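(* Let $(\mathcal X,d,\mu)$ be a non-homogeneous metric measure space (upper doubling and geometrically doubling) with dominating function $\lambda$. Let $K$ be a locally integrable function on $(\mathcal X\times\mathcal X)\setminus\{(x,x):x\in\mathcal X\}$ for which there exists a positive constant $C$ such that, for all $x,y\in\mathcal X$ with $x\neq y$, $$|K(x,y)|\le C\,\frac{d(x,y)}{\lambda(x,d(x,y))}$$ and, for all $y,y'\in\mathcal X$, $$\int_{d(x,y)\ge 2d(y,y')}\big[|K(x,y)-K(x,y')|+|K(y,x)-K(y',x)|\big]\frac{1}{d(x,y)}\,d\mu(x)\le C.$$ Let $\mathcal M$ be the Marcinkiewicz integral associated with $K$, that is, for $x\in\mathcal X$, $$\mathcal M(f)(x):=\left[\int_0^\infty\left|\int_{d(x,y)<t}K(x,y)f(y)\,d\mu(y)\right|^2\frac{dt}{t^3}\right]^{1/2}.$$ (i) If $\mathcal M$ is bounded from $H^1(\mu)$ into $L^1(\mu)$, then, for $f\in L^\infty(\mu)$, $\mathcal M(f)$ is either infinite everywhere or finite $\mu$-almost everywhere; more precisely, if $\mathcal M(f)$ is finite at some point $x_0\in\mathcal X$, then $\mathcal M(f)$ is finite $\mu$-almost everywhere and $$\|\mathcal M(f)\|_{\mathrm{RBLO}(\mu)}\le C\|f\|_{L^\infty(\mu)},$$ where the positive constant $C$ is independent of $f$. (ii) If there exists a positive constant $C$ such that, for all $f\in L^\infty_b(\mu)$, $$\|\mathcal M(f)\|_{\mathrm{RBMO}(\mu)}\le C\|f\|_{L^\infty(\mu)},$$ then $\mathcal M$ is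 bounded from $H^{1,\infty}_{\rm fin}(\mu)$ into $L^1(\mu)$.
   Context: Balls: $B(x,r):=\{y\in\mathcal X: d(x,y)<r\}$ with $x\in\mathcal X$, $r\in(0,\infty)$. A ball $B$ comes with its center $c_B$ and radius $r_B$; for $\rho\in(0,\infty)$, $\rho B:=B(c_B,\rho r_B)$. $L^\infty_b(\mu)$ is the set of all $L^\infty(\mu)$ functions with bounded support; $L^1_{\rm loc}(\mu)$ is the space of locally $\mu$-integrable functions. Non-homogeneous metric measure space: a metric space $(\mathcal X,d)$ with a Borel measure $\mu$ such that: (a) Upper doubling: there exist a dominating function $\lambda:\mathcal X\times(0,\infty)\to(0,\infty)$ and a positive constant $C_\lambda$ such that, for each $x\in\mathcal X$, $r\mapsto\lambda(x,r)$ is non-decreasing and, for all $x\in\mathcal X$ and $r\in(0,\infty)$, $\mu(B(x,r))\le\lambda(x,r)\le C_\lambda\lambda(x,r/2)$. It is always assumed in addition that, for all $x,y\in\mathcal X$ with $d(x,y)\le r$, $\lambda(x,r)\le C_\lambda\lambda(y,r)$. (b) Geometrically doubling: there exists $N_0\in\mathbb N=\{1,2,\dots\}$ such that every ball $B(x,r)\subset\mathcal X$ can be covered by at most $N_0$ balls $B(x_i,r/2)$. Coefficient $\delta$: for balls $B\subset S$, $\delta(B,S):=\int_{(2S)\setminus B}\frac{d\mu(x)}{\lambda(c_B,d(x,c_B))}$. Doubling balls: for $\alpha,\beta\in(1,\infty)$, a ball $B$ is $(\alpha,\beta)$-doubling if $\mu(\alpha B)\le\beta\mu(B)$. Let $n:=\log_2N_0$,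 $\nu:=\log_2C_\lambda$ and $\beta_\alpha:=\alpha^{3\max\{n,\nu\}}+30^n+30^\nu$. For a ball $B$, $\widetilde B^\alpha$ denotes the smallest $(\alpha,\beta_\alpha)$-doubling ball of the form $\alpha^jB$ with $j\in\mathbb N$. Atomic blocks: let $\rho\in(1,\infty)$ and $p\in(1,\infty]$. A function $b\in L^1_{\rm loc}(\mu)$ is a $(p,1)_\lambda$-atomic block if (1) there is a ball $B$ with $\operatorname{supp}(b)\subset B$; (2) $\int_{\mathcal X}b\,d\mu=0$; (3) for $j\in\{1,2\}$ there exist a function $a_j$ supported on a ball $B_j\subset B$ and $\kappa_j\in\mathbb C$ such that $b=\kappa_1a_1+\kappa_2a_2$ and $\|a_j\|_{L^p(\mu)}\le[\mu(\rho B_j)]^{1/p-1}[1+\delta(B_j,B)]^{-1}$. Set $|b|_{H^{1,p}_{\rm atb}(\mu)}:=|\kappa_1|+|\kappa_2|$. When $\mu(\mathcal X)<\infty$, the constant function $[\mu(\mathcal X)]^{-1}$ is also regarded as a $(p,1)_\lambda$-atomic block (of size $1$, so that $\|[\mu(\mathcal X)]^{-1}\|_{H^1(\mu)}\le1$). Finite atomic Hardy space: $H^{1,p}_{\rm fin}(\mu)$ is the set of all finite linear combinations of $(p,1)_\lambda$-atomic blocks, with $\|f\|_{H^{1,p}_{\rm fin}(\mu)}:=\inf\{\sum_{j=1}^N|b_j|_{H^{1,p}_{\rm atb}(\mu)}: f=\sum_{j=1}^Nb_j,\ b_j\text{ a }(p,1)_\lambda\text{-atomic block},\ N\in\mathbb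 N\}$. Atomic Hardy space: $f\in L^1(\mu)$ belongs to $H^{1,p}_{\rm atb}(\mu)$ if there exist $(p,1)_\lambda$-atomic blocks $\{b_j\}_{j\in\mathbb N}$ with $f=\sum_{j=1}^\infty b_j$ and $\sum_{j}|b_j|_{H^{1,p}_{\rm atb}(\mu)}<\infty$; the norm is the infimum of $\sum_j|b_j|_{H^{1,p}_{\rm atb}(\mu)}$ over all such decompositions. It is known that this space does not depend on $\rho\in(1,\infty)$ nor on $p\in(1,\infty]$ (with equivalent norms); it is denoted by $H^1(\mu)$. $\mathrm{RBMO}(\mu)$: let $\rho\in(1,\infty)$. $f\in L^1_{\rm loc}(\mu)$ is in $\mathrm{RBMO}(\mu)$ if there exist a positive constant $C$ and, for every ball $B$, a number $f_B$ such that $\frac1{\mu(\rho B)}\int_B|f(y)-f_B|\,d\mu(y)\le C$ for all balls $B$ and $|f_B-f_S|\le C[1+\delta(B,S)]$ for all balls $B\subset S$. $\|f\|_{\mathrm{RBMO}(\mu)}$ is the minimal such $C$. The space is known to be independent of $\rho$. $\mathrm{RBLO}(\mu)$: let $\eta,\rho\in(1,\infty)$. A real-valued $f\in L^1_{\rm loc}(\mu)$ is in $\mathrm{RBLO}(\mu)$ if there exists a non-negative constant $C$ such that, for all balls $B$, $\frac1{\mu(\eta B)}\int_B\big[f(y)-\operatorname{ess\,inf}_{\widetilde B^\rho}f\big]\,d\mu(y)\le C$ and, for all $(\rho,\beta_\rho)$-doubling balls $B\subset S$, $\operatorname{ess\,inf}_Bf-\operatorname{ess\,inf}_Sf\le C[1+\delta(B,S)]$.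 $\|f\|_{\mathrm{RBLO}(\mu)}$ is the minimal such $C$. The space is known to be independent of $\eta,\rho\in(1,\infty)$. *)

theory Defs
  imports "HOL-Probability.Essential_Supremum"
begin

text \<open>
  Functions are represented pointwise and taken modulo equality almost everywhere wherever the
  mathematics works with classes in \<open>L\<^sup>p\<close>; ``supported on \<open>A\<close>'' means vanishing outside \<open>A\<close>.
  Norms take values in \<^typ>\<open>ennreal\<close> and are \<open>\<infinity>\<close> off the corresponding space.
\<close>

section \<open>Balls\<close>

text \<open>
  A ball carries its centre and radius, which are not determined by the underlying point set.
  Inclusion of balls is inclusion of the point sets.
\<close>

type_synonym 'a metric_ball = "'a \<times> real"

definition is_ball :: "'a::metric_space metric_ball \<Rightarrow> bool" where
  "is_ball B \<longleftrightarrow> 0 < snd B"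

definition pts :: "'a::metric_space metric_ball \<Rightarrow> 'a set" where
  "pts B = ball (fst B) (snd B)"

definition dilate :: "real \<Rightarrow> 'a::metric_space metric_ball \<Rightarrow> 'a metric_ball" where
  "dilate \<rho> B = (fst B, \<rho> * snd B)"

section \<open>Non-homogeneous metric measure spaces\<close>

definition upper_doubling ::
    "'a::metric_space measure \<Rightarrow> ('a \<Rightarrow> real \<Rightarrow> real) \<Rightarrow> real \<Rightarrow> bool" where
  "upper_doubling \<mu> lam Clam \<longleftrightarrow>
     0 < Clam \<and>
     (\<forall>x. \<forall>r>0. 0 < lam x r) \<and>
     (\<forall>x. mono_on {0<..} (lam x)) \<and>
     (\<forall>x. \<forall>r>0. emeasure \<mu> (ball x r) \<le> ennreal (lam x r) \<and> lam x r \<le> Clam * lam x (r / 2)) \<and>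
     (\<forall>x y. \<forall>r>0. dist x y \<le> r \<longrightarrow> lam x r \<le> Clam * lam y r)"

definition geometrically_doubling :: "'a::metric_space itself \<Rightarrow> nat \<Rightarrow> bool" where
  "geometrically_doubling _ N0 \<longleftrightarrow>
     1 \<le> N0 \<and>
     (\<forall>x::'a. \<forall>r>0. \<exists>F. finite F \<and> card F \<le> N0 \<and> ball x r \<subseteq> (\<Union>c\<in>F. ball c (r / 2)))"

definition non_homogeneous_space ::
    "'a::metric_space measure \<Rightarrow> ('a \<Rightarrow> real \<Rightarrow> real) \<Rightarrow> real \<Rightarrow> nat \<Rightarrow> bool" where
  "non_homogeneous_space \<mu> lam Clam N0 \<longleftrightarrow>
     sets \<mu> = sets borel \<and> upper_doubling \<mu> lam Clam \<and> geometrically_doubling TYPE('a) N0"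

text \<open>
  In an upper doubling space the integrand below is bounded on the domain of integration, which
  has finite measure, so the Bochner integral is the (finite) integral that is meant.
\<close>

definition delta ::
    "'a::metric_space measure \<Rightarrow> ('a \<Rightarrow> real \<Rightarrow> real) \<Rightarrow> 'a metric_ball \<Rightarrow> 'a metric_ball \<Rightarrow> real" where
  "delta \<mu> lam B S =
     (LINT x : pts (dilate 2 S) - pts B | \<mu>. 1 / lam (fst B) (dist x (fst B)))"

definition doubling_ball ::
    "'a::metric_space measure \<Rightarrow> real \<Rightarrow> real \<Rightarrow> 'a metric_ball \<Rightarrow> bool" where
  "doubling_ball \<mu> \<alpha> \<beta> B \<longleftrightarrow>
     emeasure \<mu> (pts (dilate \<alpha> B)) \<le> ennreal \<beta> * emeasure \<mu> (pts B)"

definition beta :: "real \<Rightarrow> nat \<Rightarrow> real \<Rightarrow> real" where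
  "beta Clam N0 \<alpha> =
     (let n = log 2 (real N0); \<nu> = log 2 Clam
      in \<alpha> powr (3 * max n \<nu>) + 30 powr n + 30 powr \<nu>)"

text \<open>The exponent ranges over the positive integers.\<close>

definition tilde_ball ::
    "'a::metric_space measure \<Rightarrow> real \<Rightarrow> nat \<Rightarrow> real \<Rightarrow> 'a metric_ball \<Rightarrow> 'a metric_ball" where
  "tilde_ball \<mu> Clam N0 \<alpha> B =
     dilate (\<alpha> ^ (LEAST j. 1 \<le> j \<and> doubling_ball \<mu> \<alpha> (beta Clam N0 \<alpha>) (dilate (\<alpha> ^ j) B))) B"

section \<open>Function spaces\<close>

text \<open>Used with positive exponents only.\<close>

definition epowr :: "ennreal \<Rightarrow> real \<Rightarrow> ennreal" where
  "epowr a e = (if a = \<infinity> then \<infinity> else ennreal (enn2real a powr e))"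

definition Lp_norm :: "'a measure \<Rightarrow> ereal \<Rightarrow> ('a \<Rightarrow> complex) \<Rightarrow> ennreal" where
  "Lp_norm \<mu> p f =
     (if p = \<infinity> then esssup \<mu> (\<lambda>x. ennreal (cmod (f x)))
      else epowr (\<integral>\<^sup>+ x. ennreal (cmod (f x) powr real_of_ereal p) \<partial>\<mu>) (1 / real_of_ereal p))"

definition Linf :: "'a measure \<Rightarrow> ('a \<Rightarrow> complex) set" where
  "Linf \<mu> = {f \<in> borel_measurable \<mu>. Lp_norm \<mu> \<infinity> f < \<infinity>}"

definition Linf_b :: "'a::metric_space measure \<Rightarrow> ('a \<Rightarrow> complex) set" where
  "Linf_b \<mu> = {f \<in> Linf \<mu>. bounded {x. f x \<noteq> 0}}"

definition L1_loc ::
    "'a::metric_space measure \<Rightarrow> ('a \<Rightarrow> 'b::{banach, second_countable_topology}) set" where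
  "L1_loc \<mu> = {f. \<forall>B. is_ball B \<longrightarrow> set_integrable \<mu> (pts B) f}"

subsection \<open>Atomic Hardy spaces\<close>

text \<open>
  \<open>atomic_block \<mu> lam \<rho> p b s\<close>: \<open>b\<close> is an atomic block, with \<open>s\<close> the size
  \<open>\<bar>\<kappa>\<^sub>1\<bar> + \<bar>\<kappa>\<^sub>2\<bar>\<close> attached to one of its representations; the size depends on the
  representation, and the norms below are infima over all of them.  Blocks in the proper sense are
  closed under scalar multiplication; the same is built in for the exceptional constant block of a
  space of finite measure, without which the norms would not be homogeneous.
  If \<open>\<mu>(\<rho>B\<^sub>j) = 0\<close>, then \<open>a\<^sub>j = 0\<close> almost everywhere, and the norm estimate holds both with the
  library convention \<open>0 powr e = 0\<close> and with \<open>0 powr e = \<infinity>\<close> for negative \<open>e\<close>.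
\<close>

definition proper_atomic_block ::
    "'a::metric_space measure \<Rightarrow> ('a \<Rightarrow> real \<Rightarrow> real) \<Rightarrow> real \<Rightarrow> ereal
       \<Rightarrow> ('a \<Rightarrow> complex) \<Rightarrow> real \<Rightarrow> bool" where
  "proper_atomic_block \<mu> lam \<rho> p b s \<longleftrightarrow>
     b \<in> L1_loc \<mu> \<and>
     (\<exists>B. is_ball B \<and>
        (\<forall>x. x \<notin> pts B \<longrightarrow> b x = 0) \<and>
        (LINT x|\<mu>. b x) = 0 \<and>
        (\<exists>(a :: nat \<Rightarrow> 'a \<Rightarrow> complex) (Bs :: nat \<Rightarrow> 'a metric_ball) (\<kappa> :: nat \<Rightarrow> complex).
           (\<forall>j\<in>{1,2}.
              is_ball (Bs j) \<and> pts (Bs j) \<subseteq> pts B \<and>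
              a j \<in> borel_measurable \<mu> \<and> (\<forall>x. x \<notin> pts (Bs j) \<longrightarrow> a j x = 0) \<and>
              Lp_norm \<mu> p (a j) \<le>
                ennreal (measure \<mu> (pts (dilate \<rho> (Bs j))) powr (real_of_ereal (1 / p) - 1)
                         * inverse (1 + delta \<mu> lam (Bs j) B))) \<and>
           (\<forall>x. b x = \<kappa> 1 * a 1 x + \<kappa> 2 * a 2 x) \<and>
           s = cmod (\<kappa> 1) + cmod (\<kappa> 2)))"

definition atomic_block ::
    "'a::metric_space measure \<Rightarrow> ('a \<Rightarrow> real \<Rightarrow> real) \<Rightarrow> real \<Rightarrow> ereal
       \<Rightarrow> ('a \<Rightarrow> complex) \<Rightarrow> real \<Rightarrow> bool" where
  "atomic_block \<mu> lam \<rho> p b s \<longleftrightarrow>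
     proper_atomic_block \<mu> lam \<rho> p b s \<or>
     (emeasure \<mu> UNIV < \<infinity> \<and>
        (\<exists>\<kappa>::complex. b = (\<lambda>_. \<kappa> * of_real (inverse (measure \<mu> UNIV))) \<and> s = cmod \<kappa>))"

definition fin_decomposition ::
    "'a::metric_space measure \<Rightarrow> ('a \<Rightarrow> real \<Rightarrow> real) \<Rightarrow> real \<Rightarrow> ereal \<Rightarrow> ('a \<Rightarrow> complex)
       \<Rightarrow> nat \<Rightarrow> (nat \<Rightarrow> 'a \<Rightarrow> complex) \<Rightarrow> (nat \<Rightarrow> real) \<Rightarrow> bool" where
  "fin_decomposition \<mu> lam \<rho> p f N b s \<longleftrightarrow>
     1 \<le> N \<and> (\<forall>j<N. atomic_block \<mu> lam \<rho> p (b j) (s j)) \<and>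
     (AE x in \<mu>. f x = (\<Sum>j<N. b j x))"

definition H1_fin ::
    "'a::metric_space measure \<Rightarrow> ('a \<Rightarrow> real \<Rightarrow> real) \<Rightarrow> real \<Rightarrow> ereal \<Rightarrow> ('a \<Rightarrow> complex) set" where
  "H1_fin \<mu> lam \<rho> p =
     {f \<in> borel_measurable \<mu>. \<exists>N b s. fin_decomposition \<mu> lam \<rho> p f N b s}"

definition H1_fin_norm ::
    "'a::metric_space measure \<Rightarrow> ('a \<Rightarrow> real \<Rightarrow> real) \<Rightarrow> real \<Rightarrow> ereal
       \<Rightarrow> ('a \<Rightarrow> complex) \<Rightarrow> ennreal" where
  "H1_fin_norm \<mu> lam \<rho> p f =
     Inf {ennreal (\<Sum>j<N. s j) | N b s. fin_decomposition \<mu> lam \<rho> p f N b s}"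

text \<open>
  The series converges in \<open>L\<^sup>1\<close>; since the \<open>L\<^sup>1\<close> norm of a block is at most its size, this is the
  same as convergence almost everywhere.
\<close>

definition atb_decomposition ::
    "'a::metric_space measure \<Rightarrow> ('a \<Rightarrow> real \<Rightarrow> real) \<Rightarrow> real \<Rightarrow> ereal \<Rightarrow> ('a \<Rightarrow> complex)
       \<Rightarrow> (nat \<Rightarrow> 'a \<Rightarrow> complex) \<Rightarrow> (nat \<Rightarrow> real) \<Rightarrow> bool" where
  "atb_decomposition \<mu> lam \<rho> p f b s \<longleftrightarrow>
     (\<forall>j. atomic_block \<mu> lam \<rho> p (b j) (s j)) \<and> summable s \<and>
     (\<lambda>n. Lp_norm \<mu> 1 (\<lambda>x. f x - (\<Sum>j<n. b j x))) \<longlonglongrightarrow> 0"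

definition H1_atb ::
    "'a::metric_space measure \<Rightarrow> ('a \<Rightarrow> real \<Rightarrow> real) \<Rightarrow> real \<Rightarrow> ereal \<Rightarrow> ('a \<Rightarrow> complex) set" where
  "H1_atb \<mu> lam \<rho> p = {f. integrable \<mu> f \<and> (\<exists>b s. atb_decomposition \<mu> lam \<rho> p f b s)}"

definition H1_atb_norm ::
    "'a::metric_space measure \<Rightarrow> ('a \<Rightarrow> real \<Rightarrow> real) \<Rightarrow> real \<Rightarrow> ereal
       \<Rightarrow> ('a \<Rightarrow> complex) \<Rightarrow> ennreal" where
  "H1_atb_norm \<mu> lam \<rho> p f =
     Inf {ennreal (\<Sum>j. s j) | b s. atb_decomposition \<mu> lam \<rho> p f b s}"

subsection \<open>RBMO and RBLO\<close>

text \<open>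
  Here and below, averages are written with the denominator multiplied out, so that balls of
  measure zero impose no condition.
\<close>

definition RBMO_bound ::
    "'a::metric_space measure \<Rightarrow> ('a \<Rightarrow> real \<Rightarrow> real) \<Rightarrow> real \<Rightarrow> ('a \<Rightarrow> complex) \<Rightarrow> real \<Rightarrow> bool" where
  "RBMO_bound \<mu> lam \<rho> f C \<longleftrightarrow>
     0 < C \<and>
     (\<exists>m :: 'a metric_ball \<Rightarrow> complex.
        (\<forall>B. is_ball B \<longrightarrow>
           (\<integral>\<^sup>+ y\<in>pts B. ennreal (cmod (f y - m B)) \<partial>\<mu>)
             \<le> ennreal C * emeasure \<mu> (pts (dilate \<rho> B))) \<and>
        (\<forall>B S. is_ball B \<and> is_ball S \<and> pts B \<subseteq> pts S \<longrightarrow>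
           cmod (m B - m S) \<le> C * (1 + delta \<mu> lam B S)))"

definition RBMO ::
    "'a::metric_space measure \<Rightarrow> ('a \<Rightarrow> real \<Rightarrow> real) \<Rightarrow> real \<Rightarrow> ('a \<Rightarrow> complex) set" where
  "RBMO \<mu> lam \<rho> = {f \<in> L1_loc \<mu>. \<exists>C. RBMO_bound \<mu> lam \<rho> f C}"

definition RBMO_norm ::
    "'a::metric_space measure \<Rightarrow> ('a \<Rightarrow> real \<Rightarrow> real) \<Rightarrow> real \<Rightarrow> ('a \<Rightarrow> complex) \<Rightarrow> ennreal" where
  "RBMO_norm \<mu> lam \<rho> f = Inf {ennreal C | C. f \<in> L1_loc \<mu> \<and> RBMO_bound \<mu> lam \<rho> f C}"

definition ess_inf :: "'a measure \<Rightarrow> 'a set \<Rightarrow> ('a \<Rightarrow> real) \<Rightarrow> ereal" where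
  "ess_inf \<mu> A f = - esssup (restrict_space \<mu> A) (\<lambda>x. - ereal (f x))"

text \<open>
  The integrand in the first condition is nonnegative almost everywhere on the ball, which is
  contained in its doubling dilate; so \<^const>\<open>e2ennreal\<close> truncates nothing.  If the ball has
  positive measure and the essential infimum is \<open>-\<infinity>\<close>, the condition fails, as it should.
  In the second condition, null balls are left out, an essential infimum over a null set being
  \<open>+\<infinity>\<close>.
\<close>

definition RBLO_bound ::
    "'a::metric_space measure \<Rightarrow> ('a \<Rightarrow> real \<Rightarrow> real) \<Rightarrow> real \<Rightarrow> nat \<Rightarrow> real \<Rightarrow> real
       \<Rightarrow> ('a \<Rightarrow> real) \<Rightarrow> real \<Rightarrow> bool" where
  "RBLO_bound \<mu> lam Clam N0 \<eta> \<rho> f C \<longleftrightarrow>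
     0 \<le> C \<and>
     (\<forall>B. is_ball B \<longrightarrow>
        (\<integral>\<^sup>+ y\<in>pts B. e2ennreal (ereal (f y) - ess_inf \<mu> (pts (tilde_ball \<mu> Clam N0 \<rho> B)) f) \<partial>\<mu>)
          \<le> ennreal C * emeasure \<mu> (pts (dilate \<eta> B))) \<and>
     (\<forall>B S. is_ball B \<and> is_ball S \<and> pts B \<subseteq> pts S \<and> 0 < emeasure \<mu> (pts B) \<and>
        doubling_ball \<mu> \<rho> (beta Clam N0 \<rho>) B \<and> doubling_ball \<mu> \<rho> (beta Clam N0 \<rho>) S \<longrightarrow>
        ess_inf \<mu> (pts B) f - ess_inf \<mu> (pts S) f \<le> ereal (C * (1 + delta \<mu> lam B S)))"

definition RBLO ::
    "'a::metric_space measure \<Rightarrow> ('a \<Rightarrow> real \<Rightarrow> real) \<Rightarrow> real \<Rightarrow> nat \<Rightarrow> real \<Rightarrow> real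
       \<Rightarrow> ('a \<Rightarrow> real) set" where
  "RBLO \<mu> lam Clam N0 \<eta> \<rho> = {f \<in> L1_loc \<mu>. \<exists>C. RBLO_bound \<mu> lam Clam N0 \<eta> \<rho> f C}"

definition RBLO_norm ::
    "'a::metric_space measure \<Rightarrow> ('a \<Rightarrow> real \<Rightarrow> real) \<Rightarrow> real \<Rightarrow> nat \<Rightarrow> real \<Rightarrow> real
       \<Rightarrow> ('a \<Rightarrow> real) \<Rightarrow> ennreal" where
  "RBLO_norm \<mu> lam Clam N0 \<eta> \<rho> f =
     Inf {ennreal C | C. f \<in> L1_loc \<mu> \<and> RBLO_bound \<mu> lam Clam N0 \<eta> \<rho> f C}"

section \<open>The Marcinkiewicz integral\<close>

text \<open>
  The kernel lives off the diagonal, so its values \<open>K x x\<close> are irrelevant: they are excluded from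
  the inner integral of \<open>marcinkiewicz\<close> (which matters if \<open>\<mu>\<close> has atoms), and in the regularity
  condition they occur only for \<open>y = y'\<close>, where the integrand is zero.

  Local integrability off the diagonal is required near every point of the complement of the
  diagonal. Given the size condition, requiring integrability on bounded sets at positive distance
  from the diagonal would amount to the same.
\<close>

definition marcinkiewicz_kernel ::
    "'a::metric_space measure \<Rightarrow> ('a \<Rightarrow> real \<Rightarrow> real) \<Rightarrow> ('a \<Rightarrow> 'a \<Rightarrow> complex) \<Rightarrow> bool" where
  "marcinkiewicz_kernel \<mu> lam K \<longleftrightarrow>
     (\<forall>x y. x \<noteq> y \<longrightarrow>
        (\<exists>r>0. set_integrable (\<mu> \<Otimes>\<^sub>M \<mu>) (ball x r \<times> ball y r) (\<lambda>(u, v). K u v))) \<and>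
     (\<exists>C>0.
        (\<forall>x y. x \<noteq> y \<longrightarrow> cmod (K x y) \<le> C * (dist x y / lam x (dist x y))) \<and>
        (\<forall>y y'.
           (\<integral>\<^sup>+ x\<in>{x. 2 * dist y y' \<le> dist x y}.
              ennreal ((cmod (K x y - K x y') + cmod (K y x - K y' x)) * (1 / dist x y)) \<partial>\<mu>)
           \<le> ennreal C))"

text \<open>
  For \<open>f\<close> in \<open>L\<^sup>\<infinity>\<close> the inner integral converges absolutely for all \<open>x\<close> and \<open>t\<close>, and for \<open>f\<close> in
  \<open>L\<^sup>1\<close> it does so for almost every \<open>x\<close> and all \<open>t\<close>.
\<close>

definition marcinkiewicz ::
    "'a::metric_space measure \<Rightarrow> ('a \<Rightarrow> 'a \<Rightarrow> complex) \<Rightarrow> ('a \<Rightarrow> complex) \<Rightarrow> 'a \<Rightarrow> ennreal" where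
  "marcinkiewicz \<mu> K f x =
     epowr (\<integral>\<^sup>+ t\<in>{0<..}.
              ennreal ((cmod (LINT y : {y. y \<noteq> x \<and> dist x y < t} | \<mu>. K x y * f y))\<^sup>2 / t ^ 3) \<partial>lborel)
           (1 / 2)"

definition bounded_into_L1 ::
    "'a measure \<Rightarrow> ('a \<Rightarrow> complex) set \<Rightarrow> (('a \<Rightarrow> complex) \<Rightarrow> ennreal)
       \<Rightarrow> (('a \<Rightarrow> complex) \<Rightarrow> 'a \<Rightarrow> ennreal) \<Rightarrow> bool" where
  "bounded_into_L1 \<mu> H nrm T \<longleftrightarrow>
     (\<exists>C>0. \<forall>f\<in>H. T f \<in> borel_measurable \<mu> \<and> (\<integral>\<^sup>+ x. T f x \<partial>\<mu>) \<le> ennreal C * nrm f)"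

end

theory Submission
  imports Defs
begin

text \<open>
  The proof runs through one local estimate: for \<open>a\<close> bounded by \<open>A\<close> and supported in a ball
  \<open>B\<close>, the integral of the Marcinkiewicz integral of \<open>a\<close> over \<open>2B\<close> is at most a multiple of
  \<open>A \<mu>(\<eta>B)\<close>, for every \<open>\<eta> > 1\<close>.
  If some measure lies outside \<open>4B\<close>, there is a doubling ball \<open>D\<close> of positive measure in the
  first dyadic annulus around \<open>B\<close> that carries mass, and the coefficients \<open>\<delta>\<close> of \<open>B\<close> and
  \<open>D\<close> in a common larger ball are bounded.  Under the hypothesis of (i), subtracting from \<open>a\<close> a
  multiple of the indicator of \<open>D\<close> gives an atomic block; under that of (ii), the mean over \<open>2B\<close> is
  compared with the one over \<open>D\<close>, where the Marcinkiewicz integral of \<open>a\<close> is bounded pointwise.  Covering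
  \<open>B\<close> by small balls yields the general case.

  Off the support, the size and regularity of the kernel and Minkowski's inequality in
  \<open>L\<^sup>2(dt/t\<^sup>3)\<close> give pointwise bounds.  For (i) one splits \<open>f\<close> into a part near \<open>B\<close>, an annular
  part controlled by \<open>1 + \<delta>(B, S)\<close>, and a far part whose Marcinkiewicz integral varies boundedly
  on \<open>S\<close>; for (ii) one splits the space at \<open>2B\<^sub>j\<close> and \<open>2B\<close>.
\<close>

section \<open>The dominating function\<close>

text \<open>The correcting multiple of an indicator must meet two demands. Its ball \<open>D\<close>
  must be doubling, because the size of a block is measured by \<mu>(\<rho>D) while the mean is
  restored through \<mu>(D); and \<open>D\<close> must keep a distance from 2B, so that the
  Marcinkiewicz integral of the correction is bounded pointwise there. Neither can be arranged when
  all mass lies in 4B. At a suitable smaller scale no ball of four times the radius carries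
  everything, unless the measure sits at one point; in that case the Marcinkiewicz integral vanishes
  almost everywhere. The same covering replaces the enlargement brought in by the hypothesis
  (\<open>max \<rho> 2\<close> or \<open>2 * \<rho>\<close>) by any \<eta> > 1. This freedom
  matters: atoms are normalised with their own parameter, and the RBLO conditions spend \<eta> or
  \<rho> in two steps of size \<open>sqrt\<close>. Since the test functions are bounded, the
  corrected function is a block for every p at once, so no equivalence between Hardy spaces has to
  be invoked.\<close>

locale nonhomogeneous =
  fixes \<mu> :: "'a::metric_space measure"
    and lam :: "'a \<Rightarrow> real \<Rightarrow> real"
    and Clam :: real
    and N0 :: nat
  assumes space: "non_homogeneous_space \<mu> lam Clam N0"
begin

lemma sets_mu [measurable_cong]: "sets \<mu> = sets borel"
  using space by (simp add: non_homogeneous_space_def)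

lemma space_mu [simp]: "space \<mu> = UNIV"
  using sets_eq_imp_space_eq[OF sets_mu] by simp

lemma lam_pos: "0 < r \<Longrightarrow> 0 < lam x r"
  using space by (simp add: non_homogeneous_space_def upper_doubling_def)

lemma lam_mono: "0 < r \<Longrightarrow> r \<le> R \<Longrightarrow> lam x r \<le> lam x R"
  using space by (auto simp add: non_homogeneous_space_def upper_doubling_def mono_on_def)

lemma emeasure_ball_le_lam: "0 < r \<Longrightarrow> emeasure \<mu> (ball x r) \<le> ennreal (lam x r)"
  using space by (simp add: non_homogeneous_space_def upper_doubling_def)

lemma lam_half: "0 < r \<Longrightarrow> lam x r \<le> Clam * lam x (r / 2)"
  using space by (simp add: non_homogeneous_space_def upper_doubling_def)

lemma lam_center: "0 < r \<Longrightarrow> dist x y \<le> r \<Longrightarrow> lam x r \<le> Clam * lam y r"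
  using space by (simp add: non_homogeneous_space_def upper_doubling_def)

lemma Clam_ge_1: "1 \<le> Clam"
proof -
  have "lam undefined 1 \<le> Clam * lam undefined 1"
    by (rule lam_center) auto
  with lam_pos[of 1 undefined] show ?thesis by simp
qed

lemma emeasure_ball_finite: "emeasure \<mu> (ball x r) < \<infinity>"
proof (cases "0 < r")
  case True
  then show ?thesis using emeasure_ball_le_lam[of r x] by (simp add: le_less_trans)
next
  case False
  then have e: "ball x r = {}" by simp
  show ?thesis unfolding e by simp
qed

lemma emeasure_ball_not_top [simp]: "emeasure \<mu> (ball x r) \<noteq> top"
  using emeasure_ball_finite[of x r] by simp

lemma measure_ball: "emeasure \<mu> (ball x r) = ennreal (measure \<mu> (ball x r))"
  by (rule emeasure_eq_ennreal_measure) simp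

lemma sigma_finite_mu: "sigma_finite_measure \<mu>"
proof
  show "\<exists>A::'a set set. countable A \<and> A \<subseteq> sets \<mu> \<and> \<Union>A = space \<mu> \<and> (\<forall>a\<in>A. emeasure \<mu> a \<noteq> \<infinity>)"
  proof (intro exI conjI)
    let ?A = "range (\<lambda>n::nat. ball (undefined::'a) (real n))"
    show "countable ?A" by simp
    show "?A \<subseteq> sets \<mu>" by (auto simp: sets_mu)
    show "\<Union>?A = space \<mu>" using reals_Archimedean2 by auto
    show "\<forall>a\<in>?A. emeasure \<mu> a \<noteq> \<infinity>" by simp
  qed
qed

sublocale sigma_finite_measure \<mu>
  by (rule sigma_finite_mu)

text \<open>Bounds the growth of \<open>lam x\<close> when the radius is multiplied by u \<ge> 1.
  The exponent is the \<nu> of the doubling constant; the leading \<open>Clam\<close> pays for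
  rounding log 2 u up to an integer number of doublings.\<close>

definition growth :: "real \<Rightarrow> real" where
  "growth u = Clam * u powr (log 2 Clam)"

lemma nu_nonneg: "0 \<le> log 2 Clam"
  using Clam_ge_1 by simp

lemma growth_nonneg [simp]: "0 \<le> growth u"
  using Clam_ge_1 by (simp add: growth_def)

lemma lam_pow2: "0 < r \<Longrightarrow> lam x (2 ^ k * r) \<le> Clam ^ k * lam x r"
proof (induction k)
  case (Suc k)
  have "lam x (2 ^ Suc k * r) \<le> Clam * lam x (2 ^ k * r)"
    using lam_half[of "2 ^ Suc k * r" x] Suc.prems by simp
  also have "\<dots> \<le> Clam * (Clam ^ k * lam x r)"
    using Suc Clam_ge_1 by (intro mult_left_mono) auto
  finally show ?case by (simp add: mult.assoc)
qed simp

lemma lam_growth: "0 < r \<Longrightarrow> r \<le> R \<Longrightarrow> lam x R \<le> growth (R / r) * lam x r"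
proof -
  assume r: "0 < r" "r \<le> R"
  define k where "k = nat \<lceil>log 2 (R / r)\<rceil>"
  have l: "0 \<le> log 2 (R / r)" using r by simp
  have "log 2 (R / r) \<le> real k" "real k \<le> log 2 (R / r) + 1"
    unfolding k_def using l by linarith+
  then have "R / r \<le> 2 powr real k"
    using r by (subst (asm) log_le_iff) (auto)
  then have "R \<le> 2 ^ k * r"
    using r by (simp add: powr_realpow field_simps)
  then have "lam x R \<le> lam x (2 ^ k * r)"
    using r by (intro lam_mono) auto
  also have "\<dots> \<le> Clam ^ k * lam x r"
    by (rule lam_pow2[OF r(1)])
  also have "Clam ^ k \<le> growth (R / r)"
  proof -
    have "Clam ^ k = Clam powr real k"
      using Clam_ge_1 by (simp add: powr_realpow)
    also have "\<dots> \<le> Clam powr (log 2 (R / r) + 1)"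
      using Clam_ge_1 \<open>real k \<le> _\<close> by (intro powr_mono) auto
    also have "\<dots> = Clam * Clam powr (log 2 (R / r))"
      using Clam_ge_1 by (simp add: powr_add)
    also have "Clam powr (log 2 (R / r)) = (R / r) powr (log 2 Clam)"
      using r Clam_ge_1 by (simp add: powr_def log_def mult.commute)
    finally show ?thesis by (simp add: growth_def)
  qed
  finally show ?thesis using lam_pos[OF r(1), of x] by (simp add: mult_right_mono)
qed

text \<open>The radius \<open>M * v\<close> exceeds both u and the distance of the centres. There
  the centre may be moved from c to x; afterwards the radius is shrunk back to v.\<close>

lemma lam_compare:
  assumes "0 < u" "0 < v" "u \<le> M * v" "1 \<le> M" "dist c x \<le> M * v"
  shows "lam c u \<le> Clam * growth M * lam x v"
proof -
  have v: "v \<le> M * v" using assms by simp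
  have "lam c u \<le> lam c (M * v)" using assms by (intro lam_mono) auto
  also have "\<dots> \<le> Clam * lam x (M * v)" using assms by (intro lam_center) auto
  also have "\<dots> \<le> Clam * (growth (M * v / v) * lam x v)"
    using v assms Clam_ge_1 by (intro mult_left_mono lam_growth) auto
  finally show ?thesis using assms by simp
qed

text \<open>Nothing is assumed about \<open>lam x 0\<close>, hence the case distinction.\<close>

definition wt :: "'a \<Rightarrow> 'a \<Rightarrow> real" where
  "wt x y = (if y = x then 0 else 1 / lam x (dist x y))"

abbreviation wt_int :: "'a \<Rightarrow> 'a set \<Rightarrow> ennreal" where
  "wt_int x S \<equiv> \<integral>\<^sup>+ y. ennreal (wt x y) * indicator S y \<partial>\<mu>"

abbreviation annulus :: "'a \<Rightarrow> real \<Rightarrow> real \<Rightarrow> 'a set" where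
  "annulus x s S \<equiv> {y. s \<le> dist x y \<and> dist x y < S}"

section \<open>Integrals of the reciprocal dominating function over annuli\<close>

lemma wt_nonneg [simp]: "0 \<le> wt x y"
  using lam_pos[of "dist x y" x] by (auto simp: wt_def)

lemma measurable_dist_left [measurable]: "(\<lambda>y. dist x y) \<in> borel_measurable (borel :: 'a measure)"
  by (intro borel_measurable_continuous_onI continuous_intros)

lemma wt_measurable [measurable]: "wt x \<in> borel_measurable borel"
proof -
  define h where "h t = (if t \<le> 0 then 0 else lam x t)" for t
  have "mono h"
  proof (rule monoI)
    fix s t :: real assume "s \<le> t"
    then show "h s \<le> h t"
      using lam_pos[of t x] lam_mono[of s t x] by (auto simp: h_def)
  qed
  then have [measurable]: "h \<in> borel_measurable borel"
    by (rule borel_measurable_mono)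
  have "wt x = (\<lambda>y. if dist x y = 0 then 0 else 1 / h (dist x y))"
    by (auto simp: fun_eq_iff wt_def h_def)
  also have "\<dots> \<in> borel_measurable borel" by measurable
  finally show ?thesis .
qed

lemma wt_le: "0 < s \<Longrightarrow> s \<le> dist x y \<Longrightarrow> wt x y \<le> 1 / lam x s"
  unfolding wt_def using lam_pos[of s x] lam_mono[of s "dist x y" x]
  by (auto intro!: divide_left_mono mult_pos_pos)

lemma wt_compare:
  assumes "0 < dist x y" "1 \<le> M" "dist c z \<le> M * dist x y" "dist c x \<le> M * dist x y"
  shows "c \<noteq> z \<Longrightarrow> wt x y \<le> Clam * growth M * wt c z"
proof -
  assume cz: "c \<noteq> z"
  have "lam c (dist c z) \<le> Clam * growth M * lam x (dist x y)"
    using assms cz by (intro lam_compare) auto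
  moreover have "0 < lam c (dist c z)" "0 < lam x (dist x y)" using assms cz lam_pos by auto
  ultimately show ?thesis using assms cz by (auto simp: wt_def field_simps)
qed

text \<open>The weight is at most 1 / \<open>lam x s\<close> and the measure at most
  \<open>lam x S\<close>, so an annulus costs no more than the growth of \<open>lam\<close> across
  it. Annuli of bounded ratio therefore cost a bounded amount, however the measure is
  distributed.\<close>

lemma annulus_wt:
  assumes "0 < s" "s \<le> S"
  shows "wt_int x (annulus x s S)
           \<le> ennreal (growth (S / s))"
proof -
  have "wt_int x (annulus x s S)
      \<le> (\<integral>\<^sup>+ y. ennreal (1 / lam x s) * indicator (ball x S) y \<partial>\<mu>)"
    using assms by (intro nn_integral_mono) (auto simp: indicator_def intro!: ennreal_leI wt_le)
  also have "\<dots> = ennreal (1 / lam x s) * emeasure \<mu> (ball x S)"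
    by (subst nn_integral_cmult_indicator) (auto simp: sets_mu)
  also have "\<dots> \<le> ennreal (1 / lam x s) * ennreal (growth (S / s) * lam x s)"
    using assms emeasure_ball_le_lam[of S x] lam_growth[OF assms, of x]
    by (intro mult_left_mono) (auto intro: order_trans ennreal_leI)
  also have "\<dots> = ennreal (growth (S / s))"
    using lam_pos[of s x] assms by (subst ennreal_mult[symmetric]) auto
  finally show ?thesis .
qed

text \<open>Every annulus of ratio 2 costs at most \<open>growth 2\<close>, so geometric decay of h
  along annuli gives a geometric series. The radii \<open>R k\<close> are left free in order to
  cover both annuli shrinking to x and annuli going to infinity.\<close>

lemma dyadic_sum_bound:
  fixes h :: "'a \<Rightarrow> real" and q :: real
  assumes q: "0 \<le> q" "q < 1" and "0 \<le> A" and R: "\<And>k. 0 < R k"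
    and h: "\<And>y. 0 \<le> h y"
    and cov: "\<And>y. 0 < h y \<Longrightarrow> y \<noteq> x \<Longrightarrow> \<exists>k. R k \<le> dist x y \<and> dist x y < 2 * R k \<and> h y \<le> A * q ^ k"
  shows "(\<integral>\<^sup>+ y. ennreal (h y * wt x y) \<partial>\<mu>) \<le> ennreal (A * growth 2 / (1 - q))"
proof -
  let ?I = "\<lambda>k. (annulus x (R k) (2 * R k))"
  have meas: "(\<lambda>y. ennreal (A * q ^ k) * (ennreal (wt x y) * indicator (?I k) y)) \<in> borel_measurable \<mu>" for k
    by measurable
  have "(\<integral>\<^sup>+ y. ennreal (h y * wt x y) \<partial>\<mu>)
      \<le> (\<integral>\<^sup>+ y. (\<Sum>k. ennreal (A * q ^ k) * (ennreal (wt x y) * indicator (?I k) y)) \<partial>\<mu>)"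
  proof (intro nn_integral_mono)
    fix y
    show "ennreal (h y * wt x y) \<le> (\<Sum>k. ennreal (A * q ^ k) * (ennreal (wt x y) * indicator (?I k) y))"
    proof (cases "0 < h y \<and> y \<noteq> x")
      case False
      then have "h y = 0 \<or> wt x y = 0" using h[of y] by (auto simp: wt_def)
      then have e: "h y * wt x y = 0" by auto
      show ?thesis unfolding e by simp
    next
      case True
      with cov obtain k where k: "R k \<le> dist x y" "dist x y < 2 * R k" "h y \<le> A * q ^ k" by blast
      have "ennreal (h y * wt x y) \<le> ennreal (A * q ^ k * wt x y)"
        using k by (intro ennreal_leI mult_right_mono) auto
      also have "\<dots> = ennreal (A * q ^ k) * (ennreal (wt x y) * indicator (?I k) y)"
        using k assms by (simp add: ennreal_mult)
      also have "\<dots> \<le> (\<Sum>k. ennreal (A * q ^ k) * (ennreal (wt x y) * indicator (?I k) y))"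
        using sum_le_suminf[of "\<lambda>k. ennreal (A * q ^ k) * (ennreal (wt x y) * indicator (?I k) y)" "{k}"]
        by simp
      finally show ?thesis .
    qed
  qed
  also have "\<dots> = (\<Sum>k. \<integral>\<^sup>+ y. ennreal (A * q ^ k) * (ennreal (wt x y) * indicator (?I k) y) \<partial>\<mu>)"
    by (rule nn_integral_suminf) (rule meas)
  also have "\<dots> = (\<Sum>k. ennreal (A * q ^ k) * wt_int x (?I k))"
    by (subst nn_integral_cmult) auto
  also have "\<dots> \<le> (\<Sum>k. ennreal (A * q ^ k) * ennreal (growth 2))"
  proof (intro suminf_le mult_left_mono)
    fix k
    have "wt_int x (?I k) \<le> ennreal (growth (2 * R k / R k))"
      using R[of k] by (intro annulus_wt) auto
    then show "wt_int x (?I k) \<le> ennreal (growth 2)"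
      using R[of k] by simp
  qed auto
  also have "\<dots> = (\<Sum>k. ennreal ((A * growth 2) * q ^ k))"
    using assms by (intro suminf_cong) (simp add: ennreal_mult[symmetric] mult_ac)
  also have "\<dots> = ennreal (\<Sum>k. (A * growth 2) * q ^ k)"
    using assms by (intro suminf_ennreal2) (auto intro!: summable_mult summable_geometric)
  also have "(\<Sum>k. (A * growth 2) * q ^ k) = A * growth 2 / (1 - q)"
    using q by (subst suminf_mult) (auto simp: suminf_geometric summable_geometric)
  finally show ?thesis .
qed

lemma dyadic_scale:
  fixes t :: real
  assumes "1 \<le> t"
  obtains k :: nat where "2 ^ k \<le> t" "t < 2 ^ Suc k"
proof -
  define k where "k = nat \<lfloor>log 2 t\<rfloor>"
  have "0 \<le> log 2 t" using assms by simp
  then have "real k \<le> log 2 t" "log 2 t < real (Suc k)"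
    unfolding k_def by linarith+
  then have "2 powr real k \<le> t" "t < 2 powr real (Suc k)"
    using assms by (auto simp: le_log_iff log_less_iff)
  then show ?thesis by (intro that[of k]) (auto simp: powr_realpow simp del: of_nat_Suc)
qed

text \<open>The factor \<open>dist x y\<close> halves from one annulus to the next towards x and so
  makes up for the singularity of the weight.\<close>

lemma near_wt:
  assumes "0 < R"
  shows "(\<integral>\<^sup>+ y. ennreal (dist x y * wt x y) * indicator {y. dist x y < R} y \<partial>\<mu>)
           \<le> ennreal (2 * growth 2 * R)"
proof -
  have "(\<integral>\<^sup>+ y. ennreal (dist x y * wt x y) * indicator {y. dist x y < R} y \<partial>\<mu>)
     = (\<integral>\<^sup>+ y. ennreal ((dist x y * indicator {y. dist x y < R} y) * wt x y) \<partial>\<mu>)"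
    by (intro nn_integral_cong) (auto simp: indicator_def)
  also have "\<dots> \<le> ennreal (R * growth 2 / (1 - 1/2))"
  proof (rule dyadic_sum_bound[where R="\<lambda>k. R / 2 ^ Suc k" and q="1/2" and A=R])
    fix y assume y: "0 < dist x y * indicator {y. dist x y < R} y" "y \<noteq> x"
    then have d: "0 < dist x y" "dist x y < R" by (cases "dist x y < R"; auto)+
    obtain k :: nat where k: "2 ^ k \<le> R / dist x y" "R / dist x y < 2 ^ Suc k"
      using dyadic_scale[of "R / dist x y"] d by (auto simp: field_simps)
    then show "\<exists>k. R / 2 ^ Suc k \<le> dist x y \<and> dist x y < 2 * (R / 2 ^ Suc k) \<and>
         dist x y * indicator {y. dist x y < R} y \<le> R * (1 / 2) ^ k"
      using d k
    proof (cases "2 ^ k = R / dist x y")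
      case False
      then show ?thesis using k d by (intro exI[of _ k]) (auto simp: field_simps power_divide)
    next
      \<comment> \<open>Annuli contain their inner radius but not the outer one. A distance equal to
        R / 2^k thus belongs to the annulus of index k - 1, which exists because the distance is
        less than R.\<close>
      case True
      then have kd: "dist x y = R / 2 ^ k" using d by (simp add: field_simps)
      have "k \<noteq> 0" using kd d by (cases k; auto)
      then obtain j where j: "k = Suc j" by (cases k) auto
      show ?thesis
        using kd d j assms by (intro exI[of _ j]) (auto simp: field_simps power_divide)
    qed
  qed (use assms in auto)
  finally show ?thesis by (simp add: mult_ac)
qed

text \<open>The square root gains sqrt (1/2) per annulus; the rational bound 3/4 for it sums to 4.
  This decay is what a time window of bounded length leaves after Minkowski's inequality.\<close>

lemma far_wt:
  assumes "0 < R"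
  shows "(\<integral>\<^sup>+ y. ennreal (sqrt (R / dist x y) * wt x y) * indicator {y. R \<le> dist x y} y \<partial>\<mu>)
           \<le> ennreal (4 * growth 2)"
proof -
  have s: "sqrt (1/2) \<le> 3/4" by (rule real_le_lsqrt) (auto simp: power2_eq_square)
  have "(\<integral>\<^sup>+ y. ennreal (sqrt (R / dist x y) * wt x y) * indicator {y. R \<le> dist x y} y \<partial>\<mu>)
     = (\<integral>\<^sup>+ y. ennreal ((sqrt (R / dist x y) * indicator {y. R \<le> dist x y} y) * wt x y) \<partial>\<mu>)"
    by (intro nn_integral_cong) (auto simp: indicator_def)
  also have "\<dots> \<le> ennreal (1 * growth 2 / (1 - 3/4))"
  proof (rule dyadic_sum_bound[where R="\<lambda>k. R * 2 ^ k" and q="3/4" and A=1])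
    fix y assume y: "0 < sqrt (R / dist x y) * indicator {y. R \<le> dist x y} y" "y \<noteq> x"
    then have d: "0 < dist x y" "R \<le> dist x y" by (cases "R \<le> dist x y"; auto)+
    obtain k :: nat where k: "2 ^ k \<le> dist x y / R" "dist x y / R < 2 ^ Suc k"
      using dyadic_scale[of "dist x y / R"] d assms by (auto simp: field_simps)
    have "R / dist x y \<le> (1/2) ^ k" using k d assms by (simp add: field_simps power_divide)
    then have "sqrt (R / dist x y) \<le> sqrt ((1/2) ^ k)" by simp
    also have "\<dots> = (sqrt (1/2)) ^ k" by (simp add: real_sqrt_power)
    also have "\<dots> \<le> (3/4) ^ k" using s by (intro power_mono) auto
    finally show "\<exists>k. R * 2 ^ k \<le> dist x y \<and> dist x y < 2 * (R * 2 ^ k) \<and>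
         sqrt (R / dist x y) * indicator {y. R \<le> dist x y} y \<le> 1 * (3/4) ^ k"
      using d k assms by (intro exI[of _ k]) (auto simp: field_simps indicator_def)
  qed (use assms in \<open>auto simp: indicator_def\<close>)
  finally show ?thesis by (simp add: mult_ac)
qed

end

section \<open>The weighted norm in the time variable\<close>

abbreviation tw :: "real \<Rightarrow> ennreal" where
  "tw t \<equiv> ennreal (1 / t ^ 3) * indicator {0<..} t"

text \<open>The norm of L2(dt/t^3) on the half line, with extended values, so that it can be
  estimated before anything is known to be finite.\<close>

definition tnorm :: "(real \<Rightarrow> ennreal) \<Rightarrow> ennreal" where
  "tnorm q = epowr (\<integral>\<^sup>+ t. q t ^ 2 * tw t \<partial>lborel) (1 / 2)"

lemma epowr_half_square: "(epowr a (1 / 2))\<^sup>2 = a"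
proof (cases a)
  case (real r)
  then have "(r powr (1 / 2))\<^sup>2 = r" by (simp add: powr_half_sqrt)
  with real show ?thesis by (simp add: epowr_def ennreal_power)
next
  case top
  then show ?thesis by (simp add: epowr_def power2_eq_square)
qed

lemma ennreal_square_le: "(a::ennreal)\<^sup>2 \<le> b\<^sup>2 \<Longrightarrow> a \<le> b"
proof (cases a b rule: ennreal2_cases)
  case (real_real r s)
  then show "a\<^sup>2 \<le> b\<^sup>2 \<Longrightarrow> a \<le> b" by (auto simp: ennreal_power intro: power2_le_imp_le)
qed (auto simp: power2_eq_square ennreal_top_mult top_unique ennreal_mult_eq_top_iff)

lemma tnorm_square: "(tnorm q)\<^sup>2 = (\<integral>\<^sup>+ t. q t ^ 2 * tw t \<partial>lborel)"
  by (simp add: tnorm_def epowr_half_square)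

lemma tnorm_leI:
  "(\<integral>\<^sup>+ t. q t ^ 2 * tw t \<partial>lborel) \<le> b\<^sup>2 \<Longrightarrow> tnorm q \<le> b"
  by (rule ennreal_square_le) (simp add: tnorm_square)

lemma tnorm_mono: "(\<And>t. 0 < t \<Longrightarrow> q t \<le> q' t) \<Longrightarrow> tnorm q \<le> tnorm q'"
proof (rule tnorm_leI, subst tnorm_square, rule nn_integral_mono)
  fix t assume "\<And>t. 0 < t \<Longrightarrow> q t \<le> q' t"
  then show "(q t)\<^sup>2 * tw t
      \<le> (q' t)\<^sup>2 * tw t"
    by (cases "0 < t") (auto intro!: mult_right_mono power_mono)
qed

text \<open>Young's inequality, from (s a - b)^2 \<ge> 0. The parameter s is free so that it can be
  optimised in the triangle inequality.\<close>

lemma square_add_le_ennreal: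
  assumes "0 < s"
  shows "((a::ennreal) + b)\<^sup>2 \<le> ennreal (1 + s) * a\<^sup>2 + ennreal (1 + 1 / s) * b\<^sup>2"
proof (cases a b rule: ennreal2_cases)
  case (real_real r t)
  have "0 \<le> (s * r - t)\<^sup>2 / s" using assms by simp
  also have "\<dots> = s * r\<^sup>2 + t\<^sup>2 / s - 2 * r * t"
    using assms by (simp add: power2_eq_square field_simps)
  finally have "(r + t)\<^sup>2 \<le> (1 + s) * r\<^sup>2 + (1 + 1 / s) * t\<^sup>2"
    by (simp add: power2_eq_square field_simps)
  then have "ennreal ((r + t)\<^sup>2) \<le> ennreal ((1 + s) * r\<^sup>2 + (1 + 1 / s) * t\<^sup>2)"
    by (rule ennreal_leI)
  also have "\<dots> = ennreal (1 + s) * a\<^sup>2 + ennreal (1 + 1 / s) * b\<^sup>2"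
    using real_real assms by (simp add: ennreal_power ennreal_mult)
  also have "ennreal ((r + t)\<^sup>2) = (a + b)\<^sup>2"
    unfolding real_real(2,4) using real_real(1,3)
    by (subst ennreal_plus[symmetric]) (auto simp: ennreal_power simp del: ennreal_plus)
  finally show ?thesis .
qed (use assms in \<open>auto simp: power2_eq_square ennreal_top_mult ennreal_mult_top\<close>)

text \<open>With s the quotient of the two norms, Young's inequality integrates to the square of
  their sum. Both norms are first raised by e / 2, which keeps the quotient defined and positive
  when one of them is zero.\<close>

lemma tnorm_triangle:
  assumes [measurable]: "q \<in> borel_measurable borel" "q' \<in> borel_measurable borel"
  shows "tnorm (\<lambda>t. q t + q' t) \<le> tnorm q + tnorm q'"
proof (cases "tnorm q" "tnorm q'" rule: ennreal2_cases)
  case (real_real a b)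
  have *: "tnorm (\<lambda>t. q t + q' t) \<le> ennreal (a + b) + ennreal e" if "0 < e" for e
  proof -
    define p where "p = a + e / 2"
    define r where "r = b + e / 2"
    have pos: "0 < p" "0 < r" using real_real that by (auto simp: p_def r_def add_nonneg_pos)
    define s where "s = r / p"
    have s: "0 < s" using pos by (simp add: s_def)
    have "(\<integral>\<^sup>+ t. (q t + q' t) ^ 2 * tw t \<partial>lborel)
       \<le> (\<integral>\<^sup>+ t. ennreal (1 + s) * (q t ^ 2 * tw t)
            + ennreal (1 + 1 / s) * (q' t ^ 2 * tw t) \<partial>lborel)"
      by (intro nn_integral_mono order_trans[OF mult_right_mono[OF square_add_le_ennreal[OF s]]])
         (auto simp: distrib_right mult.assoc)
    also have "\<dots> = ennreal (1 + s) * (tnorm q)\<^sup>2 + ennreal (1 + 1 / s) * (tnorm q')\<^sup>2"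
      unfolding tnorm_square by (subst nn_integral_add, measurable) (simp add: nn_integral_cmult)
    also have "\<dots> = ennreal ((1 + s) * a\<^sup>2 + (1 + 1 / s) * b\<^sup>2)"
      using real_real s by (simp add: ennreal_power ennreal_mult)
    also have "\<dots> \<le> ennreal ((p + r)\<^sup>2)"
    proof (rule ennreal_leI)
      have "(1 + s) * a\<^sup>2 + (1 + 1 / s) * b\<^sup>2 \<le> (1 + s) * p\<^sup>2 + (1 + 1 / s) * r\<^sup>2"
        using s real_real that by (intro add_mono mult_left_mono power_mono) (auto simp: p_def r_def)
      also have "\<dots> = (p + r)\<^sup>2"
        unfolding s_def using pos by (simp add: power2_eq_square field_simps)
      finally show "(1 + s) * a\<^sup>2 + (1 + 1 / s) * b\<^sup>2 \<le> (p + r)\<^sup>2" .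
    qed
    also have "\<dots> = (ennreal (p + r))\<^sup>2" using pos by (subst ennreal_power) auto
    finally have "tnorm (\<lambda>t. q t + q' t) \<le> ennreal (p + r)" by (rule tnorm_leI)
    also have "p + r = a + b + e" by (simp add: p_def r_def)
    finally show ?thesis using real_real that by simp
  qed
  show ?thesis
    using ennreal_le_epsilon[OF *] real_real by (simp add: ennreal_plus)
qed auto

lemma tnorm_Minkowski:
  fixes g W :: "'b \<Rightarrow> ennreal" and I :: "'b \<Rightarrow> real \<Rightarrow> bool"
  assumes "sigma_finite_measure M"
    and [measurable]: "g \<in> borel_measurable M" "W \<in> borel_measurable M"
      "Measurable.pred (M \<Otimes>\<^sub>M borel) (\<lambda>(y, t). I y t)"
    and W: "\<And>y. g y \<noteq> 0 \<Longrightarrow>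
      (\<integral>\<^sup>+ t. indicator {t. I y t} t * tw t \<partial>lborel) \<le> (W y)\<^sup>2"
  shows "tnorm (\<lambda>t. \<integral>\<^sup>+ y. g y * indicator {y. I y t} y \<partial>M) \<le> (\<integral>\<^sup>+ y. g y * W y \<partial>M)"
proof (rule tnorm_leI)
  interpret sigma_finite_measure M by fact
  interpret P: pair_sigma_finite M lborel ..
  define k :: "real \<Rightarrow> ennreal" where "k t = ennreal (1 / t ^ 3) * indicator {0<..} t" for t
  have [measurable]: "k \<in> borel_measurable borel" unfolding k_def by measurable
  define h :: "'b \<Rightarrow> real \<Rightarrow> ennreal" where "h y t = (if I y t then g y else 0)" for y t
  have h_eq: "g y * indicator {y. I y t} y = h y t" for y t by (simp add: h_def indicator_def)
  have [measurable]: "(\<lambda>p. h (fst p) (snd p)) \<in> borel_measurable (M \<Otimes>\<^sub>M lborel)"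
  proof -
    have "(\<lambda>p. if (case p of (y, t) \<Rightarrow> I y t) then g (fst p) else 0) \<in> borel_measurable (M \<Otimes>\<^sub>M lborel)"
      by measurable
    then show ?thesis by (simp add: h_def case_prod_beta)
  qed
  have hm[measurable]: "(\<lambda>y. h y t) \<in> borel_measurable M" for t
    using measurable_compose[OF measurable_Pair2'[of t lborel M], of "\<lambda>p. h (fst p) (snd p)" borel]
    by simp
  have hm2[measurable]: "h y \<in> borel_measurable lborel" if "y \<in> space M" for y
    using measurable_compose[OF measurable_Pair1'[of y M lborel], of "\<lambda>p. h (fst p) (snd p)" borel] that
    by simp
  define G where "G t = (\<integral>\<^sup>+ y. h y t \<partial>M)" for t
  have [measurable]: "G \<in> borel_measurable lborel"
  proof -
    have "(\<lambda>p. h (snd p) (fst p)) \<in> borel_measurable (lborel \<Otimes>\<^sub>M M)"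
      using measurable_compose[OF measurable_pair_swap', of "\<lambda>p. h (fst p) (snd p)" M lborel borel]
      by (simp add: case_prod_beta)
    then show ?thesis
      unfolding G_def using borel_measurable_nn_integral[of "\<lambda>t y. h y t" lborel]
      by (simp add: case_prod_beta)
  qed
  have key: "(\<integral>\<^sup>+ t. h y t * h y' t * k t \<partial>lborel) \<le> (g y * W y) * (g y' * W y')"
    if y: "y \<in> Sigma_Algebra.space M" "y' \<in> Sigma_Algebra.space M" for y y'
  proof (cases "g y = 0 \<or> g y' = 0")
    case True
    then have z: "h y t * h y' t * k t = 0" for t by (auto simp: h_def)
    show ?thesis unfolding z by simp
  next
    case False
    \<comment> \<open>The intersection lies in either set, so its weight is at most the smaller of
      the two squares, and that is at most the product.\<close>
    have le: "(\<integral>\<^sup>+ t. indicator {t. I y t \<and> I y' t} t * k t \<partial>lborel) \<le> W y * W y'"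
    proof -
      have 1: "(\<integral>\<^sup>+ t. indicator {t. I y t \<and> I y' t} t * k t \<partial>lborel) \<le> (W y)\<^sup>2"
        by (rule order_trans[OF nn_integral_mono W[of y]])
           (use False in \<open>auto simp: k_def indicator_def\<close>)
      have 2: "(\<integral>\<^sup>+ t. indicator {t. I y t \<and> I y' t} t * k t \<partial>lborel) \<le> (W y')\<^sup>2"
        by (rule order_trans[OF nn_integral_mono W[of y']])
           (use False in \<open>auto simp: k_def indicator_def\<close>)
      show ?thesis
      proof (cases "W y \<le> W y'")
        case True
        then have "(W y)\<^sup>2 \<le> W y * W y'" by (simp add: power2_eq_square mult_left_mono)
        with 1 show ?thesis by (rule order_trans)
      next
        case False
        then have "(W y')\<^sup>2 \<le> W y * W y'" by (simp add: power2_eq_square mult_right_mono)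
        with 2 show ?thesis by (rule order_trans)
      qed
    qed
    have [measurable]: "Measurable.pred lborel (I y)" if "y \<in> Sigma_Algebra.space M" for y
      using measurable_compose[OF measurable_Pair1'[OF that, of borel] assms(4)] by simp
    note [measurable] = this[OF y(1)] this[OF y(2)]
    have "(\<integral>\<^sup>+ t. h y t * h y' t * k t \<partial>lborel)
       \<le> (\<integral>\<^sup>+ t. (g y * g y') * (indicator {t. I y t \<and> I y' t} t * k t) \<partial>lborel)"
      by (intro nn_integral_mono) (auto simp: h_def indicator_def)
    also have "\<dots> = (g y * g y') * (\<integral>\<^sup>+ t. indicator {t. I y t \<and> I y' t} t * k t \<partial>lborel)"
      by (rule nn_integral_cmult) measurable
    also have "\<dots> \<le> (g y * g y') * (W y * W y')" by (intro mult_left_mono le) auto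
    finally show ?thesis by (simp add: mult_ac)
  qed
  have "(\<integral>\<^sup>+ t. (\<integral>\<^sup>+ y. g y * indicator {y. I y t} y \<partial>M)\<^sup>2 * tw t \<partial>lborel)
     = (\<integral>\<^sup>+ t. (\<integral>\<^sup>+ y. h y t * (G t * k t) \<partial>M) \<partial>lborel)"
    unfolding h_eq by (intro nn_integral_cong)
      (subst nn_integral_multc, auto simp: G_def power2_eq_square k_def mult.assoc)
  also have "\<dots> = (\<integral>\<^sup>+ y. (\<integral>\<^sup>+ t. h y t * (G t * k t) \<partial>lborel) \<partial>M)"
    using P.Fubini'[of "\<lambda>y t. h y t * (G t * k t)"] by (simp add: case_prod_beta)
  also have "\<dots> = (\<integral>\<^sup>+ y. (\<integral>\<^sup>+ t. (\<integral>\<^sup>+ y'. h y t * h y' t * k t \<partial>M) \<partial>lborel) \<partial>M)"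
    by (intro nn_integral_cong)
       (simp add: nn_integral_multc nn_integral_cmult G_def[symmetric] mult_ac)
  also have "\<dots> = (\<integral>\<^sup>+ y. (\<integral>\<^sup>+ y'. (\<integral>\<^sup>+ t. h y t * h y' t * k t \<partial>lborel) \<partial>M) \<partial>M)"
  proof (intro nn_integral_cong)
    fix y assume y: "y \<in> space M"
    note [measurable] = hm2[OF y]
    show "(\<integral>\<^sup>+ t. (\<integral>\<^sup>+ y'. h y t * h y' t * k t \<partial>M) \<partial>lborel)
       = (\<integral>\<^sup>+ y'. (\<integral>\<^sup>+ t. h y t * h y' t * k t \<partial>lborel) \<partial>M)"
      using P.Fubini'[of "\<lambda>y' t. h y t * h y' t * k t"] by (simp add: case_prod_beta)
  qed
  also have "\<dots> \<le> (\<integral>\<^sup>+ y. (\<integral>\<^sup>+ y'. (g y * W y) * (g y' * W y') \<partial>M) \<partial>M)"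
    by (intro nn_integral_mono key)
  also have "\<dots> = (\<integral>\<^sup>+ y. g y * W y \<partial>M)\<^sup>2"
  proof -
    have "(\<integral>\<^sup>+ y'. (g y * W y) * (g y' * W y') \<partial>M) = (g y * W y) * (\<integral>\<^sup>+ y. g y * W y \<partial>M)" for y
      by (rule nn_integral_cmult) measurable
    then show ?thesis by (simp add: nn_integral_multc power2_eq_square)
  qed
  finally show "(\<integral>\<^sup>+ t. (\<integral>\<^sup>+ y. g y * indicator {y. I y t} y \<partial>M)\<^sup>2 * tw t \<partial>lborel)
    \<le> (\<integral>\<^sup>+ y. g y * W y \<partial>M)\<^sup>2" .
qed

lemma nn_integral_inverse_cube:
  assumes "0 < a"
  shows "(\<integral>\<^sup>+ t. indicator {t. a < t} t * tw t \<partial>lborel) \<le> (ennreal (1 / a))\<^sup>2"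
proof -
  have "(\<integral>\<^sup>+ t. indicator {t. a < t} t * tw t \<partial>lborel)
     \<le> (\<integral>\<^sup>+ t. ennreal (1 / t ^ 3) * indicator {a..} t \<partial>lborel)"
    using assms by (intro nn_integral_mono) (auto simp: indicator_def)
  also have "\<dots> = ennreal (0 - (- 1 / (2 * a ^ 2)))"
  proof (rule nn_integral_FTC_atLeast)
    show "((\<lambda>x. - 1 / (2 * x ^ 2)) has_real_derivative 1 / x ^ 3) (at x)" if "a \<le> x" for x
      using that assms by (auto intro!: derivative_eq_intros simp: field_simps power2_eq_square power3_eq_cube)
    show "((\<lambda>x. - 1 / (2 * x ^ 2)) \<longlongrightarrow> (0::real)) at_top"
      by (intro tendsto_divide_0[OF tendsto_const] filterlim_at_top_imp_at_infinity
           filterlim_tendsto_pos_mult_at_top[OF tendsto_const] filterlim_pow_at_top filterlim_ident) auto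
  qed (use assms in auto)
  also have "\<dots> \<le> ennreal ((1 / a)\<^sup>2)"
    by (intro ennreal_leI) (use assms in \<open>auto simp: power2_eq_square intro!: divide_left_mono\<close>)
  also have "\<dots> = (ennreal (1 / a))\<^sup>2" using assms by (simp add: ennreal_power)
  finally show ?thesis .
qed

text \<open>A window of length at most d, rather than the whole half line beyond a, gains the factor
  sqrt (d / a). This gain makes the far integrals converge.\<close>

lemma nn_integral_inverse_cube_Ioc:
  assumes "0 < a" "b - a \<le> d" "0 \<le> d"
  shows "(\<integral>\<^sup>+ t. indicator {t. a < t \<and> t \<le> b} t * tw t \<partial>lborel)
    \<le> (ennreal (sqrt (d / a) / a))\<^sup>2"
proof (cases "a \<le> b")
  case True
  have "(\<integral>\<^sup>+ t. indicator {t. a < t \<and> t \<le> b} t * tw t \<partial>lborel)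
     \<le> (\<integral>\<^sup>+ t. ennreal (1 / a ^ 3) * indicator {a..b} t \<partial>lborel)"
    using assms by (intro nn_integral_mono) (auto simp: indicator_def intro!: ennreal_leI divide_left_mono power_mono)
  also have "\<dots> = ennreal (1 / a ^ 3 * (b - a))"
    using True assms by (subst nn_integral_cmult_indicator) (auto simp: ennreal_mult[symmetric])
  also have "\<dots> \<le> ennreal (1 / a ^ 3 * d)"
    using assms by (intro ennreal_leI mult_left_mono) auto
  also have "1 / a ^ 3 * d = (sqrt (d / a) / a)\<^sup>2"
    using assms by (simp add: power_divide) (simp add: power2_eq_square power3_eq_cube)
  finally show ?thesis using assms by (simp add: ennreal_power)
next
  case False
  then have "indicator {t. a < t \<and> t \<le> b} t = (0::ennreal)" for t by (auto simp: indicator_def)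
  then show ?thesis by simp
qed

lemma tnorm_cmult:
  assumes [measurable]: "q \<in> borel_measurable borel"
  shows "tnorm (\<lambda>t. c * q t) \<le> c * tnorm q"
proof (rule tnorm_leI)
  have "(\<integral>\<^sup>+ t. (c * q t)\<^sup>2 * tw t \<partial>lborel)
     = (\<integral>\<^sup>+ t. c\<^sup>2 * ((q t)\<^sup>2 * tw t) \<partial>lborel)"
    by (simp add: power_mult_distrib mult.assoc)
  also have "\<dots> = c\<^sup>2 * (tnorm q)\<^sup>2"
    unfolding tnorm_square by (rule nn_integral_cmult) measurable
  finally show "(\<integral>\<^sup>+ t. (c * q t)\<^sup>2 * tw t \<partial>lborel) \<le> (c * tnorm q)\<^sup>2"
    by (simp add: power_mult_distrib)
qed

lemma tnorm_const_tail:
  assumes "0 < R" "0 \<le> c"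
  shows "tnorm (\<lambda>t. ennreal c * indicator {t. R < t} t) \<le> ennreal (c / R)"
proof (rule tnorm_leI)
  have "(\<integral>\<^sup>+ t. (ennreal c * indicator {t. R < t} t)\<^sup>2 * tw t \<partial>lborel)
     = (\<integral>\<^sup>+ t. (ennreal c)\<^sup>2 * (indicator {t. R < t} t * tw t) \<partial>lborel)"
    by (intro nn_integral_cong) (auto simp: indicator_def)
  also have "\<dots> = (ennreal c)\<^sup>2 * (\<integral>\<^sup>+ t. indicator {t. R < t} t * tw t \<partial>lborel)"
    by (intro nn_integral_cmult) measurable
  also have "\<dots> \<le> (ennreal c)\<^sup>2 * (ennreal (1 / R))\<^sup>2"
    by (intro mult_left_mono nn_integral_inverse_cube assms) auto
  also have "\<dots> = (ennreal (c / R))\<^sup>2"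
    using assms by (simp add: power_mult_distrib[symmetric] ennreal_mult[symmetric])
  finally show "(\<integral>\<^sup>+ t. (ennreal c * indicator {t. R < t} t)\<^sup>2 * tw t \<partial>lborel)
     \<le> (ennreal (c / R))\<^sup>2" .
qed

lemma tnorm_tail:
  assumes "0 < R"
  shows "tnorm (\<lambda>t. c * indicator {t. R < t} t) \<le> c * ennreal (1 / R)"
proof -
  have "tnorm (\<lambda>t. c * indicator {t. R < t} t) \<le> c * tnorm (\<lambda>t. ennreal 1 * indicator {t. R < t} t)"
    by (rule order_trans[OF _ tnorm_cmult]) (auto intro!: tnorm_mono)
  also have "\<dots> \<le> c * ennreal (1 / R)"
    using assms by (intro mult_left_mono tnorm_const_tail) auto
  finally show ?thesis .
qed

section \<open>Coverings and product measurability\<close>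

context nonhomogeneous begin

lemma cover:
  fixes x :: 'a
  assumes "0 < r"
  shows "\<exists>F. finite F \<and> card F \<le> N0 ^ k \<and> ball x r \<subseteq> (\<Union>c\<in>F. ball c (r / 2 ^ k))"
proof (induction k)
  case 0
  show ?case by (rule exI[of _ "{x}"]) simp
next
  case (Suc k)
  then obtain F where F: "finite F" "card F \<le> N0 ^ k" "ball x r \<subseteq> (\<Union>c\<in>F. ball c (r / 2 ^ k))" by blast
  have halve: "\<exists>H. finite H \<and> card H \<le> N0 \<and> ball c s \<subseteq> (\<Union>c\<in>H. ball c (s / 2))"
    if "0 < s" for c :: 'a and s
    using space that by (auto simp: non_homogeneous_space_def geometrically_doubling_def)
  have "\<forall>c::'a. \<exists>H. finite H \<and> card H \<le> N0 \<and> ball c (r / 2 ^ k) \<subseteq> (\<Union>c\<in>H. ball c (r / 2 ^ k / 2))"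
    by (intro allI halve) (use assms in simp)
  then obtain H :: "'a \<Rightarrow> 'a set" where H: "\<And>c. finite (H c)" "\<And>c. card (H c) \<le> N0"
    "\<And>c. ball c (r / 2 ^ k) \<subseteq> (\<Union>c\<in>H c. ball c (r / 2 ^ k / 2))" by metis
  show ?case
  proof (intro exI[of _ "\<Union>c\<in>F. H c"] conjI)
    show "finite (\<Union>c\<in>F. H c)" using F H by auto
    have "card (\<Union>c\<in>F. H c) \<le> (\<Sum>c\<in>F. card (H c))" using F H by (intro card_UN_le) auto
    also have "\<dots> \<le> card F * N0" using H sum_bounded_above[of F "\<lambda>c. card (H c)" N0] by auto
    also have "\<dots> \<le> N0 ^ Suc k" using F by simp
    finally show "card (\<Union>c\<in>F. H c) \<le> N0 ^ Suc k" .
    show "ball x r \<subseteq> (\<Union>c\<in>\<Union>c\<in>F. H c. ball c (r / 2 ^ Suc k))"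
      using F(3) H(3) by (fastforce simp: field_simps)
  qed
qed

text \<open>Geometric doubling makes bounded sets totally bounded. Separability is what makes the
  distance measurable for the product of the Borel sigma-algebras: its open sublevel sets become
  countable unions of products of balls.\<close>

lemma separable: "\<exists>D::'a set. countable D \<and> (\<forall>x. \<forall>e>0. \<exists>q\<in>D. dist q x < e)"
proof -
  define x0 :: 'a where "x0 = undefined"
  have "\<exists>F. finite F \<and> ball x0 (real (Suc n)) \<subseteq> (\<Union>c\<in>F. ball c (real (Suc n) / 2 ^ k))" for n k
    using cover[of "real (Suc n)" k x0] by auto
  then obtain F where F: "\<And>n k. finite (F n k)"
    "\<And>n k. ball x0 (real (Suc n)) \<subseteq> (\<Union>c\<in>F n k. ball c (real (Suc n) / 2 ^ k))"
    by metis
  show ?thesis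
  proof (intro exI[of _ "\<Union>n k. F n k"] conjI allI impI)
    show "countable (\<Union>n k. F n k)" using F(1) by (intro countable_UN) (auto intro: countable_finite)
    fix x and e :: real assume e: "0 < e"
    obtain n where n: "dist x0 x < real n" using reals_Archimedean2 by blast
    have "(\<lambda>k. real (Suc n) / 2 ^ k) \<longlonglongrightarrow> 0"
      by (intro LIMSEQ_divide_realpow_zero) auto
    then obtain k where k: "real (Suc n) / 2 ^ k < e"
      using e by (metis (no_types, lifting) eventually_sequentially order_refl order_tendstoD(2))
    have "x \<in> ball x0 (real (Suc n))" using n by simp
    then obtain c where "c \<in> F n k" "dist c x < real (Suc n) / 2 ^ k" using F(2)[of n k] by fastforce
    then show "\<exists>q\<in>(\<Union>n k. F n k). dist q x < e" using k by force
  qed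
qed

lemma measurable_dist_prod [measurable]:
  "(\<lambda>p. dist (fst p) (snd p)) \<in> borel_measurable (borel \<Otimes>\<^sub>M borel :: ('a \<times> 'a) measure)"
proof (rule borel_measurableI_less)
  fix t :: real
  obtain D :: "'a set" where D: "countable D" "\<And>x e. 0 < e \<Longrightarrow> \<exists>q\<in>D. dist q x < e"
    using separable by blast
  have "{p \<in> Sigma_Algebra.space (borel \<Otimes>\<^sub>M borel :: ('a \<times> 'a) measure). dist (fst p) (snd p) < t}
     = (\<Union>q\<in>D. \<Union>s\<in>\<rat>. ball q s \<times> ball q (t - s))" (is "?L = ?R")
  proof (intro equalityI subsetI)
    fix p assume "p \<in> ?L"
    then have d: "dist (fst p) (snd p) < t" by auto
    obtain q where q: "q \<in> D" "dist q (fst p) < (t - dist (fst p) (snd p)) / 2"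
      using D(2)[of "(t - dist (fst p) (snd p)) / 2" "fst p"] d by auto
    have "dist q (snd p) \<le> dist q (fst p) + dist (fst p) (snd p)" by (rule dist_triangle)
    then have "dist q (fst p) < t - dist q (snd p)" using q by (simp add: field_simps)
    then obtain s where s: "s \<in> \<rat>" "dist q (fst p) < s" "s < t - dist q (snd p)"
      using Rats_dense_in_real by blast
    show "p \<in> ?R" using q s by (intro UN_I[of q] UN_I[of s]) (auto simp: mem_Times_iff)
  next
    fix p assume "p \<in> ?R"
    then obtain q s where "dist q (fst p) < s" "dist q (snd p) < t - s" by (auto simp: mem_Times_iff)
    then have "dist (fst p) (snd p) < t"
      using dist_triangle[of "fst p" "snd p" q] by (simp add: dist_commute)
    then show "p \<in> ?L" by (simp add: space_pair_measure)
  qed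
  also have "\<dots> \<in> sets (borel \<Otimes>\<^sub>M borel)"
    using D(1) by (intro sets.countable_UN' countable_rat image_subsetI) auto
  finally show "{p \<in> Sigma_Algebra.space (borel \<Otimes>\<^sub>M borel :: ('a \<times> 'a) measure). dist (fst p) (snd p) < t} \<in> sets (borel \<Otimes>\<^sub>M borel)" .
qed

lemma measurable_dist2 [measurable (raw)]:
  "f \<in> measurable M borel \<Longrightarrow> g \<in> measurable M borel \<Longrightarrow> (\<lambda>w. dist (f w) (g w :: 'a)) \<in> borel_measurable M"
  using measurable_compose[OF measurable_Pair measurable_dist_prod, of f M g] by simp

text \<open>Local integrability yields measurability on small products of balls around each point
  off the diagonal. Those with centres in a countable dense set and a rational radius are countably
  many and, with the diagonal, still cover the product; the function is glued from them.\<close>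

lemma kernel_measurable:
  fixes K :: "'a \<Rightarrow> 'a \<Rightarrow> complex"
  assumes "\<And>x y. x \<noteq> y \<Longrightarrow>
        \<exists>r>0. set_integrable (\<mu> \<Otimes>\<^sub>M \<mu>) (ball x r \<times> ball y r) (\<lambda>(u, v). K u v)"
  shows "(\<lambda>p. if fst p = snd p then 0 else K (fst p) (snd p)) \<in> borel_measurable (\<mu> \<Otimes>\<^sub>M \<mu>)"
proof -
  obtain D :: "'a set" where D: "countable D" "\<And>x e. 0 < e \<Longrightarrow> \<exists>q\<in>D. dist q x < e"
    using separable by blast
  define Q where "Q = {(q, q', s). q \<in> D \<and> q' \<in> D \<and> s \<in> \<rat> \<and>
     (\<lambda>p. indicator (ball q s \<times> ball q' s) p *\<^sub>R K (fst p) (snd p)) \<in> borel_measurable (\<mu> \<Otimes>\<^sub>M \<mu>)}"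
  have "Q \<subseteq> D \<times> D \<times> \<rat>" by (auto simp: Q_def)
  then have cQ: "countable Q"
    by (rule countable_subset) (intro countable_SIGMA countable_rat D(1))
  let ?diag = "{p. fst p = snd p} :: ('a \<times> 'a) set"
  let ?C = "insert ?diag ((\<lambda>(q, q', s). ball q s \<times> ball q' s) ` Q)"
  have diag: "?diag \<in> sets (\<mu> \<Otimes>\<^sub>M \<mu>)"
  proof -
    have "{p \<in> Sigma_Algebra.space (\<mu> \<Otimes>\<^sub>M \<mu>). dist (fst p) (snd p) = 0} \<in> sets (\<mu> \<Otimes>\<^sub>M \<mu>)" by measurable
    then show ?thesis by (simp add: space_pair_measure)
  qed
  show ?thesis
  proof (rule measurable_piecewise_restrict[of ?C])
    show "countable ?C" using cQ by simp
    show "\<Omega> \<inter> Sigma_Algebra.space (\<mu> \<Otimes>\<^sub>M \<mu>) \<in> sets (\<mu> \<Otimes>\<^sub>M \<mu>)" if "\<Omega> \<in> ?C" for \<Omega>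
      using that diag by (auto simp: space_pair_measure sets_mu)
    show "Sigma_Algebra.space (\<mu> \<Otimes>\<^sub>M \<mu>) \<subseteq> \<Union>?C"
    proof
      fix p :: "'a \<times> 'a"
      show "p \<in> \<Union>?C"
      proof (cases "fst p = snd p")
        case False
        then obtain r where r: "0 < r"
          "set_integrable (\<mu> \<Otimes>\<^sub>M \<mu>) (ball (fst p) r \<times> ball (snd p) r) (\<lambda>(u, v). K u v)"
          using assms by blast
        obtain s where s: "s \<in> \<rat>" "0 < s" "s < r / 2" using Rats_dense_in_real[of 0 "r/2"] r by auto
        obtain q q' where q: "q \<in> D" "dist q (fst p) < s" "q' \<in> D" "dist q' (snd p) < s"
          using D(2) s by metis
        have sub: "ball q s \<times> ball q' s \<subseteq> ball (fst p) r \<times> ball (snd p) r"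
        proof clarsimp
          fix a b assume "dist q a < s" "dist q' b < s"
          then show "dist (fst p) a < r \<and> dist (snd p) b < r"
            using dist_triangle[of "fst p" a q] dist_triangle[of "snd p" b q'] q s by (simp add: dist_commute)
        qed
        have "set_integrable (\<mu> \<Otimes>\<^sub>M \<mu>) (ball q s \<times> ball q' s) (\<lambda>(u, v). K u v)"
          by (rule set_integrable_subset[OF r(2)]) (auto simp: sets_mu sub)
        then have "(\<lambda>p. indicator (ball q s \<times> ball q' s) p *\<^sub>R K (fst p) (snd p)) \<in> borel_measurable (\<mu> \<Otimes>\<^sub>M \<mu>)"
          unfolding set_integrable_def by (auto simp: case_prod_beta dest: borel_measurable_integrable)
        then have "(q, q', s) \<in> Q" using q s by (simp add: Q_def)
        then show ?thesis using q by (intro UnionI[of "ball q s \<times> ball q' s"]) (auto simp: mem_Times_iff intro!: rev_image_eqI)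
      qed auto
    qed
    fix \<Omega> assume "\<Omega> \<in> ?C"
    then consider "\<Omega> = ?diag" | q q' s where "(q, q', s) \<in> Q" "\<Omega> = ball q s \<times> ball q' s" by auto
    then show "(\<lambda>p. if fst p = snd p then 0 else K (fst p) (snd p)) \<in> borel_measurable (restrict_space (\<mu> \<Otimes>\<^sub>M \<mu>) \<Omega>)"
    proof cases
      case 1
      have "(\<lambda>p. 0 :: complex) \<in> borel_measurable (restrict_space (\<mu> \<Otimes>\<^sub>M \<mu>) \<Omega>)" by simp
      then show ?thesis
        by (rule measurable_cong[THEN iffD1, rotated]) (auto simp: 1 space_restrict_space)
    next
      case 2
      have [measurable]: "(\<lambda>p. indicator \<Omega> p *\<^sub>R K (fst p) (snd p)) \<in> borel_measurable (\<mu> \<Otimes>\<^sub>M \<mu>)"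
        using 2 by (auto simp: Q_def)
      have [measurable]: "?diag \<in> sets (\<mu> \<Otimes>\<^sub>M \<mu>)" by (rule diag)
      have "(\<lambda>p. if p \<in> ?diag then 0 else indicator \<Omega> p *\<^sub>R K (fst p) (snd p)) \<in> borel_measurable (\<mu> \<Otimes>\<^sub>M \<mu>)"
        by measurable
      then have "(\<lambda>p. if p \<in> ?diag then 0 else indicator \<Omega> p *\<^sub>R K (fst p) (snd p))
        \<in> borel_measurable (restrict_space (\<mu> \<Otimes>\<^sub>M \<mu>) \<Omega>)" by (rule measurable_restrict_space1)
      then show ?thesis
        by (rule measurable_cong[THEN iffD1, rotated]) (auto simp: space_restrict_space)
    qed
  qed
qed

end

section \<open>Pointwise estimates for the Marcinkiewicz integral\<close>

text \<open>The kernel is normalised to vanish on the diagonal. Then the size bound holds for all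
  pairs, and the inner integral may run over the full ball. A general kernel is reduced to this case
  in the final theorem.\<close>

locale marcinkiewicz_space = nonhomogeneous \<mu> lam Clam N0
  for \<mu> :: "'a::metric_space measure" and lam Clam N0 +
  fixes K :: "'a \<Rightarrow> 'a \<Rightarrow> complex" and CK :: real
  assumes K_measurable: "(\<lambda>p. K (fst p) (snd p)) \<in> borel_measurable (\<mu> \<Otimes>\<^sub>M \<mu>)"
    and K_diag: "K x x = 0"
    and CK_pos: "0 < CK"
    and K_size: "cmod (K x y) \<le> CK * (dist x y * wt x y)"
    and K_regular: "(\<integral>\<^sup>+ x. ennreal ((cmod (K x y - K x y') + cmod (K y x - K y' x)) * (1 / dist x y))
        * indicator {x. 2 * dist y y' \<le> dist x y} x \<partial>\<mu>) \<le> ennreal CK"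
begin

section \<open>Measurability and sublinearity of the Marcinkiewicz integral\<close>

lemma K_measurable_pair [measurable (raw)]:
  "f \<in> measurable M \<mu> \<Longrightarrow> g \<in> measurable M \<mu> \<Longrightarrow> (\<lambda>w. K (f w) (g w)) \<in> borel_measurable M"
  using measurable_compose[OF measurable_Pair K_measurable, of f M g] by simp

lemma K_measurable_right [measurable]: "K x \<in> borel_measurable \<mu>"
  by (rule K_measurable_pair) simp_all

lemma inner_int_integrand_measurable:
  "g \<in> borel_measurable \<mu> \<Longrightarrow> (\<lambda>y. indicat_real (ball x t) y *\<^sub>R (K x y * g y)) \<in> borel_measurable \<mu>"
  by (intro borel_measurable_scaleR borel_measurable_indicator borel_measurable_times K_measurable_right)
     (auto simp: sets_mu)

definition bdd :: "real \<Rightarrow> ('a \<Rightarrow> complex) \<Rightarrow> bool" where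
  "bdd A g \<longleftrightarrow> g \<in> borel_measurable \<mu> \<and> 0 \<le> A \<and> (AE y in \<mu>. cmod (g y) \<le> A)"

lemma bdd_measurable: "bdd A g \<Longrightarrow> g \<in> borel_measurable \<mu>"
  and bdd_nonneg: "bdd A g \<Longrightarrow> 0 \<le> A"
  and bdd_AE: "bdd A g \<Longrightarrow> AE y in \<mu>. cmod (g y) \<le> A"
  by (auto simp: bdd_def)

definition restr :: "'a set \<Rightarrow> ('a \<Rightarrow> complex) \<Rightarrow> 'a \<Rightarrow> complex" where
  "restr S g y = (if y \<in> S then g y else 0)"

lemma restr_measurable: "S \<in> sets borel \<Longrightarrow> g \<in> borel_measurable \<mu> \<Longrightarrow> restr S g \<in> borel_measurable \<mu>"
  unfolding restr_def by (rule measurable_If_set) (auto simp: sets_mu)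

lemma bdd_restr: "S \<in> sets borel \<Longrightarrow> bdd A g \<Longrightarrow> bdd A (restr S g)"
  unfolding bdd_def using restr_measurable[of S g]
  by (auto simp: restr_def elim!: eventually_mono)

lemma bdd_add: "bdd A g \<Longrightarrow> bdd A' g' \<Longrightarrow> bdd (A + A') (\<lambda>y. g y + g' y)"
proof -
  assume *: "bdd A g" "bdd A' g'"
  have "AE y in \<mu>. cmod (g y + g' y) \<le> A + A'"
    using bdd_AE[OF *(1)] bdd_AE[OF *(2)] by eventually_elim (rule norm_triangle_mono)
  with * show ?thesis by (auto simp: bdd_def)
qed

definition inner_int :: "'a \<Rightarrow> ('a \<Rightarrow> complex) \<Rightarrow> real \<Rightarrow> complex" where
  "inner_int x g t = (LINT y|\<mu>. indicator (ball x t) y *\<^sub>R (K x y * g y))"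

abbreviation marc :: "('a \<Rightarrow> complex) \<Rightarrow> 'a \<Rightarrow> ennreal" where
  "marc \<equiv> marcinkiewicz \<mu> K"

lemma marc_eq_tnorm: "marc g x = tnorm (\<lambda>t. ennreal (cmod (inner_int x g t)))"
proof -
  have "(LINT y : {y. y \<noteq> x \<and> dist x y < t} | \<mu>. K x y * g y) = inner_int x g t" for t
    unfolding inner_int_def set_lebesgue_integral_def
    by (intro Bochner_Integration.integral_cong) (auto simp: indicator_def K_diag)
  then show ?thesis
    unfolding marcinkiewicz_def tnorm_def
    by (intro arg_cong[where f="\<lambda>a. epowr a (1 / 2)"] nn_integral_cong)
       (auto simp: indicator_def ennreal_power ennreal_mult[symmetric])
qed

lemma inner_int_measurable:
  assumes [measurable]: "g \<in> borel_measurable \<mu>"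
  shows "(\<lambda>p. inner_int (fst p) g (snd p)) \<in> borel_measurable (\<mu> \<Otimes>\<^sub>M borel)"
proof -
  have "(\<lambda>(p, y). if dist (fst p) y < snd p then K (fst p) y * g y else 0)
      \<in> borel_measurable ((\<mu> \<Otimes>\<^sub>M borel) \<Otimes>\<^sub>M \<mu>)"
    by measurable
  then have "(\<lambda>p. LINT y|\<mu>. (if dist (fst p) y < snd p then K (fst p) y * g y else 0))
      \<in> borel_measurable (\<mu> \<Otimes>\<^sub>M borel)"
    by (rule borel_measurable_lebesgue_integral)
  also have "(\<lambda>p. LINT y|\<mu>. (if dist (fst p) y < snd p then K (fst p) y * g y else 0))
      = (\<lambda>p. inner_int (fst p) g (snd p))"
    unfolding inner_int_def by (intro ext Bochner_Integration.integral_cong) (auto simp: indicator_def)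
  finally show ?thesis .
qed

lemma inner_int_measurable_t:
  assumes "g \<in> borel_measurable \<mu>" shows "inner_int x g \<in> borel_measurable borel"
  using measurable_compose[OF measurable_Pair1'[of x \<mu> borel] inner_int_measurable[OF assms]] by simp

lemma marc_measurable:
  assumes "g \<in> borel_measurable \<mu>" shows "marc g \<in> borel_measurable \<mu>"
proof -
  have [measurable]: "(\<lambda>p. inner_int (fst p) g (snd p)) \<in> borel_measurable (\<mu> \<Otimes>\<^sub>M lborel)"
    using inner_int_measurable[OF assms] by (simp cong: measurable_cong_sets)
  have ep: "(\<lambda>a. epowr a (1 / 2)) \<in> borel_measurable borel"
    unfolding epowr_def by measurable
  have "(\<lambda>x. \<integral>\<^sup>+ t. ennreal (cmod (inner_int x g t)) ^ 2 * tw t \<partial>lborel)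
      \<in> borel_measurable \<mu>"
    by (rule lborel.borel_measurable_nn_integral) measurable
  then have "(\<lambda>x. epowr (\<integral>\<^sup>+ t. ennreal (cmod (inner_int x g t)) ^ 2 * tw t \<partial>lborel) (1 / 2))
      \<in> borel_measurable \<mu>"
    by (rule measurable_compose[OF _ ep])
  then show ?thesis unfolding marc_eq_tnorm[abs_def] tnorm_def .
qed

lemma marc_cong_AE:
  assumes [measurable]: "f \<in> borel_measurable \<mu>" "g \<in> borel_measurable \<mu>" and "AE y in \<mu>. f y = g y"
  shows "marc f x = marc g x"
proof -
  have "inner_int x f t = inner_int x g t" for t
    unfolding inner_int_def
  proof (rule integral_cong_AE)
    show "AE y in \<mu>. indicat_real (ball x t) y *\<^sub>R (K x y * f y) = indicat_real (ball x t) y *\<^sub>R (K x y * g y)"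
      using assms(3) by eventually_elim simp
  qed (intro inner_int_integrand_measurable assms)+
  then show ?thesis by (simp add: marc_eq_tnorm)
qed

lemma K_times_bound:
  assumes "bdd A g" "0 \<le> A"
  shows "AE y in \<mu>. cmod (K x y * g y) \<le> CK * A * (dist x y * wt x y)"
  using bdd_AE[OF assms(1)]
proof eventually_elim
  case (elim y)
  have "cmod (K x y) * cmod (g y) \<le> (CK * (dist x y * wt x y)) * A"
    using elim K_size[of x y] by (intro mult_mono) (use CK_pos in auto)
  then show ?case by (simp add: norm_mult mult_ac)
qed

text \<open>The numerator \<open>dist x y\<close> of the size condition tames the singularity, so
  for bounded g the inner integral converges absolutely and is of order t, even if g is not
  integrable. For t \<le> 0 the ball is empty, hence the maximum.\<close>

lemma ball_wt_integral:
  assumes "bdd A g"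
  shows "(\<integral>\<^sup>+ y. ennreal (cmod (K x y * g y)) * indicator (ball x t) y \<partial>\<mu>) \<le> ennreal (CK * A * 2 * growth 2 * max t 0)"
proof (cases "0 < t")
  case True
  have A: "0 \<le> A" using assms by (rule bdd_nonneg)
  have "(\<integral>\<^sup>+ y. ennreal (cmod (K x y * g y)) * indicator (ball x t) y \<partial>\<mu>)
     \<le> (\<integral>\<^sup>+ y. ennreal (CK * A) * (ennreal (dist x y * wt x y) * indicator {y. dist x y < t} y) \<partial>\<mu>)"
    using K_times_bound[OF assms A, of x] A CK_pos
    by (intro nn_integral_mono_AE) (auto elim!: eventually_mono simp: indicator_def ennreal_mult[symmetric] intro!: ennreal_leI)
  also have "\<dots> = ennreal (CK * A) * (\<integral>\<^sup>+ y. ennreal (dist x y * wt x y) * indicator {y. dist x y < t} y \<partial>\<mu>)"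
    by (rule nn_integral_cmult) measurable
  also have "\<dots> \<le> ennreal (CK * A) * ennreal (2 * growth 2 * t)"
    by (intro mult_left_mono near_wt True) auto
  also have "\<dots> = ennreal (CK * A * 2 * growth 2 * max t 0)"
    using A CK_pos True by (simp add: ennreal_mult[symmetric] mult_ac)
  finally show ?thesis .
next
  case False
  then have "ball x t = {}" by simp
  then show ?thesis by (simp del: ball_eq_empty)
qed

lemma inner_int_integrable:
  assumes "bdd A g"
  shows "integrable \<mu> (\<lambda>y. indicator (ball x t) y *\<^sub>R (K x y * g y))"
proof (rule integrableI_bounded)
  show "(\<lambda>y. indicat_real (ball x t) y *\<^sub>R (K x y * g y)) \<in> borel_measurable \<mu>"
    by (rule inner_int_integrand_measurable[OF bdd_measurable[OF assms]])
  have "(\<integral>\<^sup>+ y. ennreal (norm (indicat_real (ball x t) y *\<^sub>R (K x y * g y))) \<partial>\<mu>)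
      = (\<integral>\<^sup>+ y. ennreal (cmod (K x y * g y)) * indicator (ball x t) y \<partial>\<mu>)"
    by (intro nn_integral_cong) (auto simp: indicator_def)
  also have "\<dots> < \<infinity>" using ball_wt_integral[OF assms, of x t] by (auto intro: le_less_trans)
  finally show "(\<integral>\<^sup>+ y. ennreal (norm (indicat_real (ball x t) y *\<^sub>R (K x y * g y))) \<partial>\<mu>) < \<infinity>" .
qed

lemma cmod_integral_le:
  fixes f :: "'a \<Rightarrow> complex"
  shows "ennreal (cmod (LINT y|\<mu>. f y)) \<le> (\<integral>\<^sup>+ y. ennreal (cmod (f y)) \<partial>\<mu>)"
proof (cases "integrable \<mu> f")
  case True
  then show ?thesis by (rule integral_norm_bound_ennreal)
next
  case False
  then show ?thesis by (simp add: not_integrable_integral_eq)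
qed

lemma inner_int_le:
  "ennreal (cmod (inner_int x g t)) \<le> (\<integral>\<^sup>+ y. ennreal (cmod (K x y * g y)) * indicator (ball x t) y \<partial>\<mu>)"
  unfolding inner_int_def
  by (rule order_trans[OF cmod_integral_le]) (auto intro!: nn_integral_mono simp: indicator_def)

lemma inner_int_bound:
  assumes "bdd A g" "0 < t"
  shows "cmod (inner_int x g t) \<le> CK * A * 2 * growth 2 * t"
  using order_trans[OF inner_int_le ball_wt_integral[OF assms(1)], of x t] assms CK_pos bdd_nonneg[OF assms(1)]
  by (subst (asm) ennreal_le_iff) auto

lemma inner_int_add:
  assumes "bdd A f" "bdd A' g"
  shows "inner_int x (\<lambda>y. f y + g y) t = inner_int x f t + inner_int x g t"
  unfolding inner_int_def distrib_left scaleR_add_right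
  by (rule Bochner_Integration.integral_add[OF inner_int_integrable[OF assms(1)] inner_int_integrable[OF assms(2)]])

lemma marc_triangle:
  assumes "bdd A f" "bdd A' g"
  shows "marc (\<lambda>y. f y + g y) x \<le> marc f x + marc g x"
proof -
  have "marc (\<lambda>y. f y + g y) x \<le> tnorm (\<lambda>t. ennreal (cmod (inner_int x f t)) + ennreal (cmod (inner_int x g t)))"
    unfolding marc_eq_tnorm inner_int_add[OF assms]
    by (intro tnorm_mono) (simp add: norm_triangle_ineq flip: ennreal_plus)
  also have "\<dots> \<le> marc f x + marc g x"
    unfolding marc_eq_tnorm
    using inner_int_measurable_t[OF bdd_measurable[OF assms(1)], of x] inner_int_measurable_t[OF bdd_measurable[OF assms(2)], of x]
    by (intro tnorm_triangle) auto
  finally show ?thesis .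
qed

lemma inner_int_cmult: "inner_int x (\<lambda>y. c * g y) t = c * inner_int x g t"
proof -
  have "inner_int x (\<lambda>y. c * g y) t = (LINT y|\<mu>. c * (indicator (ball x t) y *\<^sub>R (K x y * g y)))"
    unfolding inner_int_def by (intro Bochner_Integration.integral_cong) (auto simp: indicator_def)
  also have "\<dots> = c * inner_int x g t" unfolding inner_int_def by (rule integral_mult_right_zero)
  finally show ?thesis .
qed

lemma marc_cmult:
  assumes "g \<in> borel_measurable \<mu>"
  shows "marc (\<lambda>y. c * g y) x \<le> ennreal (cmod c) * marc g x"
  unfolding marc_eq_tnorm inner_int_cmult norm_mult
  using inner_int_measurable_t[OF assms, of x]
  by (subst ennreal_mult) (auto intro!: tnorm_cmult)

lemma marc_sum:
  assumes "finite I" "\<And>i. i \<in> I \<Longrightarrow> bdd (A i) (f i)"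
  shows "marc (\<lambda>y. \<Sum>i\<in>I. f i y) x \<le> (\<Sum>i\<in>I. marc (f i) x) \<and> bdd (\<Sum>i\<in>I. A i) (\<lambda>y. \<Sum>i\<in>I. f i y)"
  using assms
proof (induction I rule: finite_induct)
  case empty
  have "marc (\<lambda>y. 0) x \<le> 0 * marc (\<lambda>y. 0) x" using marc_cmult[of "\<lambda>y. 0" 0 x] by simp
  then show ?case by (simp add: bdd_def)
next
  case (insert i I)
  then have b: "bdd (A i) (f i)" "bdd (\<Sum>i\<in>I. A i) (\<lambda>y. \<Sum>i\<in>I. f i y)"
    and le: "marc (\<lambda>y. \<Sum>i\<in>I. f i y) x \<le> (\<Sum>i\<in>I. marc (f i) x)" by auto
  have "marc (\<lambda>y. f i y + (\<Sum>i\<in>I. f i y)) x \<le> marc (f i) x + (\<Sum>i\<in>I. marc (f i) x)"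
    by (rule order_trans[OF marc_triangle[OF b]]) (intro add_left_mono le)
  then show ?case using insert bdd_add[OF b] by simp
qed

lemma marc_zero: "AE y in \<mu>. g y = 0 \<Longrightarrow> g \<in> borel_measurable \<mu> \<Longrightarrow> marc g x = 0"
  using marc_cmult[of "\<lambda>y. 0" 0 x] marc_cong_AE[of g "\<lambda>y. 0" x] by simp

text \<open>By Minkowski's inequality a point y, which enters at time \<open>dist x y\<close>,
  contributes its kernel value divided by \<open>dist x y\<close>. This division cancels the
  numerator of the size condition and leaves the weight.\<close>

lemma marc_size:
  assumes "g \<in> borel_measurable \<mu>"
  shows "marc g x \<le> ennreal CK * (\<integral>\<^sup>+ y. ennreal (cmod (g y) * wt x y) \<partial>\<mu>)"
proof -
  note [measurable] = assms
  have [measurable]: "x \<in> Sigma_Algebra.space \<mu>" by simp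
  let ?g = "\<lambda>y. ennreal (cmod (K x y * g y))"
  have "marc g x \<le> tnorm (\<lambda>t. \<integral>\<^sup>+ y. ?g y * indicator {y. dist x y < t} y \<partial>\<mu>)"
    unfolding marc_eq_tnorm using inner_int_le[of x g]
    by (intro tnorm_mono) (simp add: ball_def)
  also have "\<dots> \<le> (\<integral>\<^sup>+ y. ?g y * ennreal (1 / dist x y) \<partial>\<mu>)"
  proof (rule tnorm_Minkowski)
    fix y assume "?g y \<noteq> 0"
    then have "0 < dist x y" using K_diag[of x] by (cases "x = y") auto
    then show "(\<integral>\<^sup>+ t. indicator {t. dist x y < t} t * tw t \<partial>lborel)
        \<le> (ennreal (1 / dist x y))\<^sup>2"
      by (rule nn_integral_inverse_cube)
  next
    show "?g \<in> borel_measurable \<mu>" by measurable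
    show "(\<lambda>y. ennreal (1 / dist x y)) \<in> borel_measurable \<mu>" by measurable
    show "Measurable.pred (\<mu> \<Otimes>\<^sub>M borel) (\<lambda>(y, t). dist x y < t)" by measurable
  qed (rule sigma_finite_mu)
  also have "\<dots> \<le> (\<integral>\<^sup>+ y. ennreal CK * ennreal (cmod (g y) * wt x y) \<partial>\<mu>)"
  proof (intro nn_integral_mono)
    fix y
    have "cmod (K x y * g y) * (1 / dist x y) \<le> CK * (cmod (g y) * wt x y)"
    proof (cases "x = y")
      case False
      have "cmod (K x y) * cmod (g y) * (1 / dist x y) \<le> (CK * (dist x y * wt x y) * cmod (g y)) * (1 / dist x y)"
        by (rule mult_right_mono[OF mult_right_mono[OF K_size]]) simp_all
      also have "\<dots> = CK * (cmod (g y) * wt x y)" using False by simp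
      finally show ?thesis by (simp only: norm_mult)
    qed (simp add: K_diag wt_def)
    then show "?g y * ennreal (1 / dist x y) \<le> ennreal CK * ennreal (cmod (g y) * wt x y)"
      using CK_pos by (subst (1 2) ennreal_mult[symmetric]) (auto intro!: ennreal_leI)
  qed
  also have "\<dots> = ennreal CK * (\<integral>\<^sup>+ y. ennreal (cmod (g y) * wt x y) \<partial>\<mu>)"
    by (rule nn_integral_cmult) measurable
  finally show ?thesis .
qed

lemma marc_size_bdd:
  assumes "bdd A g" and S: "S \<in> sets borel" "\<And>y. y \<notin> S \<Longrightarrow> g y = 0"
  shows "marc g x \<le> ennreal (CK * A) * wt_int x S"
proof -
  have A: "0 \<le> A" using assms(1) by (rule bdd_nonneg)
  have "marc g x \<le> ennreal CK * (\<integral>\<^sup>+ y. ennreal (cmod (g y) * wt x y) \<partial>\<mu>)"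
    by (rule marc_size) (rule bdd_measurable[OF assms(1)])
  also have "(\<integral>\<^sup>+ y. ennreal (cmod (g y) * wt x y) \<partial>\<mu>) \<le> (\<integral>\<^sup>+ y. ennreal A * (ennreal (wt x y) * indicator S y) \<partial>\<mu>)"
    using bdd_AE[OF assms(1)] S(2) A
    by (intro nn_integral_mono_AE)
       (auto elim!: eventually_mono simp: indicator_def ennreal_mult[symmetric] intro!: ennreal_leI mult_right_mono)
  also have "\<dots> = ennreal A * wt_int x S"
    using S(1) by (intro nn_integral_cmult) (simp add: sets_mu)
  finally show ?thesis
    using A CK_pos by (simp add: ennreal_mult mult.assoc mult_left_mono)
qed

text \<open>Removing \<open>ball x R\<close> makes the inner integral vanish up to time R and
  afterwards subtracts its fixed value at time R. That value is of order R, while a constant on (R,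
  \<infinity>) has norm of order 1 / R times itself, so R cancels.\<close>

lemma marc_truncate:
  assumes "bdd A f" "0 < R"
  shows "marc (restr (- ball x R) f) x \<le> marc f x + ennreal (CK * A * 2 * growth 2)"
proof -
  note fm = bdd_measurable[OF assms(1)]
  have A: "0 \<le> A" using assms(1) by (rule bdd_nonneg)
  have eq: "inner_int x (restr (- ball x R) f) t = (if t \<le> R then 0 else inner_int x f t - inner_int x f R)" for t
  proof (cases "t \<le> R")
    case True
    then have z: "indicat_real (ball x t) y *\<^sub>R (K x y * restr (- ball x R) f y) = 0" for y
      by (auto simp: indicator_def restr_def)
    show ?thesis unfolding inner_int_def z using True by simp
  next
    case False
    have "inner_int x f t - inner_int x f R
       = (LINT y|\<mu>. indicator (ball x t) y *\<^sub>R (K x y * f y) - indicator (ball x R) y *\<^sub>R (K x y * f y))"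
      unfolding inner_int_def
      by (subst Bochner_Integration.integral_diff) (auto intro: inner_int_integrable[OF assms(1)])
    also have "\<dots> = inner_int x (restr (- ball x R) f) t"
      unfolding inner_int_def using False
      by (intro Bochner_Integration.integral_cong) (auto simp: indicator_def restr_def)
    finally show ?thesis using False by simp
  qed
  let ?c = "CK * A * 2 * growth 2 * R"
  have "marc (restr (- ball x R) f) x
      \<le> tnorm (\<lambda>t. ennreal (cmod (inner_int x f t)) + ennreal ?c * indicator {t. R < t} t)"
    unfolding marc_eq_tnorm eq
  proof (intro tnorm_mono)
    fix t :: real
    show "ennreal (cmod (if t \<le> R then 0 else inner_int x f t - inner_int x f R))
       \<le> ennreal (cmod (inner_int x f t)) + ennreal ?c * indicator {t. R < t} t"
    proof (cases "t \<le> R")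
      case False
      have "cmod (inner_int x f t - inner_int x f R) \<le> cmod (inner_int x f t) + ?c"
        using norm_triangle_ineq4[of "inner_int x f t" "inner_int x f R"] inner_int_bound[OF assms, of x] by simp
      then show ?thesis using False A CK_pos assms(2)
        by (simp flip: ennreal_plus)
    qed simp
  qed
  also have "\<dots> \<le> marc f x + tnorm (\<lambda>t. ennreal ?c * indicator {t. R < t} t)"
    unfolding marc_eq_tnorm using inner_int_measurable_t[OF fm, of x] by (intro tnorm_triangle) auto
  also have "tnorm (\<lambda>t. ennreal ?c * indicator {t. R < t} t) \<le> ennreal (?c / R)"
    using A CK_pos assms by (intro tnorm_const_tail) auto
  finally show ?thesis using assms(2) by (simp add: add_left_mono)
qed



text \<open>The points counted for x only during a window of length at most R. The short window
  turns Minkowski's inequality into the integral of \<open>far_wt\<close>; it is used for the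
  symmetric difference of two balls with nearby centres.\<close>

lemma marc_shift:
  assumes "bdd A g" "0 < R" "\<And>y. y \<in> ball x R \<Longrightarrow> g y = 0"
    and [measurable]: "b \<in> borel_measurable \<mu>" and b: "\<And>y. b y - dist x y \<le> R"
  shows "tnorm (\<lambda>t. \<integral>\<^sup>+ y. ennreal (cmod (K x y * g y)) * indicator {y. dist x y < t \<and> t \<le> b y} y \<partial>\<mu>)
      \<le> ennreal (CK * A * (4 * growth 2))"
proof -
  have A: "0 \<le> A" using assms(1) by (rule bdd_nonneg)
  note [measurable] = bdd_measurable[OF assms(1)]
  let ?g = "\<lambda>y. ennreal (cmod (K x y * g y))"
  let ?W = "\<lambda>y. ennreal (sqrt (R / dist x y) / dist x y)"
  have "tnorm (\<lambda>t. \<integral>\<^sup>+ y. ?g y * indicator {y. dist x y < t \<and> t \<le> b y} y \<partial>\<mu>) \<le> (\<integral>\<^sup>+ y. ?g y * ?W y \<partial>\<mu>)"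
  proof (rule tnorm_Minkowski)
    fix y assume "?g y \<noteq> 0"
    then have "0 < dist x y" using K_diag[of x] by (cases "x = y") auto
    then show "(\<integral>\<^sup>+ t. indicator {t. dist x y < t \<and> t \<le> b y} t * tw t \<partial>lborel)
        \<le> (?W y)\<^sup>2"
      using b[of y] assms(2) by (intro nn_integral_inverse_cube_Ioc) auto
  next
    show "?g \<in> borel_measurable \<mu>" by measurable
    show "?W \<in> borel_measurable \<mu>" by measurable
    show "Measurable.pred (\<mu> \<Otimes>\<^sub>M borel) (\<lambda>(y, t). dist x y < t \<and> t \<le> b y)" by measurable
  qed (rule sigma_finite_mu)
  also have "\<dots> \<le> (\<integral>\<^sup>+ y. ennreal (CK * A) * (ennreal (sqrt (R / dist x y) * wt x y) * indicator {y. R \<le> dist x y} y) \<partial>\<mu>)"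
  proof (rule nn_integral_mono_AE)
    show "AE y in \<mu>. ?g y * ?W y \<le> ennreal (CK * A) * (ennreal (sqrt (R / dist x y) * wt x y) * indicator {y. R \<le> dist x y} y)"
      using K_times_bound[OF assms(1) A, of x]
    proof eventually_elim
      case (elim y)
      show ?case
      proof (cases "R \<le> dist x y")
        case True
        then have d: "0 < dist x y" using assms(2) by linarith
        have "cmod (K x y * g y) * (sqrt (R / dist x y) / dist x y)
            \<le> (CK * A * (dist x y * wt x y)) * (sqrt (R / dist x y) / dist x y)"
          using elim assms(2) by (intro mult_right_mono) auto
        also have "\<dots> = CK * A * (sqrt (R / dist x y) * wt x y)" using d by simp
        finally have "ennreal (cmod (K x y * g y) * (sqrt (R / dist x y) / dist x y))
            \<le> ennreal (CK * A * (sqrt (R / dist x y) * wt x y))" by (rule ennreal_leI)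
        also have "\<dots> = ennreal (CK * A) * (ennreal (sqrt (R / dist x y) * wt x y) * indicator {y. R \<le> dist x y} y)"
          using True A CK_pos assms(2) by (simp add: ennreal_mult)
        also have "ennreal (cmod (K x y * g y) * (sqrt (R / dist x y) / dist x y)) = ?g y * ?W y"
          by (rule ennreal_mult) (use assms(2) in auto)
        finally show ?thesis .
      next
        case False
        then have "g y = 0" using assms(3)[of y] by simp
        then show ?thesis by simp
      qed
    qed
  qed
  also have "\<dots> = ennreal (CK * A) * (\<integral>\<^sup>+ y. ennreal (sqrt (R / dist x y) * wt x y) * indicator {y. R \<le> dist x y} y \<partial>\<mu>)"
    by (rule nn_integral_cmult) measurable
  also have "\<dots> \<le> ennreal (CK * A) * ennreal (4 * growth 2)"
    by (intro mult_left_mono far_wt assms) auto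
  also have "\<dots> = ennreal (CK * A * (4 * growth 2))"
    using A CK_pos by (simp add: ennreal_mult[symmetric])
  finally show ?thesis .
qed

text \<open>One \<open>CK\<close> for the regularity of the kernel, and 4 * \<open>growth 2\<close>
  for each half of the symmetric difference.\<close>

definition creg :: real where "creg = CK * (1 + 8 * growth 2)"

lemma creg_nonneg: "0 \<le> creg"
  using CK_pos by (simp add: creg_def)

text \<open>The difference of the inner integrals splits into \<open>Q1\<close>, where both balls
  contain y and the regularity condition applies, and \<open>Q2\<close>, \<open>Q3\<close>, where
  exactly one ball contains y and the window of admissible times is no longer than the distance of x
  and x'.\<close>

lemma marc_regular:
  assumes g: "bdd A g" "\<And>y. y \<in> ball x R \<Longrightarrow> g y = 0" and R: "0 < R" "3 * dist x x' \<le> R"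
  shows "marc g x \<le> marc g x' + ennreal (creg * A)"
proof -
  have A: "0 \<le> A" using assms(1) by (rule bdd_nonneg)
  note gm [measurable] = bdd_measurable[OF assms(1)]
  define Q1 where "Q1 t = (\<integral>\<^sup>+ y. ennreal (cmod ((K x y - K x' y) * g y)) * indicator {y. dist x y < t \<and> dist x' y < t} y \<partial>\<mu>)" for t
  define Q2 where "Q2 t = (\<integral>\<^sup>+ y. ennreal (cmod (K x y * g y)) * indicator {y. dist x y < t \<and> t \<le> dist x' y} y \<partial>\<mu>)" for t
  define Q3 where "Q3 t = (\<integral>\<^sup>+ y. ennreal (cmod (K x' y * g y)) * indicator {y. dist x' y < t \<and> t \<le> dist x y} y \<partial>\<mu>)" for t
  have diff: "ennreal (cmod (inner_int x g t - inner_int x' g t)) \<le> Q1 t + (Q2 t + Q3 t)" for t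
  proof -
    have "inner_int x g t - inner_int x' g t
        = (LINT y|\<mu>. indicator (ball x t) y *\<^sub>R (K x y * g y) - indicator (ball x' t) y *\<^sub>R (K x' y * g y))"
      unfolding inner_int_def
      by (subst Bochner_Integration.integral_diff) (auto intro: inner_int_integrable[OF g(1)])
    then have "ennreal (cmod (inner_int x g t - inner_int x' g t))
        \<le> (\<integral>\<^sup>+ y. ennreal (cmod (indicator (ball x t) y *\<^sub>R (K x y * g y) - indicator (ball x' t) y *\<^sub>R (K x' y * g y))) \<partial>\<mu>)"
      by (simp only: cmod_integral_le)
    also have "\<dots> \<le> (\<integral>\<^sup>+ y. ennreal (cmod ((K x y - K x' y) * g y)) * indicator {y. dist x y < t \<and> dist x' y < t} y
        + (ennreal (cmod (K x y * g y)) * indicator {y. dist x y < t \<and> t \<le> dist x' y} y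
           + ennreal (cmod (K x' y * g y)) * indicator {y. dist x' y < t \<and> t \<le> dist x y} y) \<partial>\<mu>)"
    proof (intro nn_integral_mono)
      fix y
      show "ennreal (cmod (indicator (ball x t) y *\<^sub>R (K x y * g y) - indicator (ball x' t) y *\<^sub>R (K x' y * g y)))
        \<le> ennreal (cmod ((K x y - K x' y) * g y)) * indicator {y. dist x y < t \<and> dist x' y < t} y
        + (ennreal (cmod (K x y * g y)) * indicator {y. dist x y < t \<and> t \<le> dist x' y} y
           + ennreal (cmod (K x' y * g y)) * indicator {y. dist x' y < t \<and> t \<le> dist x y} y)"
        by (cases "dist x y < t"; cases "dist x' y < t") (auto simp: indicator_def left_diff_distrib)
    qed
    also have "\<dots> = Q1 t + (Q2 t + Q3 t)"
      unfolding Q1_def Q2_def Q3_def by (subst nn_integral_add; (subst nn_integral_add)?; measurable)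
    finally show ?thesis .
  qed
  have m1: "(\<lambda>(t, y). ennreal (cmod ((K x y - K x' y) * g y)) * indicator {y. dist x y < t \<and> dist x' y < t} y)
      \<in> borel_measurable (borel \<Otimes>\<^sub>M \<mu>)" by measurable
  have m2: "(\<lambda>(t, y). ennreal (cmod (K x y * g y)) * indicator {y. dist x y < t \<and> t \<le> dist x' y} y)
      \<in> borel_measurable (borel \<Otimes>\<^sub>M \<mu>)" for x x' by measurable
  have [measurable]: "Q1 \<in> borel_measurable borel"
    unfolding Q1_def[abs_def] by (rule borel_measurable_nn_integral[OF m1])
  have [measurable]: "Q2 \<in> borel_measurable borel"
    unfolding Q2_def[abs_def] by (rule borel_measurable_nn_integral[OF m2])
  have [measurable]: "Q3 \<in> borel_measurable borel"
    unfolding Q3_def[abs_def] by (rule borel_measurable_nn_integral[OF m2])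
  have "tnorm Q1 \<le> ennreal (A * CK)"
  proof -
    let ?g = "\<lambda>y. ennreal (cmod ((K x y - K x' y) * g y))"
    let ?h = "\<lambda>y. ennreal ((cmod (K y x - K y x') + cmod (K x y - K x' y)) * (1 / dist y x)) * indicator {y. 2 * dist x x' \<le> dist y x} y"
    have hm: "?h \<in> borel_measurable \<mu>" by measurable
    have "tnorm Q1 \<le> (\<integral>\<^sup>+ y. ?g y * ennreal (1 / dist x y) \<partial>\<mu>)"
      unfolding Q1_def
    proof (rule tnorm_Minkowski)
      fix y assume "?g y \<noteq> 0"
      then have "g y \<noteq> 0" by auto
      then have "y \<notin> ball x R" using g(2) by blast
      then have "0 < dist x y" using R(1) unfolding mem_ball by linarith
      have "(\<integral>\<^sup>+ t. indicator {t. dist x y < t \<and> dist x' y < t} t * tw t \<partial>lborel)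
        \<le> (\<integral>\<^sup>+ t. indicator {t. dist x y < t} t * tw t \<partial>lborel)"
        by (intro nn_integral_mono) (auto simp: indicator_def)
      also have "\<dots> \<le> (ennreal (1 / dist x y))\<^sup>2"
        by (rule nn_integral_inverse_cube) fact
      finally show "(\<integral>\<^sup>+ t. indicator {t. dist x y < t \<and> dist x' y < t} t * tw t \<partial>lborel)
        \<le> (ennreal (1 / dist x y))\<^sup>2" .
    next
      show "?g \<in> borel_measurable \<mu>" by measurable
      show "(\<lambda>y. ennreal (1 / dist x y)) \<in> borel_measurable \<mu>" by measurable
      show "Measurable.pred (\<mu> \<Otimes>\<^sub>M borel) (\<lambda>(y, t). dist x y < t \<and> dist x' y < t)" by measurable
    qed (rule sigma_finite_mu)
    also have "\<dots> \<le> (\<integral>\<^sup>+ y. ennreal A * ?h y \<partial>\<mu>)"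
    proof (rule nn_integral_mono_AE)
      show "AE y in \<mu>. ?g y * ennreal (1 / dist x y) \<le> ennreal A * ?h y"
        using bdd_AE[OF g(1)]
      proof eventually_elim
        case (elim y)
        show ?case
        proof (cases "g y = 0")
          case False
          then have "y \<notin> ball x R" using g(2) by blast
          then have d: "2 * dist x x' \<le> dist y x" using R zero_le_dist[of x x'] by (simp add: dist_commute)
          have "cmod (K x y - K x' y) * cmod (g y) \<le> (cmod (K y x - K y x') + cmod (K x y - K x' y)) * A"
            using elim by (intro mult_mono) auto
          then have "cmod ((K x y - K x' y) * g y) * (1 / dist x y)
             \<le> A * ((cmod (K y x - K y x') + cmod (K x y - K x' y)) * (1 / dist y x))"
            using mult_right_mono[of _ _ "1 / dist x y"] by (simp add: norm_mult dist_commute mult_ac)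
          then show ?thesis using d A
            by (subst ennreal_mult[symmetric]) (auto simp: ennreal_mult[symmetric] intro!: ennreal_leI)
        qed simp
      qed
    qed
    also have "\<dots> = ennreal A * (\<integral>\<^sup>+ y. ?h y \<partial>\<mu>)" by (rule nn_integral_cmult[OF hm])
    also have "\<dots> \<le> ennreal A * ennreal CK"
      by (intro mult_left_mono K_regular) auto
    finally show ?thesis using A CK_pos by (simp add: ennreal_mult)
  qed
  moreover have "tnorm Q2 \<le> ennreal (CK * A * (4 * growth 2))"
    unfolding Q2_def
  proof (rule marc_shift[where R=R])
    fix y
    show "dist x' y - dist x y \<le> R"
      using R dist_triangle[of x' y x] zero_le_dist[of x x'] by (simp add: dist_commute)
  qed (use g R in auto)
  moreover have "tnorm Q3 \<le> ennreal (CK * A * (4 * growth 2))"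
    unfolding Q3_def
  \<comment> \<open>Seen from x', the function vanishes on a smaller ball: x and x' are at most R /
    3 apart, so 2 * R / 3 is the radius that remains.\<close>
  proof (rule marc_shift[where R="2 * R / 3"])
    fix y
    show "dist x y - dist x' y \<le> 2 * R / 3"
      using R dist_triangle[of x y x'] zero_le_dist[of x x'] by (simp add: dist_commute)
    assume "y \<in> ball x' (2 * R / 3)"
    then have "y \<in> ball x R" using R dist_triangle[of x y x'] by simp
    then show "g y = 0" by (rule g(2))
  qed (use g R in auto)
  moreover have "tnorm (\<lambda>t. Q1 t + (Q2 t + Q3 t)) \<le> tnorm Q1 + (tnorm Q2 + tnorm Q3)"
    by (rule order_trans[OF tnorm_triangle]) (measurable, intro add_left_mono tnorm_triangle, measurable)
  ultimately have "tnorm (\<lambda>t. Q1 t + (Q2 t + Q3 t))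
      \<le> ennreal (A * CK) + (ennreal (CK * A * (4 * growth 2)) + ennreal (CK * A * (4 * growth 2)))"
    by (meson add_mono order_trans)
  also have "\<dots> = ennreal (creg * A)"
  proof -
    have e: "creg * A = A * CK + (CK * A * (4 * growth 2) + CK * A * (4 * growth 2))"
      by (simp add: creg_def algebra_simps)
    have nn: "0 \<le> A * CK" "0 \<le> CK * A * (4 * growth 2)" using A CK_pos by auto
    show ?thesis
      unfolding e ennreal_plus[OF nn(1) add_nonneg_nonneg[OF nn(2) nn(2)]] ennreal_plus[OF nn(2) nn(2)] ..
  qed
  finally have Q: "tnorm (\<lambda>t. Q1 t + (Q2 t + Q3 t)) \<le> ennreal (creg * A)" .
  have "marc g x \<le> tnorm (\<lambda>t. ennreal (cmod (inner_int x' g t)) + (Q1 t + (Q2 t + Q3 t)))"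
    unfolding marc_eq_tnorm
  proof (rule tnorm_mono)
    fix t
    have "ennreal (cmod (inner_int x g t)) \<le> ennreal (cmod (inner_int x' g t) + cmod (inner_int x g t - inner_int x' g t))"
      by (intro ennreal_leI norm_triangle_sub)
    also have "\<dots> = ennreal (cmod (inner_int x' g t)) + ennreal (cmod (inner_int x g t - inner_int x' g t))" by simp
    also have "\<dots> \<le> ennreal (cmod (inner_int x' g t)) + (Q1 t + (Q2 t + Q3 t))"
      by (intro add_left_mono diff)
    finally show "ennreal (cmod (inner_int x g t)) \<le> ennreal (cmod (inner_int x' g t)) + (Q1 t + (Q2 t + Q3 t))" .
  qed
  also have "\<dots> \<le> marc g x' + tnorm (\<lambda>t. Q1 t + (Q2 t + Q3 t))"
  proof -
    note [measurable] = inner_int_measurable_t[OF gm, of x']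
    show ?thesis unfolding marc_eq_tnorm by (rule tnorm_triangle) measurable
  qed
  also have "\<dots> \<le> marc g x' + ennreal (creg * A)" by (intro add_left_mono Q)
  finally show ?thesis .
qed

text \<open>The three summands pay for moving the point, for the annulus between the two
  truncations, and for truncating at y.\<close>

definition cfar :: real where "cfar = creg + CK * growth 9 + CK * 2 * growth 2"

lemma cfar_nonneg: "0 \<le> cfar"
  using CK_pos by (auto simp: cfar_def creg_def)

text \<open>The far part varies boundedly over \<open>ball c r\<close>, so x may be replaced by y.
  At y, cutting off \<open>ball c (8 * r)\<close> differs from cutting off \<open>ball y r\<close>
  by a function on an annulus around y of ratio 9, and the latter truncation is compared with the
  full Marcinkiewicz integral.\<close>

lemma marc_far:
  assumes f: "bdd A f" and x: "x \<in> ball c r" and y: "y \<in> ball c r"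
  shows "marc (restr (- ball c (8 * r)) f) x \<le> marc f y + ennreal (cfar * A)"
proof -
  have A: "0 \<le> A" using assms(1) by (rule bdd_nonneg)
  have r: "0 < r" using x by (auto intro: le_less_trans[OF zero_le_dist])
  let ?g = "restr (- ball c (8 * r)) f"
  let ?S = "ball c (8 * r) - ball y r"
  have gb: "bdd A ?g" by (rule bdd_restr[OF _ f]) auto
  have "marc ?g x \<le> marc ?g y + ennreal (creg * A)"
  \<comment> \<open>Two points of \<open>ball c r\<close> are less than 2 * r apart, which requires
    6 * r; the function vanishes within 7 * r of x.\<close>
  proof (rule marc_regular[where R="6 * r"])
    show "3 * dist x y \<le> 6 * r" using x y dist_triangle[of x y c] by (simp add: dist_commute)
    show "?g z = 0" if "z \<in> ball x (6 * r)" for z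
    proof -
      have "dist c z < 8 * r" using that x dist_triangle[of c z x] r unfolding mem_ball by linarith
      then show ?thesis by (simp add: restr_def)
    qed
  qed (use gb r in auto)
  also have "marc ?g y \<le> marc (restr (- ball y r) f) y + marc (\<lambda>z. - restr ?S f z) y"
  proof -
    have "?g = (\<lambda>z. restr (- ball y r) f z + - restr ?S f z)"
    proof
      fix z show "?g z = restr (- ball y r) f z + - restr ?S f z"
        using y dist_triangle[of c z y] r by (auto simp: restr_def)
    qed
    moreover have "bdd A (\<lambda>z. - restr ?S f z)"
      using bdd_restr[of ?S, OF _ f] by (auto simp: bdd_def)
    ultimately show ?thesis
      using marc_triangle[OF bdd_restr[of "- ball y r", OF _ f], of A "\<lambda>z. - restr ?S f z" y] by simp
  qed
  also have "marc (\<lambda>z. - restr ?S f z) y \<le> ennreal (CK * A * growth 9)"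
  proof -
    have b: "bdd A (\<lambda>z. - restr ?S f z)"
      using bdd_restr[of ?S, OF _ f] by (auto simp: bdd_def)
    have "marc (\<lambda>z. - restr ?S f z) y \<le> ennreal (CK * A) * wt_int y ?S"
      by (rule marc_size_bdd[OF b]) (auto simp: restr_def)
    also have "wt_int y ?S
        \<le> wt_int y (annulus y r (9 * r))"
    proof (intro nn_integral_mono mult_left_mono)
      fix z show "indicator ?S z \<le> (indicator (annulus y r (9 * r)) z :: ennreal)"
        using y dist_triangle[of y z c] by (auto simp: indicator_def dist_commute)
    qed auto
    also have "\<dots> \<le> ennreal (growth (9 * r / r))" using r by (intro annulus_wt) auto
    finally show ?thesis using A CK_pos r by (simp add: ennreal_mult mult_left_mono)
  qed
  also have "marc (restr (- ball y r) f) y \<le> marc f y + ennreal (CK * A * 2 * growth 2)"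
    by (rule marc_truncate[OF f r])
  finally have "marc ?g x \<le> marc f y + ennreal (CK * A * 2 * growth 2) + ennreal (CK * A * growth 9) + ennreal (creg * A)"
    by (simp add: add_right_mono)
  also have "\<dots> = marc f y + (ennreal (CK * A * 2 * growth 2) + ennreal (CK * A * growth 9) + ennreal (creg * A))"
    by (simp add: add.assoc)
  also have "ennreal (CK * A * 2 * growth 2) + ennreal (CK * A * growth 9) + ennreal (creg * A) = ennreal (cfar * A)"
  proof -
    have e: "cfar * A = (CK * A * 2 * growth 2 + CK * A * growth 9) + creg * A"
      by (simp add: cfar_def algebra_simps)
    show ?thesis unfolding e using A CK_pos creg_nonneg by simp
  qed
  finally show ?thesis .
qed

definition cmean :: real where "cmean = CK * Clam * growth 2 * 8 * growth 2 + CK"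

text \<open>After time T = \<open>dist x c + r\<close> the ball around x contains the whole support,
  so mean zero allows subtracting \<open>K x c\<close>; by Tonelli's theorem the regularity
  condition then applies for each fixed y. Before T, a point y counts only during a window of length
  at most 2 * r, which gives the decay needed for \<open>far_wt\<close>.\<close>

lemma marc_mean_zero_far:
  assumes b: "bdd A b" and r: "0 < r" and supp: "\<And>y. y \<notin> ball c r \<Longrightarrow> b y = 0"
    and mean: "(LINT y|\<mu>. b y) = 0"
  shows "(\<integral>\<^sup>+ x. marc b x * indicator (- ball c (2 * r)) x \<partial>\<mu>) \<le> ennreal cmean * (\<integral>\<^sup>+ y. ennreal (cmod (b y)) \<partial>\<mu>)"
proof -
  have A: "0 \<le> A" using b by (rule bdd_nonneg)
  note bm [measurable] = bdd_measurable[OF b]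
  define B1 where "B1 = (\<integral>\<^sup>+ y. ennreal (cmod (b y)) \<partial>\<mu>)"
  define H where "H x = (\<integral>\<^sup>+ y. ennreal (cmod ((K x y - K x c) * b y)) \<partial>\<mu>)" for x
  have "(\<integral>\<^sup>+ y. ennreal (cmod (b y)) \<partial>\<mu>) \<le> (\<integral>\<^sup>+ y. ennreal A * indicator (ball c r) y \<partial>\<mu>)"
    using bdd_AE[OF b] supp by (intro nn_integral_mono_AE) (auto elim!: eventually_mono simp: indicator_def intro!: ennreal_leI)
  also have "\<dots> = ennreal A * emeasure \<mu> (ball c r)" by (rule nn_integral_cmult_indicator) (simp add: sets_mu)
  also have "\<dots> < \<infinity>" by (simp add: ennreal_mult_less_top emeasure_ball_finite[simplified])
  finally have b_int: "integrable \<mu> b" by (intro integrableI_bounded) auto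
  define q where "q x = 2 * CK * Clam * growth 2 * (sqrt (2 * r / dist c x) * wt c x)" for x
  have q0: "0 \<le> q x" for x using CK_pos Clam_ge_1 r by (auto simp: q_def)
  have pt: "marc b x \<le> ennreal (q x) * B1 + H x * ennreal (1 / dist x c)" if x: "x \<notin> ball c (2 * r)" for x
  proof -
    define T where "T = dist x c + r"
    have d: "2 * r \<le> dist x c" using x by (simp add: dist_commute)
    have T: "0 < T" using d r by (simp add: T_def)
    define Q where "Q t = (\<integral>\<^sup>+ y. ennreal (cmod (K x y * b y)) * indicator {y. dist x y < t \<and> t \<le> T} y \<partial>\<mu>)" for t
    have [measurable]: "Q \<in> borel_measurable borel"
      unfolding Q_def[abs_def] by (rule borel_measurable_nn_integral) measurable
    have near: "dist x y \<le> 2 * dist x c" "dist x c \<le> 2 * dist x y" "dist x y < T" "T - dist x y \<le> 2 * r" if "b y \<noteq> 0" for y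
    proof -
      have "dist c y < r" using supp[of y] that by auto
      then show "dist x y \<le> 2 * dist x c" "dist x c \<le> 2 * dist x y" "dist x y < T" "T - dist x y \<le> 2 * r"
        using d dist_triangle[of x y c] dist_triangle[of x c y] by (auto simp: dist_commute T_def)
    qed
    have inner_int: "ennreal (cmod (inner_int x b t)) \<le> Q t + H x * indicator {t. T < t} t" for t
    proof (cases "t \<le> T")
      case True
      have "ennreal (cmod (inner_int x b t)) \<le> Q t"
        unfolding Q_def using True
        by (intro order_trans[OF inner_int_le] nn_integral_mono) (auto simp: indicator_def)
      then show ?thesis using True by simp
    next
      case False
      have e: "indicator (ball x t) y *\<^sub>R (K x y * b y) = K x y * b y" for y
        using near[of y] False by (cases "b y = 0") (auto simp: indicator_def)
      have i: "integrable \<mu> (\<lambda>y. K x y * b y)" using inner_int_integrable[OF b, of x t] unfolding e .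
      have "inner_int x b t = (LINT y|\<mu>. K x y * b y)" unfolding inner_int_def e ..
      also have "\<dots> = (LINT y|\<mu>. K x y * b y) - (LINT y|\<mu>. K x c * b y)"
        using mean by simp
      also have "\<dots> = (LINT y|\<mu>. K x y * b y - K x c * b y)"
        using i b_int by (intro Bochner_Integration.integral_diff[symmetric]) auto
      also have "\<dots> = (LINT y|\<mu>. (K x y - K x c) * b y)" by (simp add: left_diff_distrib)
      finally have "ennreal (cmod (inner_int x b t)) \<le> H x"
        unfolding H_def by (simp only: cmod_integral_le)
      then show ?thesis using False by (simp add: add_increasing)
    qed
    have "marc b x \<le> tnorm (\<lambda>t. Q t + H x * indicator {t. T < t} t)"
      unfolding marc_eq_tnorm by (intro tnorm_mono inner_int)
    also have "\<dots> \<le> tnorm Q + tnorm (\<lambda>t. H x * indicator {t. T < t} t)"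
      by (rule tnorm_triangle) measurable
    also have "tnorm (\<lambda>t. H x * indicator {t. T < t} t) \<le> H x * ennreal (1 / T)"
      by (rule tnorm_tail[OF T])
    also have "H x * ennreal (1 / T) \<le> H x * ennreal (1 / dist x c)"
    proof (intro mult_left_mono ennreal_leI divide_left_mono)
      have "0 < dist x c" using d r by linarith
      then show "0 < T * dist x c" using T by simp
    qed (use r in \<open>auto simp: T_def\<close>)
    also have "tnorm Q \<le> ennreal (q x) * B1"
    proof -
      let ?g = "\<lambda>y. ennreal (cmod (K x y * b y))"
      let ?W = "\<lambda>y. ennreal (sqrt (2 * r / dist x y) / dist x y)"
      have "tnorm Q \<le> (\<integral>\<^sup>+ y. ?g y * ?W y \<partial>\<mu>)"
        unfolding Q_def
      proof (rule tnorm_Minkowski)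
        fix y assume "?g y \<noteq> 0"
        then have by0: "b y \<noteq> 0" and dxy: "0 < dist x y" using K_diag[of x] by (cases "x = y"; auto)+
        then show "(\<integral>\<^sup>+ t. indicator {t. dist x y < t \<and> t \<le> T} t * tw t \<partial>lborel)
            \<le> (?W y)\<^sup>2"
          using near[OF by0] r by (intro nn_integral_inverse_cube_Ioc dxy) auto
      next
        show "?g \<in> borel_measurable \<mu>" by measurable
        show "?W \<in> borel_measurable \<mu>" by measurable
        show "Measurable.pred (\<mu> \<Otimes>\<^sub>M borel) (\<lambda>(y, t). dist x y < t \<and> t \<le> T)" by measurable
      qed (rule sigma_finite_mu)
      also have "\<dots> \<le> (\<integral>\<^sup>+ y. ennreal (q x) * ennreal (cmod (b y)) \<partial>\<mu>)"
      proof (intro nn_integral_mono)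
        fix y
        show "?g y * ?W y \<le> ennreal (q x) * ennreal (cmod (b y))"
        proof (cases "b y = 0")
          case False
          note n = near[OF False]
          have dc: "0 < dist x c" using d r by linarith
          then have dxy: "0 < dist x y" using n(2) zero_le_dist[of x y] by linarith
          have cx: "c \<noteq> x" using dc by auto
          have "2 * r / dist x y \<le> 2 * r * (2 / dist x c)"
            using n dxy dc r by (simp add: field_simps)
          \<comment> \<open>The factor 2 is enlarged to a square so that the root taken next is an
            integer.\<close>
          also have "\<dots> \<le> 2\<^sup>2 * (2 * r / dist c x)" using r dc by (simp add: dist_commute divide_right_mono)
          finally have "sqrt (2 * r / dist x y) \<le> sqrt (2\<^sup>2 * (2 * r / dist c x))" by (rule real_sqrt_le_mono)
          then have s: "sqrt (2 * r / dist x y) \<le> 2 * sqrt (2 * r / dist c x)"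
            by (subst (asm) real_sqrt_mult) simp
          have w: "wt x y \<le> Clam * growth 2 * wt c x"
            using n dxy cx by (intro wt_compare) (auto simp: dist_commute)
          have "cmod (K x y) * (sqrt (2 * r / dist x y) / dist x y)
              \<le> (CK * (dist x y * wt x y)) * (sqrt (2 * r / dist x y) / dist x y)"
            using r by (intro mult_right_mono K_size) auto
          also have "\<dots> = CK * (wt x y * sqrt (2 * r / dist x y))" using dxy by simp
          also have "\<dots> \<le> CK * ((Clam * growth 2 * wt c x) * (2 * sqrt (2 * r / dist c x)))"
            using s w CK_pos r Clam_ge_1 by (intro mult_left_mono mult_mono) auto
          also have "\<dots> = q x" by (simp add: q_def)
          finally have "cmod (K x y) * (sqrt (2 * r / dist x y) / dist x y) * cmod (b y) \<le> q x * cmod (b y)"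
            by (intro mult_right_mono) auto
          then have "cmod (K x y * b y) * (sqrt (2 * r / dist x y) / dist x y) \<le> q x * cmod (b y)"
            by (simp add: norm_mult mult_ac)
          then show ?thesis using q0[of x] r
            by (subst (1 2) ennreal_mult[symmetric]) (auto intro!: ennreal_leI)
        qed simp
      qed
      also have "\<dots> = ennreal (q x) * B1" unfolding B1_def by (rule nn_integral_cmult) measurable
      finally show ?thesis .
    qed
    finally show ?thesis by (simp add: add_right_mono)
  qed
  have [measurable]: "H \<in> borel_measurable \<mu>"
    unfolding H_def[abs_def] by (rule borel_measurable_nn_integral) measurable
  have qm [measurable]: "q \<in> borel_measurable \<mu>" unfolding q_def[abs_def] by measurable
  have sm [measurable]: "- ball c (2 * r) \<in> sets \<mu>" by (simp add: sets_mu)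
  have "(\<integral>\<^sup>+ x. marc b x * indicator (- ball c (2 * r)) x \<partial>\<mu>)
      \<le> (\<integral>\<^sup>+ x. B1 * (ennreal (q x) * indicator (- ball c (2 * r)) x)
          + H x * ennreal (1 / dist x c) * indicator (- ball c (2 * r)) x \<partial>\<mu>)"
  proof (intro nn_integral_mono)
    fix x show "marc b x * indicator (- ball c (2 * r)) x \<le> B1 * (ennreal (q x) * indicator (- ball c (2 * r)) x)
          + H x * ennreal (1 / dist x c) * indicator (- ball c (2 * r)) x"
      using pt[of x] by (cases "x \<in> ball c (2 * r)") (auto simp: mult.commute)
  qed
  also have "\<dots> = B1 * (\<integral>\<^sup>+ x. ennreal (q x) * indicator (- ball c (2 * r)) x \<partial>\<mu>)
          + (\<integral>\<^sup>+ x. H x * ennreal (1 / dist x c) * indicator (- ball c (2 * r)) x \<partial>\<mu>)"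
    by (subst nn_integral_add, measurable) (subst nn_integral_cmult, measurable)
  also have "(\<integral>\<^sup>+ x. ennreal (q x) * indicator (- ball c (2 * r)) x \<partial>\<mu>)
      = (\<integral>\<^sup>+ x. ennreal (2 * CK * Clam * growth 2) * (ennreal (sqrt (2 * r / dist c x) * wt c x) * indicator {x. 2 * r \<le> dist c x} x) \<partial>\<mu>)"
    using CK_pos Clam_ge_1 r
    by (intro nn_integral_cong) (auto simp: q_def indicator_def ennreal_mult)
  also have "\<dots> = ennreal (2 * CK * Clam * growth 2) * (\<integral>\<^sup>+ x. ennreal (sqrt (2 * r / dist c x) * wt c x) * indicator {x. 2 * r \<le> dist c x} x \<partial>\<mu>)"
    by (rule nn_integral_cmult) measurable
  also have "\<dots> \<le> ennreal (2 * CK * Clam * growth 2) * ennreal (4 * growth 2)"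
    using r by (intro mult_left_mono far_wt) auto
  also have "\<dots> = ennreal (CK * Clam * growth 2 * 8 * growth 2)"
    using CK_pos Clam_ge_1 by (simp add: ennreal_mult[symmetric])
  also have "(\<integral>\<^sup>+ x. H x * ennreal (1 / dist x c) * indicator (- ball c (2 * r)) x \<partial>\<mu>) \<le> ennreal CK * B1"
  proof -
    interpret P: pair_sigma_finite \<mu> \<mu> ..
    let ?F = "\<lambda>x y. ennreal (cmod ((K x y - K x c) * b y)) * (ennreal (1 / dist x c) * indicator (- ball c (2 * r)) x)"
    have F: "case_prod ?F \<in> borel_measurable (\<mu> \<Otimes>\<^sub>M \<mu>)" by measurable
    have "(\<integral>\<^sup>+ x. H x * ennreal (1 / dist x c) * indicator (- ball c (2 * r)) x \<partial>\<mu>)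
        = (\<integral>\<^sup>+ x. (\<integral>\<^sup>+ y. ?F x y \<partial>\<mu>) \<partial>\<mu>)"
      unfolding H_def
    proof (intro nn_integral_cong)
      fix x assume "x \<in> Sigma_Algebra.space \<mu>"
      show "(\<integral>\<^sup>+ y. ennreal (cmod ((K x y - K x c) * b y)) \<partial>\<mu>) * ennreal (1 / dist x c) * indicator (- ball c (2 * r)) x
         = (\<integral>\<^sup>+ y. ?F x y \<partial>\<mu>)"
        by (subst nn_integral_multc) (measurable, simp add: mult.assoc)
    qed
    also have "\<dots> = (\<integral>\<^sup>+ y. (\<integral>\<^sup>+ x. ?F x y \<partial>\<mu>) \<partial>\<mu>)"
      by (rule P.Fubini'[OF F, symmetric])
    also have "\<dots> \<le> (\<integral>\<^sup>+ y. ennreal CK * ennreal (cmod (b y)) \<partial>\<mu>)"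
    proof (intro nn_integral_mono)
      fix y
      let ?h = "\<lambda>x. ennreal ((cmod (K x c - K x y) + cmod (K c x - K y x)) * (1 / dist x c)) * indicator {x. 2 * dist c y \<le> dist x c} x"
      have hm: "?h \<in> borel_measurable \<mu>" by measurable
      show "(\<integral>\<^sup>+ x. ?F x y \<partial>\<mu>) \<le> ennreal CK * ennreal (cmod (b y))"
      proof (cases "b y = 0")
        case False
        then have y: "dist c y < r" using supp[of y] by auto
        have "(\<integral>\<^sup>+ x. ?F x y \<partial>\<mu>) \<le> (\<integral>\<^sup>+ x. ennreal (cmod (b y)) * ?h x \<partial>\<mu>)"
        proof (intro nn_integral_mono)
          fix x
          show "?F x y \<le> ennreal (cmod (b y)) * ?h x"
          proof (cases "x \<in> ball c (2 * r)")
            case False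
            then have d: "2 * dist c y \<le> dist x c" using y by (simp add: dist_commute)
            have "cmod (K x y - K x c) \<le> cmod (K x c - K x y) + cmod (K c x - K y x)"
              by (simp add: norm_minus_commute)
            then have "cmod ((K x y - K x c) * b y) * (1 / dist x c)
                \<le> cmod (b y) * ((cmod (K x c - K x y) + cmod (K c x - K y x)) * (1 / dist x c))"
              unfolding norm_mult by (simp add: mult.commute mult_left_mono mult_right_mono divide_right_mono)
            then show ?thesis using d False
              by (simp add: ennreal_mult[symmetric])
          qed simp
        qed
        also have "\<dots> = ennreal (cmod (b y)) * (\<integral>\<^sup>+ x. ?h x \<partial>\<mu>)" by (rule nn_integral_cmult[OF hm])
        also have "\<dots> \<le> ennreal (cmod (b y)) * ennreal CK" by (intro mult_left_mono K_regular) auto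
        finally show ?thesis by (simp add: mult.commute)
      qed simp
    qed
    also have "\<dots> = ennreal CK * B1" unfolding B1_def by (rule nn_integral_cmult) measurable
    finally show ?thesis .
  qed
  finally have "(\<integral>\<^sup>+ x. marc b x * indicator (- ball c (2 * r)) x \<partial>\<mu>)
     \<le> B1 * ennreal (CK * Clam * growth 2 * 8 * growth 2) + ennreal CK * B1"
    by (simp add: add_mono mult_left_mono)
  also have "\<dots> = ennreal cmean * B1"
    unfolding cmean_def using CK_pos Clam_ge_1 by (subst ennreal_plus) (auto simp: distrib_right distrib_left mult.commute)
  finally show ?thesis unfolding B1_def .
qed

end

context nonhomogeneous begin

section \<open>Chains of non-doubling balls\<close>

lemma growth_power:
  assumes "0 < t" shows "growth (t ^ k) = Clam * (t powr log 2 Clam) ^ k"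
  using assms by (simp add: growth_def powr_powr mult.commute flip: powr_realpow)

lemma measure_ball_le_lam: "0 < r \<Longrightarrow> measure \<mu> (ball x r) \<le> lam x r"
  using emeasure_ball_le_lam[of r x] lam_pos[of r x] by (simp add: measure_ball)

lemma measure_ball_mono: "ball x r \<subseteq> ball y R \<Longrightarrow> measure \<mu> (ball x r) \<le> measure \<mu> (ball y R)"
  by (rule measure_mono_fmeasurable) (auto simp: fmeasurable_def sets_mu emeasure_ball_finite[simplified])

text \<open>Along the chain the measure grows at least by \<beta> per step, the dominating function
  at most by \<tau>^\<nu> < \<beta>. Since the outermost ball still obeys
  \<open>measure \<le> lam\<close>, the annuli carry geometrically less weight the further they lie
  inside it, and the total does not depend on the length m.\<close>

lemma chain_wt:
  assumes s: "0 < s" and \<tau>: "1 < \<tau>" and \<beta>: "\<tau> powr (log 2 Clam) < \<beta>"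
    and nd: "\<And>i. i < m \<Longrightarrow> \<beta> * measure \<mu> (ball x (\<tau> ^ i * s)) \<le> measure \<mu> (ball x (\<tau> ^ Suc i * s))"
  shows "wt_int x (annulus x s (\<tau> ^ m * s))
     \<le> ennreal (Clam * \<tau> powr (log 2 Clam) / (1 - \<tau> powr (log 2 Clam) / \<beta>))"
proof -
  define L where "L = \<tau> powr (log 2 Clam)"
  define q where "q = L / \<beta>"
  define a where "a i = measure \<mu> (ball x (\<tau> ^ i * s))" for i
  have L: "1 \<le> L" unfolding L_def using \<tau> nu_nonneg by (simp add: ge_one_powr_ge_zero)
  have \<beta>0: "0 < \<beta>" using L \<beta> by (simp add: L_def)
  have q: "0 \<le> q" "q < 1" using L \<beta> \<beta>0 by (auto simp: q_def L_def)
  let ?I = "\<lambda>i. (annulus x (\<tau> ^ i * s) (\<tau> ^ Suc i * s))"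
  have ind: "indicator (annulus x s (\<tau> ^ n * s)) y \<le> (\<Sum>i<n. indicator (?I i) y :: ennreal)" for n y
  proof (induction n)
    case (Suc n)
    have "indicator (annulus x s (\<tau> ^ Suc n * s)) y
        \<le> indicator (annulus x s (\<tau> ^ n * s)) y + (indicator (?I n) y :: ennreal)"
      by (auto simp: indicator_def)
    also have "\<dots> \<le> (\<Sum>i<n. indicator (?I i) y) + indicator (?I n) y" by (intro add_right_mono Suc)
    finally show ?case by simp
  qed (auto simp: indicator_def)
  have geo: "\<beta> ^ k * a i \<le> a (i + k)" if "i + k \<le> m" for i k
    using that
  proof (induction k)
    case (Suc k)
    have "\<beta> ^ Suc k * a i = \<beta> * (\<beta> ^ k * a i)" by simp
    also have "\<dots> \<le> \<beta> * a (i + k)" using Suc \<beta>0 by (intro mult_left_mono) auto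
    also have "\<dots> \<le> a (i + Suc k)" using nd[of "i + k"] Suc by (simp add: a_def)
    finally show ?case .
  qed simp
  have part: "wt_int x (?I i) \<le> ennreal (Clam * L * q ^ (m - 1 - i))" if i: "i < m" for i
  proof -
    define k where "k = m - 1 - i"
    have m: "m = Suc i + k" using i by (simp add: k_def)
    have ts: "0 < \<tau> ^ i * s" using \<tau> s by simp
    define l where "l = lam x (\<tau> ^ i * s)"
    have l: "0 < l" using ts by (auto simp: l_def lam_pos)
    have "wt_int x (?I i)
        \<le> (\<integral>\<^sup>+ y. ennreal (1 / l) * indicator (ball x (\<tau> ^ Suc i * s)) y \<partial>\<mu>)"
      using ts by (intro nn_integral_mono) (auto simp: indicator_def l_def intro!: ennreal_leI wt_le)
    also have "\<dots> = ennreal (1 / l * a (Suc i))"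
      using l by (subst nn_integral_cmult_indicator) (auto simp: sets_mu measure_ball a_def ennreal_mult[symmetric])
    also have "1 / l * a (Suc i) \<le> Clam * L * q ^ k"
    proof -
      have "\<beta> ^ k * a (Suc i) \<le> a m" using geo[of "Suc i" k] m by simp
      also have "a m \<le> lam x (\<tau> ^ m * s)" unfolding a_def using \<tau> s by (intro measure_ball_le_lam) simp
      also have "\<tau> ^ m * s = \<tau> ^ Suc k * (\<tau> ^ i * s)" by (simp add: m power_add mult_ac)
      also have "lam x (\<tau> ^ Suc k * (\<tau> ^ i * s)) \<le> growth (\<tau> ^ Suc k * (\<tau> ^ i * s) / (\<tau> ^ i * s)) * l"
        unfolding l_def
      proof (rule lam_growth[OF ts])
        have "1 \<le> \<tau> ^ Suc k" using \<tau> by (intro one_le_power) simp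
        then show "\<tau> ^ i * s \<le> \<tau> ^ Suc k * (\<tau> ^ i * s)"
          using mult_right_mono[OF _ less_imp_le[OF ts], of 1 "\<tau> ^ Suc k"] by (simp only: mult_1)
      qed
      also have "\<tau> ^ Suc k * (\<tau> ^ i * s) / (\<tau> ^ i * s) = \<tau> ^ Suc k"
        by (rule nonzero_mult_div_cancel_right) (use ts in linarith)
      also have "growth (\<tau> ^ Suc k) = Clam * L ^ Suc k" using \<tau> by (subst growth_power) (auto simp: L_def)
      finally have "a (Suc i) \<le> Clam * L ^ Suc k * l / \<beta> ^ k" using \<beta>0 by (simp add: field_simps)
      also have "\<dots> = l * (Clam * L * q ^ k)" by (simp add: q_def power_divide)
      finally show ?thesis using l by (simp add: field_simps)
    qed
    finally show ?thesis by (simp add: k_def ennreal_leI)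
  qed
  have "wt_int x (annulus x s (\<tau> ^ m * s))
     \<le> (\<integral>\<^sup>+ y. (\<Sum>i<m. ennreal (wt x y) * indicator (?I i) y) \<partial>\<mu>)"
    unfolding sum_distrib_left[symmetric] by (intro nn_integral_mono mult_left_mono ind) auto
  also have "\<dots> = (\<Sum>i<m. \<integral>\<^sup>+ y. ennreal (wt x y) * indicator (?I i) y \<partial>\<mu>)"
    by (rule nn_integral_sum) measurable
  also have "\<dots> \<le> (\<Sum>i<m. ennreal (Clam * L * q ^ (m - 1 - i)))"
    by (intro sum_mono part) simp
  also have "\<dots> = ennreal (\<Sum>i<m. Clam * L * q ^ (m - 1 - i))"
    using Clam_ge_1 L q by (intro sum_ennreal) auto
  also have "(\<Sum>i<m. Clam * L * q ^ (m - 1 - i)) = Clam * L * (\<Sum>i<m. q ^ i)"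
    using sum.nat_diff_reindex[of "\<lambda>i. q ^ i" m] by (simp add: sum_distrib_left[symmetric])
  also have "\<dots> \<le> Clam * L * (1 / (1 - q))"
  proof (intro mult_left_mono)
    have "(\<Sum>i<m. q ^ i) \<le> (\<Sum>i. q ^ i)" using q by (intro sum_le_suminf summable_geometric) auto
    then show "(\<Sum>i<m. q ^ i) \<le> 1 / (1 - q)" using q by (simp add: suminf_geometric)
  qed (use Clam_ge_1 L in auto)
  finally show ?thesis by (simp add: L_def q_def ennreal_leI)
qed

lemma N0_pos: "1 \<le> N0"
  using space by (simp add: non_homogeneous_space_def geometrically_doubling_def)

text \<open>The exponent in \<open>beta\<close> is at least \<nu>, and the summand 30^n is at least
  1. This provides the strict excess over \<rho>^\<nu> that the chains need.\<close>

lemma beta_gt: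
  assumes "1 < \<rho>" shows "\<rho> powr (log 2 Clam) + 1 \<le> beta Clam N0 \<rho>"
proof -
  have n: "0 \<le> log 2 (real N0)" using N0_pos by simp
  have "\<rho> powr (log 2 Clam) \<le> \<rho> powr (3 * max (log 2 (real N0)) (log 2 Clam))"
    using assms n nu_nonneg by (intro powr_mono) auto
  moreover have "1 \<le> (30::real) powr (log 2 (real N0))" using n by (simp add: ge_one_powr_ge_zero)
  moreover have "0 \<le> (30::real) powr (log 2 Clam)" by simp
  ultimately show ?thesis unfolding beta_def Let_def by linarith
qed

lemma beta_ratio: "1 < \<rho> \<Longrightarrow> \<rho> powr (log 2 Clam) / beta Clam N0 \<rho> \<le> 1"
proof -
  assume \<rho>: "1 < \<rho>"
  have p: "0 < \<rho> powr (log 2 Clam)" using \<rho> by simp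
  then have "0 < beta Clam N0 \<rho>" using beta_gt[OF \<rho>] by linarith
  then show ?thesis using beta_gt[OF \<rho>] by (subst divide_le_eq_1_pos) linarith+
qed

lemma doubling_ball_iff:
  assumes "0 \<le> \<beta>"
  shows "doubling_ball \<mu> \<alpha> \<beta> (x, r) \<longleftrightarrow> measure \<mu> (ball x (\<alpha> * r)) \<le> \<beta> * measure \<mu> (ball x r)"
  using assms by (simp add: doubling_ball_def pts_def dilate_def measure_ball ennreal_mult[symmetric])

text \<open>Otherwise the measures along \<rho>^j r would grow at rate \<beta> and eventually exceed
  the dominating function, which grows at rate \<rho>^\<nu> < \<beta>.\<close>

lemma doubling_exists:
  assumes "0 < r" "1 < \<rho>" "\<rho> powr (log 2 Clam) < \<beta>"
  shows "\<exists>j\<ge>1. measure \<mu> (ball x (\<rho> ^ Suc j * r)) \<le> \<beta> * measure \<mu> (ball x (\<rho> ^ j * r))"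
proof (rule ccontr)
  assume neg: "\<not> ?thesis"
  define a where "a j = measure \<mu> (ball x (\<rho> ^ j * r))" for j
  define L where "L = \<rho> powr (log 2 Clam)"
  have L: "1 \<le> L" unfolding L_def using assms nu_nonneg by (simp add: ge_one_powr_ge_zero)
  have \<beta>0: "0 < \<beta>" using L assms(3) by (simp add: L_def)
  have step: "\<beta> * a j < a (Suc j)" if "1 \<le> j" for j using neg that by (force simp: a_def)
  have "0 \<le> \<beta> * a 1" using \<beta>0 by (simp add: a_def)
  \<comment> \<open>Failure of doubling is strict, so \<open>a 2\<close> is positive even if
    \<open>a 1\<close> is zero; the geometric growth is started there.\<close>
  then have a2: "0 < a 2" using step[of 1] by (simp add: numeral_2_eq_2)
  have geo: "\<beta> ^ k * a 2 \<le> a (2 + k)" for k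
  proof (induction k)
    case (Suc k)
    have "\<beta> ^ Suc k * a 2 = \<beta> * (\<beta> ^ k * a 2)" by simp
    also have "\<dots> \<le> \<beta> * a (2 + k)" using Suc \<beta>0 by (intro mult_left_mono) auto
    also have "\<dots> \<le> a (2 + Suc k)" using step[of "2 + k"] by simp
    finally show ?case .
  qed simp
  define l where "l = lam x (\<rho>\<^sup>2 * r)"
  have ub: "a (2 + k) \<le> Clam * L ^ k * l" for k
  proof -
    have "a (2 + k) \<le> lam x (\<rho> ^ k * (\<rho>\<^sup>2 * r))"
      unfolding a_def using assms measure_ball_le_lam[of "\<rho> ^ (2 + k) * r" x] by (simp add: power_add power2_eq_square mult_ac)
    also have "\<dots> \<le> growth (\<rho> ^ k * (\<rho>\<^sup>2 * r) / (\<rho>\<^sup>2 * r)) * l"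
      unfolding l_def using assms by (intro lam_growth) (auto simp: one_le_power)
    also have "\<rho> ^ k * (\<rho>\<^sup>2 * r) / (\<rho>\<^sup>2 * r) = \<rho> ^ k" using assms by simp
    also have "growth (\<rho> ^ k) = Clam * L ^ k" using assms by (subst growth_power) (auto simp: L_def)
    finally show ?thesis .
  qed
  obtain k where k: "Clam * l / a 2 < (\<beta> / L) ^ k"
  proof -
    have "1 < \<beta> / L" using assms(3) L by (subst less_divide_eq_1_pos) (auto simp: L_def)
    then show ?thesis using real_arch_pow[of "\<beta> / L" "Clam * l / a 2"] that by blast
  qed
  have "\<beta> ^ k * a 2 \<le> Clam * L ^ k * l" using geo[of k] ub[of k] by linarith
  then have "(\<beta> / L) ^ k \<le> Clam * l / a 2" using a2 L by (simp add: power_divide field_simps)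
  with k show False by simp
qed

text \<open>The exponents start at 1, so nothing is known about the step from r to \<rho> r: it is
  paid by \<open>growth \<rho>\<close>, the non-doubling balls after it by the chain bound.\<close>

definition ctilde :: "real \<Rightarrow> real" where
  "ctilde \<rho> = growth \<rho> + Clam * \<rho> powr (log 2 Clam) / (1 - \<rho> powr (log 2 Clam) / beta Clam N0 \<rho>)"

text \<open>By minimality of J the balls with exponents 1 to J - 1 are not doubling and form a
  chain. The weight bound is the reason why passing to the doubling dilate is harmless, although J
  itself is not bounded.\<close>

lemma tilde_ball:
  assumes r: "0 < r" and \<rho>: "1 < \<rho>"
  obtains J where "1 \<le> J" "tilde_ball \<mu> Clam N0 \<rho> (x, r) = (x, \<rho> ^ J * r)"
    "wt_int x (annulus x r (\<rho> ^ J * r)) \<le> ennreal (ctilde \<rho>)"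
proof -
  let ?\<beta> = "beta Clam N0 \<rho>"
  let ?L = "\<rho> powr (log 2 Clam)"
  let ?P = "\<lambda>j. 1 \<le> j \<and> doubling_ball \<mu> \<rho> ?\<beta> (dilate (\<rho> ^ j) (x, r))"
  have \<beta>: "?L < ?\<beta>" using beta_gt[OF \<rho>] by simp
  have L: "0 < ?L" using \<rho> by simp
  have \<beta>0: "0 \<le> ?\<beta>" using \<beta> L by linarith
  have P: "?P j \<longleftrightarrow> 1 \<le> j \<and> measure \<mu> (ball x (\<rho> ^ Suc j * r)) \<le> ?\<beta> * measure \<mu> (ball x (\<rho> ^ j * r))" for j
    using doubling_ball_iff[OF \<beta>0, of \<rho> x "\<rho> ^ j * r"] by (simp add: dilate_def mult.assoc)
  define J where "J = (LEAST j. ?P j)"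
  have ex: "\<exists>j. ?P j" using doubling_exists[OF r \<rho> \<beta>, of x] unfolding P by blast
  then have PJ: "?P J" unfolding J_def by (rule LeastI_ex)
  have min: "\<not> ?P j" if "j < J" for j using not_less_Least[of j ?P] that by (simp add: J_def)
  have "wt_int x (annulus x (\<rho> * r) (\<rho> ^ (J - 1) * (\<rho> * r)))
     \<le> ennreal (Clam * ?L / (1 - ?L / ?\<beta>))"
  proof (rule chain_wt)
    fix i assume "i < J - 1"
    then have "\<not> ?P (Suc i)" by (intro min) simp
    then show "?\<beta> * measure \<mu> (ball x (\<rho> ^ i * (\<rho> * r))) \<le> measure \<mu> (ball x (\<rho> ^ Suc i * (\<rho> * r)))"
      unfolding P by (simp add: mult_ac)
  qed (use r \<rho> \<beta> in auto)
  note chain = this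
  have "\<rho> ^ (J - 1) * (\<rho> * r) = \<rho> ^ J * r"
    using PJ by (cases J) (auto simp: mult_ac)
  note 1 = chain[unfolded this]
  have 2: "wt_int x (annulus x r (\<rho> * r)) \<le> ennreal (growth (\<rho> * r / r))"
    using r \<rho> by (intro annulus_wt) auto
  have "wt_int x (annulus x r (\<rho> ^ J * r))
      \<le> (\<integral>\<^sup>+ y. ennreal (wt x y) * indicator (annulus x r (\<rho> * r)) y
         + ennreal (wt x y) * indicator (annulus x (\<rho> * r) (\<rho> ^ J * r)) y \<partial>\<mu>)"
    by (intro nn_integral_mono) (auto simp: indicator_def)
  also have "\<dots> = wt_int x (annulus x r (\<rho> * r))
         + wt_int x (annulus x (\<rho> * r) (\<rho> ^ J * r))"
    by (rule nn_integral_add) measurable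
  also have "\<dots> \<le> ennreal (growth \<rho>) + ennreal (Clam * ?L / (1 - ?L / ?\<beta>))"
    using 1 2 r by (intro add_mono) auto
  also have "\<dots> = ennreal (ctilde \<rho>)"
    unfolding ctilde_def using beta_ratio[OF \<rho>] Clam_ge_1 by (subst ennreal_plus) auto
  finally have "wt_int x (annulus x r (\<rho> ^ J * r)) \<le> ennreal (ctilde \<rho>)" .
  moreover have "tilde_ball \<mu> Clam N0 \<rho> (x, r) = (x, \<rho> ^ J * r)"
    unfolding tilde_ball_def J_def by (simp add: dilate_def)
  ultimately show ?thesis using PJ by (intro that[of J]) auto
qed

lemma ctilde_nonneg: "1 < \<rho> \<Longrightarrow> 0 \<le> ctilde \<rho>"
  using beta_ratio[of \<rho>] Clam_ge_1 by (simp add: ctilde_def)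

section \<open>Companion balls\<close>

text \<open>Pigeonhole over a covering by at most N0^k balls.\<close>

lemma heavy_ball:
  assumes "Q \<in> sets borel" "Q \<subseteq> ball c R" "0 < R" "0 < measure \<mu> Q"
  shows "\<exists>x. measure \<mu> Q \<le> real (N0 ^ k) * measure \<mu> (ball x (R / 2 ^ k) \<inter> Q)"
proof (rule ccontr)
  assume neg: "\<not> ?thesis"
  obtain F where F: "finite F" "card F \<le> N0 ^ k" "ball c R \<subseteq> (\<Union>x\<in>F. ball x (R / 2 ^ k))"
    using cover[OF assms(3)] by blast
  let ?E = "\<lambda>x. ball x (R / 2 ^ k) \<inter> Q"
  have fm: "?E x \<in> fmeasurable \<mu>" for x
    using assms(1) emeasure_mono[of "?E x" "ball x (R / 2 ^ k)" \<mu>] emeasure_ball_finite[of x "R / 2 ^ k"]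
    by (intro fmeasurableI) (auto simp: sets_mu intro: le_less_trans)
  have ne: "F \<noteq> {}" using F(3) assms by auto
  have Q: "Q = (\<Union>x\<in>F. ?E x)" using F(3) assms(2) by auto
  have "measure \<mu> Q \<le> (\<Sum>x\<in>F. measure \<mu> (?E x))"
    by (subst Q) (rule measure_UNION_le[OF F(1) fmeasurableD[OF fm]])
  then have "real (N0 ^ k) * measure \<mu> Q \<le> (\<Sum>x\<in>F. real (N0 ^ k) * measure \<mu> (?E x))"
    by (simp add: sum_distrib_left[symmetric] mult_left_mono)
  also have "\<dots> < (\<Sum>x\<in>F. measure \<mu> Q)"
    using neg F(1) ne by (intro sum_strict_mono) (auto simp: not_le)
  also have "\<dots> = real (card F) * measure \<mu> Q" by simp
  also have "\<dots> \<le> real (N0 ^ k) * measure \<mu> Q"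
    using F(2) by (intro mult_right_mono) (auto simp del: of_nat_power)
  finally show False by simp
qed

text \<open>The common larger ball S is \<open>ball c (4 * R)\<close>; coefficients into S integrate
  over 2S, hence the radius \<open>8 * R\<close> in both weight bounds. The distance
  \<open>3 * r\<close> keeps \<open>ball x s\<close> at least r away from
  \<open>ball c (2 * r)\<close>.\<close>

definition companion :: "real \<Rightarrow> real \<Rightarrow> 'a \<Rightarrow> real \<Rightarrow> 'a \<Rightarrow> real \<Rightarrow> real \<Rightarrow> bool" where
  "companion \<kappa> C c r x s R \<longleftrightarrow> 0 < s \<and> 4 * r \<le> R \<and>
     (\<forall>z\<in>ball x s. 3 * r \<le> dist c z \<and> dist c z < 4 * R) \<and>
     0 < measure \<mu> (ball x s) \<and> measure \<mu> (ball x (\<kappa> * s)) \<le> C * measure \<mu> (ball x s) \<and>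
     wt_int c (annulus c r (8 * R)) \<le> ennreal C \<and>
     wt_int x {y. s \<le> dist x y \<and> dist c y < 8 * R} \<le> ennreal C"

text \<open>
  The ball \<open>ball x s\<close> is the first doubling ball met when shrinking around a point
  at which the measure of small balls is almost as large as geometric doubling permits.
\<close>

lemma companion_ball:
  fixes \<kappa> :: real
  obtains C where "0 < C" "\<And>c r. 0 < r \<Longrightarrow> 0 < emeasure \<mu> (- ball c (4 * r)) \<Longrightarrow>
    \<exists>x s R. companion \<kappa> C c r x s R"
proof -
  obtain a where a: "1 \<le> a" "\<kappa> \<le> 2 ^ a"
  proof -
    obtain n where "\<kappa> < 2 ^ n" using real_arch_pow[of 2 \<kappa>] by auto
    then have "\<kappa> \<le> 2 ^ Suc n" by (simp add: power_Suc)  (smt (verit) zero_le_power)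
    then show ?thesis by (intro that[of "Suc n"]) auto
  qed
  define \<tau> :: real where "\<tau> = 2 ^ a"
  define L where "L = \<tau> powr (log 2 Clam)"
  define P where "P = real (N0 ^ a)"
  define \<beta> where "\<beta> = 2 * (P + L)"
  have \<tau>: "2 \<le> \<tau>" using a(1) power_increasing[of 1 a "2::real"] by (simp add: \<tau>_def)
  have L: "1 \<le> L" unfolding L_def using \<tau> nu_nonneg by (simp add: ge_one_powr_ge_zero)
  have N0a: "0 < P" using N0_pos by (simp add: P_def)
  have "0 < P + (P + L)" using L N0a by (intro add_pos_pos) simp_all
  then have \<beta>1: "L < \<beta>" by (simp add: \<beta>_def)
  then have \<beta>0: "0 < \<beta>" "L < \<beta>" using L by simp_all
  have half: "L / \<beta> \<le> 1 / 2" using L N0a by (simp add: \<beta>_def field_simps)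
  define C where "C = \<beta> + growth 4 + growth 8 + growth \<tau> + growth 128 + 2 * (Clam * L)"
  show ?thesis
  proof (rule that[of C])
    have gr: "0 \<le> growth u" for u by simp
    show C0: "0 < C" unfolding C_def using \<beta>0 L Clam_ge_1 by (intro add_pos_nonneg add_nonneg_nonneg) auto
    fix c r assume r: "0 < r" and out: "0 < emeasure \<mu> (- ball c (4 * r))"
    let ?P = "\<lambda>k. 0 < emeasure \<mu> (ball c (2 ^ (k + 3) * r) - ball c (4 * r))"
    have exk: "\<exists>k. ?P k"
    proof (rule ccontr)
      assume "\<not> ?thesis"
      then have "(\<Union>k. ball c (2 ^ (k + 3) * r) - ball c (4 * r)) \<in> null_sets \<mu>"
        by (intro null_sets_UN) (auto simp: null_sets_def sets_mu)
      moreover have "(\<Union>k. ball c (2 ^ (k + 3) * r) - ball c (4 * r)) = - ball c (4 * r)"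
      proof -
        have "\<exists>k. dist c y < 2 ^ (k + 3) * r" for y
        proof -
          obtain k where "dist c y / r < 2 ^ k" using real_arch_pow[of 2 "dist c y / r"] by auto
          then have "dist c y < 2 ^ k * r" using r by (simp add: field_simps)
          also have "\<dots> \<le> 2 ^ (k + 3) * r" using r by (intro mult_right_mono power_increasing) auto
          finally show ?thesis by blast
        qed
        then show ?thesis by auto
      qed
      ultimately show False using out by (simp add: null_sets_def)
    qed
    \<comment> \<open>Minimality makes the shell between 4 * r and R a null set. The weight around c
      then consists of the annuli from r to 4 * r and from R to 8 * R, however large R / r
      is.\<close>
    define k where "k = (LEAST k. ?P k)"
    have Pk: "?P k" unfolding k_def using exk by (rule LeastI_ex)
    define R where "R = 2 ^ (k + 2) * r"
    have R4: "4 * r \<le> R" using r one_le_power[of "2::real" k] by (simp add: R_def)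
    have R: "0 < R" using r R4 by simp
    have null: "emeasure \<mu> (ball c R - ball c (4 * r)) = 0"
    proof (cases k)
      case 0
      then show ?thesis by (simp add: R_def)
    next
      case (Suc j)
      then have "\<not> ?P j" using not_less_Least[of j ?P] by (simp add: k_def)
      then show ?thesis using Suc by (simp add: R_def power_add mult_ac)
    qed
    define Q where "Q = ball c (2 * R) - ball c R"
    have Qm: "Q \<in> sets borel" by (simp add: Q_def)
    have "0 < emeasure \<mu> Q"
    proof -
      have "0 < emeasure \<mu> (ball c (2 * R) - ball c (4 * r))" using Pk by (simp add: R_def power_add mult_ac)
      also have "\<dots> \<le> emeasure \<mu> ((ball c R - ball c (4 * r)) \<union> Q)"
        by (rule emeasure_mono) (auto simp: Q_def sets_mu)
      also have "\<dots> \<le> emeasure \<mu> (ball c R - ball c (4 * r)) + emeasure \<mu> Q"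
        by (rule emeasure_subadditive) (auto simp: Q_def sets_mu)
      finally show ?thesis using null by simp
    qed
    moreover have "emeasure \<mu> Q < \<infinity>"
      using emeasure_mono[of Q "ball c (2 * R)" \<mu>] emeasure_ball_finite[of c "2 * R"]
      by (auto simp: Q_def sets_mu intro: le_less_trans)
    ultimately have mQ: "0 < measure \<mu> Q" by (simp add: measure_def enn2real_positive_iff)
    define M where "M = measure \<mu> (ball c (4 * R))"
    obtain j where j: "M * real (N0 ^ 4) / measure \<mu> Q < 2 ^ j" using real_arch_pow[of 2] by auto
    \<comment> \<open>Since \<tau> = 2^a, the radius \<open>s j\<close> is the covering scale 2 * R
      / 2^(4 + a * j) of \<open>heavy_ball\<close>, which loses exactly the factor N0^4 *
      P^j.\<close>
    define s where "s i = R / 8 / \<tau> ^ i" for i :: nat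
    have s0: "0 < s i" for i using R \<tau> by (simp add: s_def)
    have s_Suc: "\<tau> * s (Suc i) = s i" for i using \<tau> by (simp add: s_def)
    have s_mono: "s i \<le> s i'" if "i' \<le> i" for i i'
      unfolding s_def using that R \<tau> by (intro divide_left_mono power_increasing) auto
    have sj: "s j = 2 * R / 2 ^ (4 + a * j)" by (simp add: s_def \<tau>_def power_add power_mult)
    obtain x where x: "measure \<mu> Q \<le> real (N0 ^ (4 + a * j)) * measure \<mu> (ball x (s j) \<inter> Q)"
      using heavy_ball[OF Qm _ _ mQ, of c "2 * R" "4 + a * j"] R unfolding sj by (auto simp: Q_def)
    have "ball x (s j) \<inter> Q \<noteq> {}" using x mQ by (metis measure_empty mult_zero_right not_le)
    then obtain z where z: "dist x z < s j" "dist c z < 2 * R" "R \<le> dist c z"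
      by (auto simp: Q_def not_less)
    have s8: "s 0 = R / 8" by (simp add: s_def)
    have s16: "s i \<le> R / 16" if "1 \<le> i" for i
    proof -
      have "s i \<le> s 1" using that by (rule s_mono)
      also have "s 1 \<le> R / 16" using \<tau> R by (simp add: s_def field_simps)
      finally show ?thesis .
    qed
    have cx: "R - R / 8 < dist c x" "dist c x < 2 * R + R / 8"
      using z s_mono[of 0 j] s8 dist_triangle[of c z x] dist_triangle[of c x z] by (auto simp: dist_commute)
    define b where "b i = measure \<mu> (ball x (s i))" for i
    have bj: "measure \<mu> Q \<le> real (N0 ^ (4 + a * j)) * b j"
    proof -
      have "measure \<mu> (ball x (s j) \<inter> Q) \<le> b j"
        unfolding b_def by (rule measure_mono_fmeasurable)
          (auto simp: fmeasurable_def sets_mu Qm emeasure_ball_finite[simplified])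
      then show ?thesis using x by (meson mult_left_mono of_nat_0_le_iff order_trans)
    qed
    then have bj0: "0 < b j" using mQ by (metis b_def less_le_trans measure_nonneg mult_zero_right not_le order_less_le)
    have b_mono: "b i \<le> b i'" if "i' \<le> i" for i i'
      unfolding b_def by (rule measure_ball_mono) (use s_mono[OF that] in auto)
    let ?D = "\<lambda>i. 1 \<le> i \<and> b (i - 1) \<le> \<beta> * b i"
    \<comment> \<open>Without a doubling step up to j, \<open>b j\<close> is at most M / (2 * P)^j,
      whereas \<mu>(Q) is at most N0^4 * P^j * \<open>b j\<close>. Together they give 2^j \<mu>(Q)
      \<le> M * N0^4, against the choice of j.\<close>
    have exi: "\<exists>i\<le>j. ?D i"
    proof (rule ccontr)
      assume neg: "\<not> ?thesis"
      have geo: "\<beta> ^ i * b i \<le> b 0" if "i \<le> j" for i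
        using that
      proof (induction i)
        case (Suc i)
        have "\<beta> * b (Suc i) \<le> b i" using neg Suc.prems by (metis Suc_eq_plus1 add_diff_cancel_right' le_add2 less_imp_le not_le)
        then have "\<beta> ^ i * (\<beta> * b (Suc i)) \<le> \<beta> ^ i * b i" using \<beta>0 by (intro mult_left_mono) auto
        also have "\<dots> \<le> b 0" using Suc by simp
        finally show ?case by (simp add: mult_ac)
      qed simp
      have "b 0 \<le> M"
        unfolding b_def M_def
      proof (rule measure_ball_mono, rule subsetI)
        fix y assume "y \<in> ball x (s 0)"
        then show "y \<in> ball c (4 * R)" using cx s8 R dist_triangle[of c y x] by simp
      qed
      have "2 ^ j * real (N0 ^ a) ^ j * b j \<le> \<beta> ^ j * b j"
        unfolding power_mult_distrib[symmetric] using L bj0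
        by (intro mult_right_mono power_mono) (auto simp: \<beta>_def P_def)
      also have "\<dots> \<le> M" using geo[of j] \<open>b 0 \<le> M\<close> by simp
      finally have "2 ^ j * real (N0 ^ a) ^ j * b j \<le> M" .
      then have "2 ^ j * real (N0 ^ a) ^ j * b j * real (N0 ^ 4) \<le> M * real (N0 ^ 4)"
        by (rule mult_right_mono) simp
      then have le: "2 ^ j * (real (N0 ^ 4) * real (N0 ^ a) ^ j * b j) \<le> M * real (N0 ^ 4)"
        by (simp only: mult_ac)
      have e: "real (N0 ^ (4 + a * j)) * b j = real (N0 ^ 4) * real (N0 ^ a) ^ j * b j"
        by (simp add: power_add power_mult)
      have "2 ^ j * measure \<mu> Q \<le> 2 ^ j * (real (N0 ^ (4 + a * j)) * b j)"
        by (intro mult_left_mono bj) simp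
      then have "2 ^ j * measure \<mu> Q \<le> M * real (N0 ^ 4)"
        unfolding e using le by (rule order_trans)
      then show False using j mQ by (simp add: field_simps)
    qed
    define i where "i = (LEAST i. ?D i)"
    have Di: "?D i" unfolding i_def using exi by (intro LeastI_ex[of ?D]) blast
    have ij: "i \<le> j" using exi Least_le[of ?D] unfolding i_def by (meson order_trans)
    have mini: "\<beta> * b i' \<le> b (i' - 1)" if "1 \<le> i'" "i' < i" for i'
      using not_less_Least[of i' ?D] that by (auto simp: i_def)
    have i1: "1 \<le> i" using Di by simp
    show "\<exists>x s R. companion \<kappa> C c r x s R"
      unfolding companion_def
    proof (rule exI[of _ x], rule exI[of _ "s i"], rule exI[of _ R], intro conjI ballI)
      show "0 < s i" by (rule s0)
      show "4 * r \<le> R" by (rule R4)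
      show "0 < measure \<mu> (ball x (s i))" using bj0 b_mono[OF ij] by (simp add: b_def)
      show "3 * r \<le> dist c z" "dist c z < 4 * R" if "z \<in> ball x (s i)" for z
        using that cx s16[OF i1] R4 R dist_triangle[of c x z] dist_triangle[of c z x] by (auto simp: dist_commute)
      have "\<kappa> * s i \<le> \<tau> * s i" using a s0[of i] by (simp add: \<tau>_def)
      also have "\<tau> * s i = s (i - 1)" using s_Suc[of "i - 1"] i1 by simp
      finally have "measure \<mu> (ball x (\<kappa> * s i)) \<le> b (i - 1)" unfolding b_def by (intro measure_ball_mono) auto
      also have "\<dots> \<le> \<beta> * b i" using Di by simp
      also have "\<dots> \<le> C * b i"
        unfolding C_def b_def using L Clam_ge_1 by (intro mult_right_mono) auto
      finally show "measure \<mu> (ball x (\<kappa> * s i)) \<le> C * measure \<mu> (ball x (s i))" by (simp add: b_def)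
      show "wt_int c (annulus c r (8 * R)) \<le> ennreal C"
      proof -
        have "AE y in \<mu>. y \<notin> ball c R - ball c (4 * r)"
          using null by (intro AE_not_in) (auto simp: null_sets_def sets_mu)
        then have "wt_int c (annulus c r (8 * R))
          \<le> (\<integral>\<^sup>+ y. ennreal (wt c y) * indicator (annulus c r (4 * r)) y
              + ennreal (wt c y) * indicator (annulus c R (8 * R)) y \<partial>\<mu>)"
          by (intro nn_integral_mono_AE) (auto elim!: eventually_mono simp: indicator_def)
        also have "\<dots> = wt_int c (annulus c r (4 * r))
              + wt_int c (annulus c R (8 * R))"
          by (rule nn_integral_add) measurable
        also have "\<dots> \<le> ennreal (growth (4 * r / r)) + ennreal (growth (8 * R / R))"
          using r R by (intro add_mono annulus_wt) auto
        also have "\<dots> = ennreal (growth 4 + growth 8)" using r R by simp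
        also have "\<dots> \<le> ennreal C"
          unfolding C_def using L Clam_ge_1 \<beta>0 by (intro ennreal_leI) (auto simp: add_increasing)
        finally show ?thesis .
      qed
      show "wt_int x {y. s i \<le> dist x y \<and> dist c y < 8 * R} \<le> ennreal C"
      proof -
        \<comment> \<open>Outwards from \<open>s i\<close>: one single step, then a chain of steps
          that are not doubling by minimality of i, then the remaining annulus from R / 8 to 16 * R,
          of ratio 128.\<close>
        let ?I1 = "(annulus x (s i) (\<tau> * s i))"
        let ?I2 = "(annulus x (s (i - 1)) (\<tau> ^ (i - 1) * s (i - 1)))"
        let ?I3 = "(annulus x (s 0) (16 * R))"
        have e1: "\<tau> * s i = s (i - 1)" using s_Suc[of "i - 1"] i1 by simp
        have pow: "\<tau> ^ l * s (i - 1) = s (i - 1 - l)" if "l \<le> i - 1" for l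
        proof -
          have "\<tau> ^ (i - 1) = \<tau> ^ l * \<tau> ^ (i - 1 - l)" by (simp only: power_add[symmetric] le_add_diff_inverse[OF that])
          then show ?thesis using \<tau> by (simp add: s_def)
        qed
        have e2: "\<tau> ^ (i - 1) * s (i - 1) = s 0" using pow[of "i - 1"] by simp
        have "wt_int x {y. s i \<le> dist x y \<and> dist c y < 8 * R}
          \<le> (\<integral>\<^sup>+ y. ennreal (wt x y) * indicator ?I1 y + (ennreal (wt x y) * indicator ?I2 y + ennreal (wt x y) * indicator ?I3 y) \<partial>\<mu>)"
        proof (intro nn_integral_mono)
          fix y
          have "dist x y < 16 * R" if "dist c y < 8 * R"
            using that cx R dist_triangle[of x y c] by (simp add: dist_commute)
          then show "ennreal (wt x y) * indicator {y. s i \<le> dist x y \<and> dist c y < 8 * R} y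
            \<le> ennreal (wt x y) * indicator ?I1 y + (ennreal (wt x y) * indicator ?I2 y + ennreal (wt x y) * indicator ?I3 y)"
            unfolding e1 e2 by (cases "dist x y < s (i - 1)"; cases "dist x y < s 0") (auto simp: indicator_def)
        qed
        also have "\<dots> = wt_int x ?I1 + (wt_int x ?I2
            + wt_int x ?I3)"
          by (subst nn_integral_add; (subst nn_integral_add)?; measurable)
        also have "\<dots> \<le> ennreal (growth (\<tau> * s i / s i)) + (ennreal (Clam * L / (1 - L / \<beta>)) + ennreal (growth (16 * R / s 0)))"
        proof (intro add_mono)
          show "wt_int x ?I1 \<le> ennreal (growth (\<tau> * s i / s i))"
            using s0[of i] \<tau> by (intro annulus_wt) auto
          show "wt_int x ?I3 \<le> ennreal (growth (16 * R / s 0))"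
            using s0[of 0] s8 R by (intro annulus_wt) auto
          show "wt_int x ?I2 \<le> ennreal (Clam * L / (1 - L / \<beta>))"
            unfolding L_def
          proof (rule chain_wt)
            fix l assume l: "l < i - 1"
            have "\<beta> * b (i - 1 - l) \<le> b (i - 1 - l - 1)" by (rule mini) (use l in auto)
            then show "\<beta> * measure \<mu> (ball x (\<tau> ^ l * s (i - 1))) \<le> measure \<mu> (ball x (\<tau> ^ Suc l * s (i - 1)))"
              using pow[of l] pow[of "Suc l"] l by (simp add: b_def)
          qed (use s0 \<tau> \<beta>0 in \<open>auto simp: L_def\<close>)
        qed
        also have "\<dots> \<le> ennreal (growth \<tau>) + (ennreal (2 * (Clam * L)) + ennreal (growth 128))"
        proof (intro add_mono ennreal_leI)
          have "Clam * L / (1 - L / \<beta>) \<le> Clam * L / (1 / 2)"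
          proof (intro divide_left_mono)
            show "1 / 2 \<le> 1 - L / \<beta>" using half by linarith
            then have "0 < 1 - L / \<beta>" by (rule less_le_trans[rotated]) simp
            then show "0 < (1 - L / \<beta>) * (1 / 2)" by (rule mult_pos_pos) simp
          qed (use L Clam_ge_1 in simp)
          then show "Clam * L / (1 - L / \<beta>) \<le> 2 * (Clam * L)" by simp
        qed (use s0[of i] R s8 in auto)
        also have "\<dots> = ennreal (growth \<tau> + (2 * (Clam * L) + growth 128))"
          using Clam_ge_1 L by simp
        also have "\<dots> \<le> ennreal C"
          unfolding C_def using \<beta>0 by (intro ennreal_leI) (auto simp: add_increasing)
        finally show ?thesis .
      qed
    qed
  qed
qed


section \<open>Local estimates\<close>


text \<open>Almost every point lies in all of the balls, and since the radii tend to 0 they have at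
  most one common point.\<close>

lemma nested_balls_point:
  assumes "0 < r" "\<And>k. \<exists>x. emeasure \<mu> (- ball x (r / 2 ^ k)) = 0"
  shows "\<exists>x0. AE y in \<mu>. y = x0"
proof -
  obtain x where x: "\<And>k. emeasure \<mu> (- ball (x k) (r / 2 ^ k)) = 0" using assms(2) by metis
  have "AE y in \<mu>. y \<in> ball (x k) (r / 2 ^ k)" for k
  proof -
    have "- ball (x k) (r / 2 ^ k) \<in> null_sets \<mu>" using x[of k] by (auto simp: null_sets_def sets_mu)
    then have "AE y in \<mu>. y \<notin> - ball (x k) (r / 2 ^ k)" by (rule AE_not_in)
    then show ?thesis by simp
  qed
  then have ae: "AE y in \<mu>. \<forall>k. y \<in> ball (x k) (r / 2 ^ k)" by (simp add: AE_all_countable)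
  have eq: "y = z" if "\<forall>k. y \<in> ball (x k) (r / 2 ^ k)" "\<forall>k. z \<in> ball (x k) (r / 2 ^ k)" for y z
  proof -
    have "dist y z \<le> 2 * r / 2 ^ k" for k
      using that[THEN spec, of k] dist_triangle2[of y z "x k"] by (simp add: dist_commute)
    moreover have "(\<lambda>k. 2 * r / 2 ^ k) \<longlonglongrightarrow> 0" by (rule LIMSEQ_divide_realpow_zero) simp
    ultimately have "dist y z \<le> 0" by (intro LIMSEQ_le_const) auto
    then show ?thesis by simp
  qed
  show ?thesis
  proof (cases "\<exists>z. \<forall>k. z \<in> ball (x k) (r / 2 ^ k)")
    case True
    then obtain z where z: "\<forall>k. z \<in> ball (x k) (r / 2 ^ k)" by blast
    have "AE y in \<mu>. y = z" using ae by eventually_elim (rule eq[OF _ z])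
    then show ?thesis by blast
  next
    \<comment> \<open>No common point at all means that the measure is zero; any point will then
      do.\<close>
    case False
    have "AE y in \<mu>. y = undefined"
      by (rule eventually_mono[OF ae]) (use False in blast)
    then show ?thesis ..
  qed
qed

text \<open>
  The radius \<open>u\<close> belongs to the first dyadic scale at which no ball of radius \<open>4u\<close> carries all of
  the measure.  Unless this is the initial scale, some ball of radius \<open>8u\<close> carries all of it, and
  this ball is covered instead of \<open>ball c r\<close>.
\<close>

lemma good_cover:
  assumes r: "0 < r" and nd: "\<nexists>x0. AE y in \<mu>. y = x0"
  obtains u F where "0 < u" "u \<le> r / 2 ^ e" "finite F" "card F \<le> N0 ^ (e + 3)"
    "AE y in \<mu>. y \<in> ball c r \<longrightarrow> (\<exists>x\<in>F. y \<in> ball x u)"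
    "\<And>x. x \<in> F \<Longrightarrow> 0 < emeasure \<mu> (- ball x (4 * u))"
    "\<And>x. x \<in> F \<Longrightarrow> dist c x < r + u"
    "\<And>x. x \<in> F \<Longrightarrow> AE y in \<mu>. y \<in> ball c (2 * r) \<longrightarrow> dist x y < (17 + 4 * 2 ^ e) * u"
proof -
  define t where "t = r / 2 ^ e"
  have t: "0 < t" using r by (simp add: t_def)
  let ?v = "\<lambda>k. \<exists>x. emeasure \<mu> (- ball x (4 * t / 2 ^ k)) = 0"
  have "\<exists>k. \<not> ?v k" using nested_balls_point[of "4 * t"] nd t by auto
  define k where "k = (LEAST k. \<not> ?v k)"
  have nk: "\<not> ?v k" unfolding k_def by (rule LeastI_ex) fact
  define u where "u = t / 2 ^ k"
  have u: "0 < u" "u \<le> t" using t by (auto simp: u_def divide_le_eq)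
  have pos: "0 < emeasure \<mu> (- ball x (4 * u))" for x
    using nk by (auto simp: u_def zero_less_iff_neq_zero)
  show ?thesis
  proof (cases k)
    case 0
    then have ut: "u = r / 2 ^ e" by (simp add: u_def t_def)
    obtain F where F: "finite F" "card F \<le> N0 ^ e" "ball c r \<subseteq> (\<Union>x\<in>F. ball x (r / 2 ^ e))"
      using cover[OF r] by blast
    let ?F = "{x\<in>F. ball x u \<inter> ball c r \<noteq> {}}"
    have card: "card ?F \<le> N0 ^ (e + 3)"
    proof -
      have "card ?F \<le> card F" using F(1) by (intro card_mono) auto
      also have "\<dots> \<le> N0 ^ e" by (rule F(2))
      also have "\<dots> \<le> N0 ^ (e + 3)" using N0_pos by (intro power_increasing) auto
      finally show ?thesis .
    qed
    have near: "dist c x < r + u" if "x \<in> ?F" for x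
    proof -
      from that obtain z where "dist x z < u" "dist c z < r" by auto
      then show ?thesis using dist_triangle[of c x z] by (simp add: dist_commute)
    qed
    show ?thesis
    proof (rule that[of u ?F])
      show "AE y in \<mu>. y \<in> ball c r \<longrightarrow> (\<exists>x\<in>?F. y \<in> ball x u)"
      proof (rule AE_I2, rule impI)
        fix y assume y: "y \<in> ball c r"
        then obtain x where "x \<in> F" "y \<in> ball x u" using F(3) unfolding ut by blast
        then show "\<exists>x\<in>?F. y \<in> ball x u" using y by blast
      qed
      fix x assume x: "x \<in> ?F"
      \<comment> \<open>Here r = 2^e * u, and the distance is below 3 * r + u. In the other case it
        is below 9 * u + 8 * u; the constant covers both.\<close>
      show "AE y in \<mu>. y \<in> ball c (2 * r) \<longrightarrow> dist x y < (17 + 4 * 2 ^ e) * u"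
      proof (rule AE_I2, rule impI)
        fix y assume "y \<in> ball c (2 * r)"
        then have "dist x y < 3 * r + u" using near[OF x] dist_triangle[of x y c] by (simp add: dist_commute)
        also have "\<dots> = 3 * 2 ^ e * u + u" by (simp add: ut)
        also have "\<dots> \<le> (17 + 4 * 2 ^ e) * u"
          using u by (simp add: distrib_right)
        finally show "dist x y < (17 + 4 * 2 ^ e) * u" .
      qed
    qed (use u F pos near card in \<open>auto simp: t_def\<close>)
  next
    case (Suc j)
    then have "?v j" using not_less_Least[of j "\<lambda>k. \<not> ?v k"] by (simp add: k_def)
    moreover have "4 * t / 2 ^ j = 8 * u" using Suc by (simp add: u_def)
    ultimately obtain x1 where x1: "emeasure \<mu> (- ball x1 (8 * u)) = 0" by auto
    have full: "AE y in \<mu>. y \<in> ball x1 (8 * u)"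
    proof -
      have "- ball x1 (8 * u) \<in> null_sets \<mu>" using x1 by (auto simp: null_sets_def sets_mu)
      then have "AE y in \<mu>. y \<notin> - ball x1 (8 * u)" by (rule AE_not_in)
      then show ?thesis by simp
    qed
    obtain F where F: "finite F" "card F \<le> N0 ^ 3" "ball x1 (8 * u) \<subseteq> (\<Union>x\<in>F. ball x (8 * u / 2 ^ 3))"
      using cover[of "8 * u" 3 x1] u by auto
    let ?F = "{x\<in>F. ball x u \<inter> ball c r \<inter> ball x1 (8 * u) \<noteq> {}}"
    have card: "card ?F \<le> N0 ^ (e + 3)"
    proof -
      have "card ?F \<le> card F" using F(1) by (intro card_mono) auto
      also have "\<dots> \<le> N0 ^ 3" by (rule F(2))
      also have "\<dots> \<le> N0 ^ (e + 3)" using N0_pos by (intro power_increasing) auto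
      finally show ?thesis .
    qed
    have near: "dist c x < r + u" "dist x1 x < 9 * u" if "x \<in> ?F" for x
    proof -
      from that obtain z where "dist x z < u" "dist c z < r" "dist x1 z < 8 * u" by auto
      then show "dist c x < r + u" "dist x1 x < 9 * u"
        using dist_triangle[of c x z] dist_triangle[of x1 x z] by (auto simp: dist_commute)
    qed
    show ?thesis
    proof (rule that[of u ?F])
      show "AE y in \<mu>. y \<in> ball c r \<longrightarrow> (\<exists>x\<in>?F. y \<in> ball x u)"
        using full
      proof eventually_elim
        case (elim y)
        then obtain x where "x \<in> F" "y \<in> ball x u" using F(3) by auto
        then show ?case using elim by blast
      qed
      fix x assume x: "x \<in> ?F"
      show "AE y in \<mu>. y \<in> ball c (2 * r) \<longrightarrow> dist x y < (17 + 4 * 2 ^ e) * u"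
        using full
      proof eventually_elim
        case (elim y)
        then have "dist x y < 17 * u" using near(2)[OF x] dist_triangle[of x y x1] by (simp add: dist_commute)
        also have "\<dots> \<le> (17 + 4 * 2 ^ e) * u" using u by (simp add: distrib_right)
        finally show ?case by simp
      qed
    qed (use u F pos near card in \<open>auto simp: t_def\<close>)
  qed
qed

end

section \<open>Local bounds for bounded functions supported in a ball\<close>

context marcinkiewicz_space begin

text \<open>Seen from y, the whole support lies at a distance comparable to \<open>dist x y\<close>,
  so the weight in \<open>marc_size\<close> may be taken out at the centre.\<close>

lemma marc_off_ball:
  assumes [measurable]: "a \<in> borel_measurable \<mu>" and supp: "\<And>y. y \<notin> ball x u \<Longrightarrow> a y = 0"
    and u: "0 < u" "2 * u \<le> dist x y"
  shows "marc a y \<le> ennreal (CK * Clam * growth 2 * wt x y) * (\<integral>\<^sup>+ z. ennreal (cmod (a z)) \<partial>\<mu>)"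
proof -
  have "(\<integral>\<^sup>+ z. ennreal (cmod (a z) * wt y z) \<partial>\<mu>)
      \<le> (\<integral>\<^sup>+ z. ennreal (Clam * growth 2 * wt x y) * ennreal (cmod (a z)) \<partial>\<mu>)"
  proof (intro nn_integral_mono)
    fix z
    show "ennreal (cmod (a z) * wt y z) \<le> ennreal (Clam * growth 2 * wt x y) * ennreal (cmod (a z))"
    proof (cases "a z = 0")
      case False
      then have z: "dist x z < u" using supp[of z] by auto
      have d: "dist x y \<le> 2 * dist y z" using z u dist_triangle[of x y z] by (simp add: dist_commute)
      have pos: "0 < dist y z" using d u by linarith
      have xy: "x \<noteq> y" using u by auto
      have "wt y z \<le> Clam * growth 2 * wt x y"
        by (rule wt_compare[OF pos _ _ _ xy]) (use d in auto)
      then have "wt y z * cmod (a z) \<le> Clam * growth 2 * wt x y * cmod (a z)" by (rule mult_right_mono) simp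
      then show ?thesis using Clam_ge_1
        by (subst ennreal_mult[symmetric]) (auto intro!: ennreal_leI simp: mult.commute)
    qed simp
  qed
  also have "\<dots> = ennreal (Clam * growth 2 * wt x y) * (\<integral>\<^sup>+ z. ennreal (cmod (a z)) \<partial>\<mu>)"
    by (rule nn_integral_cmult) measurable
  finally have le: "(\<integral>\<^sup>+ z. ennreal (cmod (a z) * wt y z) \<partial>\<mu>)
      \<le> ennreal (Clam * growth 2 * wt x y) * (\<integral>\<^sup>+ z. ennreal (cmod (a z)) \<partial>\<mu>)" .
  have "marc a y \<le> ennreal CK * (\<integral>\<^sup>+ z. ennreal (cmod (a z) * wt y z) \<partial>\<mu>)" by (rule marc_size) fact
  also have "\<dots> \<le> ennreal CK * (ennreal (Clam * growth 2 * wt x y) * (\<integral>\<^sup>+ z. ennreal (cmod (a z)) \<partial>\<mu>))"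
    by (intro mult_left_mono le) simp
  also have "\<dots> = ennreal (CK * Clam * growth 2 * wt x y) * (\<integral>\<^sup>+ z. ennreal (cmod (a z)) \<partial>\<mu>)"
    using CK_pos Clam_ge_1 by (simp add: ennreal_mult mult.assoc)
  finally show ?thesis .
qed

lemma bdd_supp_integral:
  assumes "bdd A a" "\<And>y. y \<notin> ball x u \<Longrightarrow> a y = 0"
  shows "(\<integral>\<^sup>+ z. ennreal (cmod (a z)) \<partial>\<mu>) \<le> ennreal A * emeasure \<mu> (ball x u)"
proof -
  have "(\<integral>\<^sup>+ z. ennreal (cmod (a z)) \<partial>\<mu>) \<le> (\<integral>\<^sup>+ z. ennreal A * indicator (ball x u) z \<partial>\<mu>)"
    using bdd_AE[OF assms(1)]
  proof (intro nn_integral_mono_AE, eventually_elim)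
    case (elim z)
    then show ?case using assms(2)[of z] by (cases "z \<in> ball x u") (auto intro: ennreal_leI)
  qed
  also have "\<dots> = ennreal A * emeasure \<mu> (ball x u)"
    by (rule nn_integral_cmult_indicator) (simp add: sets_mu)
  finally show ?thesis .
qed

text \<open>At the atom itself the integral meets the diagonal only, where the weight is
  zero.\<close>

lemma marc_point_mass:
  assumes "AE y in \<mu>. y = x0" and [measurable]: "g \<in> borel_measurable \<mu>"
  shows "AE x in \<mu>. marc g x = 0"
  using assms(1)
proof eventually_elim
  case (elim x)
  have "AE y in \<mu>. ennreal (cmod (g y) * wt x y) = 0"
    using assms(1) by eventually_elim (simp add: elim wt_def)
  then have "(\<integral>\<^sup>+ y. ennreal (cmod (g y) * wt x y) \<partial>\<mu>) = 0"
    by (subst nn_integral_0_iff_AE) measurable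
  then show ?case using marc_size[of g x] assms(2) by simp
qed

definition local_bound :: "real \<Rightarrow> real \<Rightarrow> bool" where
  "local_bound \<kappa> C \<longleftrightarrow> (\<forall>c r a A. 0 < r \<longrightarrow> bdd A a \<longrightarrow> (\<forall>y. y \<notin> ball c r \<longrightarrow> a y = 0) \<longrightarrow>
     (\<integral>\<^sup>+ x. marc a x * indicator (ball c (2 * r)) x \<partial>\<mu>) \<le> ennreal (C * A) * emeasure \<mu> (ball c (\<kappa> * r)))"

text \<open>A covering by small balls removes both the assumption of mass outside and the factor
  \<kappa>: the \<kappa>-fold small balls still lie in \<open>ball c (\<eta> * r)\<close>. Each
  piece is treated by \<open>loc\<close> on twice its own ball and by the size bound on the rest of
  \<open>ball c (2 * r)\<close>, almost all of which lies in an annulus of bounded ratio around the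
  piece.\<close>

lemma local_bound_improve:
  assumes C: "0 \<le> C" and \<kappa>: "1 \<le> \<kappa>" and \<eta>: "1 < \<eta>"
    and loc: "\<And>c r a A. 0 < r \<Longrightarrow> 0 < emeasure \<mu> (- ball c (4 * r)) \<Longrightarrow> bdd A a \<Longrightarrow> (\<And>y. y \<notin> ball c r \<Longrightarrow> a y = 0) \<Longrightarrow>
     (\<integral>\<^sup>+ x. marc a x * indicator (ball c (2 * r)) x \<partial>\<mu>) \<le> ennreal (C * A) * emeasure \<mu> (ball c (\<kappa> * r))"
  shows "\<exists>C'\<ge>0. local_bound \<eta> C'"
proof -
  \<comment> \<open>With u \<le> r / 2^e this gives r + u + \<kappa> * u \<le> \<eta> * r, the
    inclusion needed for centres within r + u of c.\<close>
  obtain e where e: "(1 + \<kappa>) / (\<eta> - 1) < 2 ^ e" using real_arch_pow[of 2] by auto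
  then have e: "(1 + \<kappa>) / 2 ^ e \<le> \<eta> - 1" using \<eta> by (simp add: field_simps)
  define M :: real where "M = 17 + 4 * 2 ^ e"
  have M: "17 \<le> M" by (simp add: M_def)
  define D where "D = C + CK * Clam * growth 2 * growth (M / 2)"
  have D: "0 \<le> D" using C CK_pos Clam_ge_1 by (simp add: D_def)
  have "local_bound \<eta> (real (N0 ^ (e + 3)) * D)"
    unfolding local_bound_def
  proof (intro allI impI)
    fix c r a A assume r: "0 < r" and a: "bdd A a" and supp: "\<forall>y. y \<notin> ball c r \<longrightarrow> a y = 0"
    have A: "0 \<le> A" using a by (rule bdd_nonneg)
    note am [measurable] = bdd_measurable[OF a]
    show "(\<integral>\<^sup>+ x. marc a x * indicator (ball c (2 * r)) x \<partial>\<mu>)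
        \<le> ennreal (real (N0 ^ (e + 3)) * D * A) * emeasure \<mu> (ball c (\<eta> * r))"
    proof (cases "\<exists>x0. AE y in \<mu>. y = x0")
      case True
      then obtain x0 where "AE y in \<mu>. y = x0" by blast
      then have "AE x in \<mu>. marc a x = 0" using am by (rule marc_point_mass)
      then have "(\<integral>\<^sup>+ x. marc a x * indicator (ball c (2 * r)) x \<partial>\<mu>) = (\<integral>\<^sup>+ x. 0 \<partial>\<mu>)"
        by (intro nn_integral_cong_AE) (auto elim!: eventually_mono)
      then show ?thesis by simp
    next
      case False
      show ?thesis
      proof (rule good_cover[OF r False, of e c])
      fix u F assume u: "0 < u" "u \<le> r / 2 ^ e" and F: "finite F" "card F \<le> N0 ^ (e + 3)"
        and cov: "AE y in \<mu>. y \<in> ball c r \<longrightarrow> (\<exists>x\<in>F. y \<in> ball x u)"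
        and pos: "\<And>x. x \<in> F \<Longrightarrow> 0 < emeasure \<mu> (- ball x (4 * u))"
        and near: "\<And>x. x \<in> F \<Longrightarrow> dist c x < r + u"
        and far: "\<And>x. x \<in> F \<Longrightarrow> AE y in \<mu>. y \<in> ball c (2 * r) \<longrightarrow> dist x y < (17 + 4 * 2 ^ e) * u"
      let ?m = "emeasure \<mu> (ball c (\<eta> * r))"
      define n where "n y = (\<Sum>x\<in>F. indicator (ball x u) y :: real)" for y
      have nm [measurable]: "n \<in> borel_measurable \<mu>"
        unfolding n_def[abs_def] by (intro borel_measurable_sum borel_measurable_indicator) (simp add: sets_mu)
      \<comment> \<open>Dividing by the number of covering balls that contain y splits a into pieces
        that add up to it and still respect the bound A.\<close>
      define b where "b x = restr (ball x u) (\<lambda>y. a y / of_real (n y))" for x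
      have n1: "1 \<le> n y" if "x \<in> F" "y \<in> ball x u" for x y
      proof -
        have "indicator (ball x u) y \<le> n y"
          unfolding n_def using F(1) that(1) by (intro member_le_sum) auto
        then show ?thesis using that(2) by simp
      qed
      have bb: "bdd A (b x)" if x: "x \<in> F" for x
        unfolding bdd_def
      proof (intro conjI A)
        show "b x \<in> borel_measurable \<mu>"
          unfolding b_def by (rule restr_measurable) (simp, measurable)
        show "AE y in \<mu>. cmod (b x y) \<le> A"
          using bdd_AE[OF a]
        proof eventually_elim
          case (elim y)
          show ?case
          proof (cases "y \<in> ball x u")
            case True
            then have "1 \<le> n y" by (rule n1[OF x])
            then have "cmod (a y) / n y \<le> cmod (a y) / 1" by (intro divide_left_mono) auto
            then show ?thesis using True elim \<open>1 \<le> n y\<close> by (simp add: b_def restr_def norm_divide)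
          qed (use A in \<open>simp add: b_def restr_def\<close>)
        qed
      qed
      have bs: "b x y = 0" if "y \<notin> ball x u" for x y using that by (simp add: b_def restr_def)
      have sum: "AE y in \<mu>. a y = (\<Sum>x\<in>F. b x y)"
        using cov
      proof eventually_elim
        case (elim y)
        have "(\<Sum>x\<in>F. b x y) = (\<Sum>x\<in>F. (a y / of_real (n y)) * of_real (indicator (ball x u) y))"
          by (intro sum.cong) (auto simp: b_def restr_def)
        also have "\<dots> = (a y / of_real (n y)) * of_real (n y)"
          unfolding n_def by (simp add: sum_distrib_left)
        finally have s: "(\<Sum>x\<in>F. b x y) = (a y / of_real (n y)) * of_real (n y)" .
        show ?case
        proof (cases "y \<in> ball c r")
          case True
          then obtain x where "x \<in> F" "y \<in> ball x u" using elim by blast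
          then have "1 \<le> n y" by (rule n1)
          then show ?thesis by (simp add: s)
        next
          case False
          then show ?thesis using supp by (simp add: s)
        qed
      qed
      have piece: "(\<integral>\<^sup>+ y. marc (b x) y * indicator (ball c (2 * r)) y \<partial>\<mu>) \<le> ennreal (D * A) * ?m" if x: "x \<in> F" for x
      proof -
        have sub: "ball x (\<kappa> * u) \<subseteq> ball c (\<eta> * r)" "ball x u \<subseteq> ball c (\<eta> * r)"
        proof -
          have "(1 + \<kappa>) * u \<le> (1 + \<kappa>) * (r / 2 ^ e)" using u \<kappa> by (intro mult_left_mono) auto
          also have "\<dots> = (1 + \<kappa>) / 2 ^ e * r" by simp
          also have "\<dots> \<le> (\<eta> - 1) * r" using e r by (intro mult_right_mono) auto
          finally have "r + u + \<kappa> * u \<le> \<eta> * r" by (simp add: algebra_simps)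
          moreover have "u \<le> \<kappa> * u" using u \<kappa> by simp
          ultimately have *: "dist c x + \<kappa> * u \<le> \<eta> * r" using near[OF x] by linarith
          show 1: "ball x (\<kappa> * u) \<subseteq> ball c (\<eta> * r)"
          proof
            fix y assume "y \<in> ball x (\<kappa> * u)"
            then show "y \<in> ball c (\<eta> * r)" using * dist_triangle[of c y x] by simp
          qed
          show "ball x u \<subseteq> ball c (\<eta> * r)" using 1 subset_ball[OF \<open>u \<le> \<kappa> * u\<close>, of x] by blast
        qed
        have m1: "emeasure \<mu> (ball x (\<kappa> * u)) \<le> ?m" "emeasure \<mu> (ball x u) \<le> ?m"
          using sub by (auto intro!: emeasure_mono simp: sets_mu)
        have bm [measurable]: "marc (b x) \<in> borel_measurable \<mu>"
          by (rule marc_measurable[OF bdd_measurable[OF bb[OF x]]])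
        have [measurable]: "ball x (2 * u) \<in> sets \<mu>" by (simp add: sets_mu)
        let ?S = "(annulus x (2 * u) (M * u))"
        have "(\<integral>\<^sup>+ y. marc (b x) y * indicator (ball c (2 * r)) y \<partial>\<mu>)
            \<le> (\<integral>\<^sup>+ y. marc (b x) y * indicator (ball x (2 * u)) y
              + ennreal (CK * Clam * growth 2 * A) * ?m * (ennreal (wt x y) * indicator ?S y) \<partial>\<mu>)"
        proof (rule nn_integral_mono_AE)
          show "AE y in \<mu>. marc (b x) y * indicator (ball c (2 * r)) y \<le> marc (b x) y * indicator (ball x (2 * u)) y
              + ennreal (CK * Clam * growth 2 * A) * ?m * (ennreal (wt x y) * indicator ?S y)"
            using far[OF x]
          proof eventually_elim
            case (elim y)
            show ?case
            proof (cases "y \<in> ball c (2 * r) \<and> y \<notin> ball x (2 * u)")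
              case True
              then have yS: "y \<in> ?S" using elim by (auto simp: M_def)
              have "marc (b x) y \<le> ennreal (CK * Clam * growth 2 * wt x y) * (\<integral>\<^sup>+ z. ennreal (cmod (b x z)) \<partial>\<mu>)"
                using yS u bs by (intro marc_off_ball bdd_measurable[OF bb[OF x]]) auto
              also have "(\<integral>\<^sup>+ z. ennreal (cmod (b x z)) \<partial>\<mu>) \<le> ennreal A * ?m"
                using bdd_supp_integral[OF bb[OF x] bs] m1(2) by (meson mult_left_mono order_trans zero_le)
              also have "ennreal (CK * Clam * growth 2 * wt x y) * (ennreal A * ?m)
                  = ennreal (CK * Clam * growth 2 * A) * ?m * ennreal (wt x y)"
                using CK_pos Clam_ge_1 A by (simp add: ennreal_mult mult_ac)
              finally show ?thesis using True yS by (simp add: mult_left_mono)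
            qed (auto simp: indicator_def)
          qed
        qed
        also have "\<dots> = (\<integral>\<^sup>+ y. marc (b x) y * indicator (ball x (2 * u)) y \<partial>\<mu>)
              + ennreal (CK * Clam * growth 2 * A) * ?m * wt_int x ?S"
          by (subst nn_integral_add, measurable) (subst nn_integral_cmult, measurable)
        also have "\<dots> \<le> ennreal (C * A) * ?m + ennreal (CK * Clam * growth 2 * A) * ?m * ennreal (growth (M / 2))"
        proof (intro add_mono mult_left_mono)
          have "(\<integral>\<^sup>+ y. marc (b x) y * indicator (ball x (2 * u)) y \<partial>\<mu>) \<le> ennreal (C * A) * emeasure \<mu> (ball x (\<kappa> * u))"
            by (rule loc[OF u(1) pos[OF x] bb[OF x] bs])
          also have "\<dots> \<le> ennreal (C * A) * ?m" by (intro mult_left_mono m1) simp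
          finally show "(\<integral>\<^sup>+ y. marc (b x) y * indicator (ball x (2 * u)) y \<partial>\<mu>) \<le> ennreal (C * A) * ?m" .
          have "wt_int x ?S \<le> ennreal (growth (M * u / (2 * u)))"
            using u M by (intro annulus_wt) auto
          then show "wt_int x ?S \<le> ennreal (growth (M / 2))" using u by simp
        qed simp
        also have "\<dots> = ennreal (C * A) * ?m + ennreal (CK * Clam * growth 2 * A * growth (M / 2)) * ?m"
          using CK_pos Clam_ge_1 A by (simp add: ennreal_mult mult_ac)
        also have "\<dots> = ennreal (D * A) * ?m"
        proof -
          have e: "D * A = C * A + CK * Clam * growth 2 * A * growth (M / 2)" by (simp add: D_def algebra_simps)
          have nn: "0 \<le> C * A" "0 \<le> CK * Clam * growth 2 * A * growth (M / 2)" using CK_pos Clam_ge_1 A C by auto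
          show ?thesis unfolding e ennreal_plus[OF nn] by (simp add: distrib_right)
        qed
        finally show ?thesis .
      qed
      have "(\<integral>\<^sup>+ y. marc a y * indicator (ball c (2 * r)) y \<partial>\<mu>)
          \<le> (\<integral>\<^sup>+ y. (\<Sum>x\<in>F. marc (b x) y * indicator (ball c (2 * r)) y) \<partial>\<mu>)"
      proof (intro nn_integral_mono)
        fix y
        have ms: "(\<lambda>y. \<Sum>x\<in>F. b x y) \<in> borel_measurable \<mu>"
          by (intro borel_measurable_sum bdd_measurable[OF bb])
        have "marc a y = marc (\<lambda>y. \<Sum>x\<in>F. b x y) y" by (rule marc_cong_AE[OF am ms sum])
        also have "\<dots> \<le> (\<Sum>x\<in>F. marc (b x) y)" using marc_sum[OF F(1) bb] by simp
        finally show "marc a y * indicator (ball c (2 * r)) y \<le> (\<Sum>x\<in>F. marc (b x) y * indicator (ball c (2 * r)) y)"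
          by (simp add: sum_distrib_right[symmetric] mult_right_mono)
      qed
      also have "\<dots> = (\<Sum>x\<in>F. \<integral>\<^sup>+ y. marc (b x) y * indicator (ball c (2 * r)) y \<partial>\<mu>)"
        by (intro nn_integral_sum borel_measurable_times_ennreal borel_measurable_indicator
            marc_measurable[OF bdd_measurable[OF bb]]) (auto simp: sets_mu)
      also have "\<dots> \<le> (\<Sum>x\<in>F. ennreal (D * A) * ?m)" by (intro sum_mono piece)
      also have "\<dots> = ennreal (real (card F)) * (ennreal (D * A) * ?m)" by (simp add: ennreal_of_nat_eq_real_of_nat)
      also have "\<dots> \<le> ennreal (real (N0 ^ (e + 3))) * (ennreal (D * A) * ?m)"
        using F(2) by (intro mult_right_mono ennreal_leI) (auto simp del: of_nat_power)
      also have "\<dots> = ennreal (real (N0 ^ (e + 3)) * D * A) * ?m"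
        using D A by (simp add: ennreal_mult mult.assoc del: of_nat_power)
      finally show ?thesis .
      qed
    qed
  qed
  moreover have "0 \<le> real (N0 ^ (e + 3)) * D" using D by simp
  ultimately show ?thesis by blast
qed

end

context nonhomogeneous begin

section \<open>Local estimates from the hypotheses\<close>

text \<open>Off the ball the weight is at most the reciprocal of \<open>lam\<close> at its radius,
  and 2S has finite measure, so the Bochner integral agrees with the nonnegative one.\<close>

lemma delta_eq:
  assumes "is_ball B"
  shows "ennreal (delta \<mu> lam B S) = wt_int (fst B) (pts (dilate 2 S) - pts B)"
    and "0 \<le> delta \<mu> lam B S"
proof -
  define x r where "x = fst B" and "r = snd B"
  have r: "0 < r" using assms by (simp add: is_ball_def r_def)
  let ?E = "pts (dilate 2 S) - pts B"
  have E [measurable]: "?E \<in> sets borel" by (simp add: pts_def)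
  have in_E: "r \<le> dist x y" if "y \<in> ?E" for y using that by (auto simp: pts_def x_def r_def)
  have eq: "delta \<mu> lam B S = (LINT y|\<mu>. wt x y * indicator ?E y)"
    unfolding delta_def set_lebesgue_integral_def
  proof (intro Bochner_Integration.integral_cong refl)
    fix y
    show "indicat_real ?E y *\<^sub>R (1 / lam (fst B) (dist y (fst B))) = wt x y * indicat_real ?E y"
    proof (cases "y \<in> ?E")
      case True
      then have "y \<noteq> x" using in_E[OF True] r by auto
      then show ?thesis by (simp add: wt_def x_def dist_commute)
    qed simp
  qed
  show "0 \<le> delta \<mu> lam B S" unfolding eq by (intro Bochner_Integration.integral_nonneg) simp
  have m: "(\<lambda>y. wt x y * indicator ?E y) \<in> borel_measurable \<mu>" by measurable
  have "(\<integral>\<^sup>+ y. ennreal (norm (wt x y * indicator ?E y)) \<partial>\<mu>)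
      \<le> (\<integral>\<^sup>+ y. ennreal (1 / lam x r) * indicator (pts (dilate 2 S)) y \<partial>\<mu>)"
  proof (intro nn_integral_mono)
    fix y
    show "ennreal (norm (wt x y * indicator ?E y)) \<le> ennreal (1 / lam x r) * indicator (pts (dilate 2 S)) y"
      using wt_le[OF r in_E, of y] by (auto simp: indicator_def intro!: ennreal_leI)
  qed
  also have "\<dots> = ennreal (1 / lam x r) * emeasure \<mu> (pts (dilate 2 S))"
    by (rule nn_integral_cmult_indicator) (simp add: pts_def sets_mu)
  also have "\<dots> < \<infinity>" by (simp add: ennreal_mult_less_top pts_def emeasure_ball_finite[simplified])
  finally have "integrable \<mu> (\<lambda>y. wt x y * indicator ?E y)" by (rule integrableI_bounded[OF m])
  then have "ennreal (LINT y|\<mu>. wt x y * indicator ?E y) = (\<integral>\<^sup>+ y. ennreal (wt x y * indicator ?E y) \<partial>\<mu>)"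
    by (intro nn_integral_eq_integral[symmetric]) auto
  also have "\<dots> = wt_int x ?E"
    by (intro nn_integral_cong) (auto simp: indicator_def)
  finally show "ennreal (delta \<mu> lam B S) = wt_int (fst B) ?E"
    unfolding eq x_def .
qed

lemma delta_le:
  assumes "is_ball B" "0 \<le> C" "pts (dilate 2 S) - pts B \<subseteq> E"
    "wt_int (fst B) E \<le> ennreal C"
  shows "delta \<mu> lam B S \<le> C"
proof -
  have "ennreal (delta \<mu> lam B S) \<le> wt_int (fst B) E"
    unfolding delta_eq(1)[OF assms(1)] using assms(3)
    by (intro nn_integral_mono mult_left_mono) (auto simp: indicator_def)
  then have "ennreal (delta \<mu> lam B S) \<le> ennreal C" using assms(4) by (rule order_trans)
  then show ?thesis using assms(2) by simp
qed

lemma Lp_norm_le: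
  assumes p: "1 < p" and [measurable]: "g \<in> borel_measurable \<mu>"
    and G: "0 \<le> G" "AE y in \<mu>. cmod (g y) \<le> G" "\<And>y. y \<notin> ball x s \<Longrightarrow> g y = 0"
    and m: "measure \<mu> (ball x s) \<le> m" "0 < m"
  shows "Lp_norm \<mu> p g \<le> ennreal (G * m powr real_of_ereal (1 / p))"
proof (cases p)
  case (real q)
  then have q: "1 < q" using p by simp
  have "(\<integral>\<^sup>+ y. ennreal (cmod (g y) powr q) \<partial>\<mu>) \<le> (\<integral>\<^sup>+ y. ennreal (G powr q) * indicator (ball x s) y \<partial>\<mu>)"
    using G(2)
  proof (intro nn_integral_mono_AE, eventually_elim)
    case (elim y)
    then show ?case using G(3)[of y] q
      by (cases "y \<in> ball x s") (auto intro!: ennreal_leI powr_mono2)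
  qed
  also have "\<dots> = ennreal (G powr q) * ennreal (measure \<mu> (ball x s))"
    unfolding measure_ball[symmetric] by (rule nn_integral_cmult_indicator) (simp add: sets_mu)
  also have "\<dots> \<le> ennreal (G powr q * m)"
    using m by (subst ennreal_mult[symmetric]) (auto intro!: ennreal_leI mult_left_mono)
  finally have le: "(\<integral>\<^sup>+ y. ennreal (cmod (g y) powr q) \<partial>\<mu>) \<le> ennreal (G powr q * m)" .
  have "epowr (\<integral>\<^sup>+ y. ennreal (cmod (g y) powr q) \<partial>\<mu>) (1 / q) \<le> ennreal ((G powr q * m) powr (1 / q))"
  proof (cases "\<integral>\<^sup>+ y. ennreal (cmod (g y) powr q) \<partial>\<mu>")
    case (real v)
    then have "v \<le> G powr q * m" using le m by simp
    then show ?thesis using real q by (auto simp: epowr_def intro!: ennreal_leI powr_mono2)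
  next
    case top
    then show ?thesis using le by (simp add: top_unique)
  qed
  also have "(G powr q * m) powr (1 / q) = G * m powr (1 / q)"
    using G(1) m q by (simp add: powr_mult powr_powr)
  finally have le: "epowr (\<integral>\<^sup>+ y. ennreal (cmod (g y) powr q) \<partial>\<mu>) (1 / q) \<le> ennreal (G * m powr (1 / q))" .
  have "real_of_ereal (1 / p) = 1 / q" using real q by (simp add: one_ereal_def)
  then show ?thesis using le real by (simp add: Lp_norm_def)
next
  case PInf
  have "esssup \<mu> (\<lambda>y. ennreal (cmod (g y))) \<le> ennreal G"
    using G(2) by (intro esssup_I) (auto elim!: eventually_mono intro: ennreal_leI)
  then show ?thesis using PInf m by (simp add: Lp_norm_def)
qed (use p in auto)

end

section \<open>The local bound under each of the two hypotheses\<close>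

context marcinkiewicz_space begin

lemma ball_sets [measurable]: "ball x r \<in> sets \<mu>"
  by (simp add: sets_mu)

lemma bdd_Linf: "bdd A g \<Longrightarrow> Lp_norm \<mu> \<infinity> g \<le> ennreal A \<and> g \<in> Linf \<mu>"
proof -
  assume g: "bdd A g"
  have [measurable]: "g \<in> borel_measurable \<mu>" by (rule bdd_measurable[OF g])
  have "Lp_norm \<mu> \<infinity> g \<le> ennreal A"
    unfolding Lp_norm_def using bdd_AE[OF g]
    by (auto intro!: esssup_I elim!: eventually_mono intro: ennreal_leI)
  then show ?thesis by (auto simp: Linf_def intro: le_less_trans)
qed

lemma bdd_Linf_b:
  assumes "bdd A g" "\<And>y. y \<notin> ball c r \<Longrightarrow> g y = 0" shows "g \<in> Linf_b \<mu>"
proof -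
  have "{y. g y \<noteq> 0} \<subseteq> ball c r" using assms(2) by blast
  then have "bounded {y. g y \<noteq> 0}" by (rule bounded_subset[OF bounded_ball])
  then show ?thesis using bdd_Linf[OF assms(1)] by (simp add: Linf_b_def)
qed

lemma bdd_integrable:
  assumes "bdd A a" "\<And>y. y \<notin> ball x u \<Longrightarrow> a y = 0"
  shows "integrable \<mu> a" "cmod (LINT y|\<mu>. a y) \<le> A * measure \<mu> (ball x u)"
proof -
  have A: "0 \<le> A" using assms(1) by (rule bdd_nonneg)
  have le: "(\<integral>\<^sup>+ z. ennreal (cmod (a z)) \<partial>\<mu>) \<le> ennreal (A * measure \<mu> (ball x u))"
    using bdd_supp_integral[OF assms] A by (simp add: measure_ball ennreal_mult)
  show i: "integrable \<mu> a"
    using le by (intro integrableI_bounded bdd_measurable[OF assms(1)]) (auto intro: le_less_trans)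
  show "cmod (LINT y|\<mu>. a y) \<le> A * measure \<mu> (ball x u)"
    using order_trans[OF integral_norm_bound_ennreal[OF i] le] A by simp
qed

lemma integrable_L1_loc: "integrable \<mu> (f :: 'a \<Rightarrow> complex) \<Longrightarrow> f \<in> L1_loc \<mu>"
  unfolding L1_loc_def by (auto intro!: integrable_mult_indicator simp: set_integrable_def pts_def sets_mu)

lemma zero_block:
  assumes "1 < p" shows "atomic_block \<mu> lam \<rho> p (\<lambda>_. 0) 0"
proof -
  let ?B = "(undefined, 1) :: 'a metric_ball"
  have B: "is_ball ?B" by (simp add: is_ball_def)
  have z: "Lp_norm \<mu> p (\<lambda>_. 0) \<le> 0"
    using Lp_norm_le[OF assms, of "\<lambda>_. 0" 0 undefined 0 1] by simp
  have "proper_atomic_block \<mu> lam \<rho> p (\<lambda>_. 0) 0"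
    unfolding proper_atomic_block_def
    using B z
    by (intro conjI exI[of _ ?B] exI[of _ "\<lambda>_ _. 0"] exI[of _ "\<lambda>_. ?B"] exI[of _ "\<lambda>_. 0"])
       (auto simp: integrable_L1_loc)
  then show ?thesis by (simp add: atomic_block_def)
qed

text \<open>Decompositions are infinite sequences, so the block is followed by zero blocks of size
  0.\<close>

lemma single_block_norm:
  assumes b: "integrable \<mu> b" "atomic_block \<mu> lam \<rho> p b s" and s: "0 \<le> s" and p: "1 < p"
  shows "b \<in> H1_atb \<mu> lam \<rho> p" "H1_atb_norm \<mu> lam \<rho> p b \<le> ennreal s"
proof -
  let ?b = "\<lambda>j::nat. if j = 0 then b else (\<lambda>_. 0)"
  let ?s = "\<lambda>j::nat. if j = 0 then s else 0"
  have sums: "?s sums s" using sums_single[of 0 "\<lambda>_. s"] by simp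
  have "Lp_norm \<mu> 1 (\<lambda>x. b x - (\<Sum>j<n. ?b j x)) = 0" if n: "1 \<le> n" for n
  proof -
    have "(\<Sum>j<n. ?b j x) = b x" for x
      using n by (subst sum.remove[of _ 0]) auto
    then show ?thesis by (simp add: Lp_norm_def epowr_def)
  qed
  then have "(\<lambda>n. Lp_norm \<mu> 1 (\<lambda>x. b x - (\<Sum>j<n. ?b j x))) \<longlonglongrightarrow> 0"
    by (intro tendsto_eventually) (auto simp: eventually_sequentially)
  then have d: "atb_decomposition \<mu> lam \<rho> p b ?b ?s"
    unfolding atb_decomposition_def using b(2) zero_block[OF p] sums by (auto dest: sums_summable)
  show "b \<in> H1_atb \<mu> lam \<rho> p" unfolding H1_atb_def using b(1) d by blast
  have "ennreal s = ennreal (\<Sum>j. ?s j)" using sums by (simp add: sums_unique[symmetric])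
  then show "H1_atb_norm \<mu> lam \<rho> p b \<le> ennreal s"
    unfolding H1_atb_norm_def using d by (intro Inf_lower) blast
qed

text \<open>The sup bound is the normalisation of an atom with p = \<infinity>. As the support has
  measure at most m, it implies the normalisation for every p.\<close>

lemma atom_norm:
  assumes "1 < p" "g \<in> borel_measurable \<mu>" "0 < m" "0 \<le> d" "measure \<mu> (ball x s) \<le> m"
    "AE y in \<mu>. cmod (g y) \<le> inverse (m * (1 + d))" "\<And>y. y \<notin> ball x s \<Longrightarrow> g y = 0"
  shows "Lp_norm \<mu> p g \<le> ennreal (m powr (real_of_ereal (1 / p) - 1) * inverse (1 + d))"
proof -
  have "Lp_norm \<mu> p g \<le> ennreal (inverse (m * (1 + d)) * m powr real_of_ereal (1 / p))"
    using assms by (intro Lp_norm_le) auto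
  also have "inverse (m * (1 + d)) * m powr real_of_ereal (1 / p) = m powr (real_of_ereal (1 / p) - 1) * inverse (1 + d)"
    using assms by (simp add: powr_diff field_simps)
  finally show ?thesis .
qed

text \<open>Beyond the block estimate there are two costs. The coefficient of the correction is
  comparable to A times the measure of the dilated ball because D is doubling, and on 2B the
  Marcinkiewicz integral of the correction is bounded because D is far enough away.\<close>

lemma local_bound_of_H1:
  assumes \<rho>: "1 < \<rho>" and p: "1 < p"
    and bnd: "bounded_into_L1 \<mu> (H1_atb \<mu> lam \<rho> p) (H1_atb_norm \<mu> lam \<rho> p) marc"
    and \<eta>: "1 < \<eta>"
  shows "\<exists>C\<ge>0. local_bound \<eta> C"
proof -
  obtain Cb where Cb: "0 < Cb" "\<And>f. f \<in> H1_atb \<mu> lam \<rho> p \<Longrightarrow> (\<integral>\<^sup>+ x. marc f x \<partial>\<mu>) \<le> ennreal Cb * H1_atb_norm \<mu> lam \<rho> p f"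
    using bnd unfolding bounded_into_L1_def by blast
  obtain C where C: "0 < C" and comp: "\<And>c r. 0 < r \<Longrightarrow> 0 < emeasure \<mu> (- ball c (4 * r)) \<Longrightarrow>
    \<exists>x s R. companion \<rho> C c r x s R"
    using companion_ball[of \<rho>] by blast
  define D where "D = Cb * ((1 + C) + C * (1 + C)) + CK * Clam * growth 2"
  have D0: "0 \<le> D" using Cb C CK_pos Clam_ge_1 by (simp add: D_def)
  show ?thesis
  proof (rule local_bound_improve[OF D0 _ \<eta>, of "max \<rho> 2"])
    show "1 \<le> max \<rho> 2" by simp
    fix c r a A
    assume r: "0 < r" and out: "0 < emeasure \<mu> (- ball c (4 * r))" and a: "bdd A a" and supp: "\<And>y. y \<notin> ball c r \<Longrightarrow> a y = 0"
    have A: "0 \<le> A" using a by (rule bdd_nonneg)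
    note am [measurable] = bdd_measurable[OF a]
    let ?k = "max \<rho> 2"
    let ?M = "measure \<mu> (ball c (?k * r))"
    define m1 where "m1 = measure \<mu> (ball c (\<rho> * r))"
    have r_le: "r \<le> \<rho> * r" using r \<rho> by simp
    have mono1: "measure \<mu> (ball c r) \<le> m1" unfolding m1_def using r_le by (intro measure_ball_mono subset_ball)
    have mono2: "m1 \<le> ?M" unfolding m1_def using r by (intro measure_ball_mono subset_ball mult_right_mono) auto
    have mono3: "measure \<mu> (ball c (2 * r)) \<le> ?M" using r by (intro measure_ball_mono subset_ball mult_right_mono) auto
    show "(\<integral>\<^sup>+ x. marc a x * indicator (ball c (2 * r)) x \<partial>\<mu>) \<le> ennreal (D * A) * emeasure \<mu> (ball c (?k * r))"
    \<comment> \<open>These are the cases in which the normalising factor \<open>k1\<close> would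
      vanish; then a is zero almost everywhere.\<close>
    proof (cases "A = 0 \<or> m1 = 0")
      case True
      have "AE y in \<mu>. a y = 0"
      proof (cases "A = 0")
        case True
        then show ?thesis using bdd_AE[OF a] by (auto elim!: eventually_mono)
      next
        case False
        then have "measure \<mu> (ball c r) = 0" using True mono1 measure_nonneg[of \<mu> "ball c r"] by linarith
        then have "ball c r \<in> null_sets \<mu>" by (auto simp: null_sets_def sets_mu measure_ball)
        then have "AE y in \<mu>. y \<notin> ball c r" by (rule AE_not_in)
        then show ?thesis by eventually_elim (rule supp)
      qed
      then have "marc a x = 0" for x using am by (rule marc_zero)
      then show ?thesis by simp
    next
      case False
      then have Apos: "0 < A" and m1: "0 < m1" using A measure_nonneg[of \<mu> "ball c (\<rho> * r)"] by (auto simp: m1_def less_le)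
      obtain x s R where s: "0 < s" and R: "4 * r \<le> R"
        and sub: "\<And>z. z \<in> ball x s \<Longrightarrow> 3 * r \<le> dist c z \<and> dist c z < 4 * R"
        and mm: "0 < measure \<mu> (ball x s)" and dbl: "measure \<mu> (ball x (\<rho> * s)) \<le> C * measure \<mu> (ball x s)"
        and w1: "wt_int c (annulus c r (8 * R)) \<le> ennreal C"
        and w0: "wt_int x {y. s \<le> dist x y \<and> dist c y < 8 * R} \<le> ennreal C"
        using comp[OF r out] unfolding companion_def by blast
      define m where "m = measure \<mu> (ball x s)"
      define m0 where "m0 = measure \<mu> (ball x (\<rho> * s))"
      have m: "0 < m" using mm by (simp add: m_def)
      have "s \<le> \<rho> * s" using s \<rho> by simp
      then have mm0: "m \<le> m0" unfolding m_def m0_def by (intro measure_ball_mono subset_ball)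
      have m0: "0 < m0" "m0 \<le> C * m" using m mm0 dbl by (auto simp: m_def m0_def)
      define d1 where "d1 = delta \<mu> lam (c, r) (c, 4 * R)"
      define d0 where "d0 = delta \<mu> lam (x, s) (c, 4 * R)"
      have balls: "is_ball (c, r)" "is_ball (x, s)" "is_ball (c, 4 * R)" using r s R by (auto simp: is_ball_def)
      have d1: "0 \<le> d1" "d1 \<le> C"
        unfolding d1_def using delta_eq(2)[OF balls(1)] C w1
        by (auto intro!: delta_le[OF balls(1), where E="(annulus c r (8 * R))"] simp: pts_def dilate_def)
      have d0: "0 \<le> d0" "d0 \<le> C"
        unfolding d0_def using delta_eq(2)[OF balls(2)] C w0
        by (auto intro!: delta_le[OF balls(2), where E="{y. s \<le> dist x y \<and> dist c y < 8 * R}"] simp: pts_def dilate_def)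
      define I where "I = (LINT y|\<mu>. a y)"
      have I: "cmod I \<le> A * measure \<mu> (ball c r)" unfolding I_def by (rule bdd_integrable[OF a supp])
      \<comment> \<open>Chosen so that a / \<open>k1\<close> and the indicator divided by
        \<open>k2\<close> satisfy exactly the sup bound required by
        \<open>atom_norm\<close>.\<close>
      define k1 where "k1 = A * m1 * (1 + d1)"
      define k2 where "k2 = m0 * (1 + d0)"
      have k: "0 < k1" "0 < k2" using Apos m1 d1 m0 d0 by (auto simp: k1_def k2_def)
      define \<kappa> where "\<kappa> j = (if j = (1::nat) then of_real k1 else - (I / of_real m) * of_real k2)" for j
      define atom where "atom j = (if j = (1::nat) then (\<lambda>y. a y / of_real k1)
         else (\<lambda>y. of_real (indicator (ball x s) y / k2)))" for j
      define Bs where "Bs j = (if j = (1::nat) then (c, r) else (x, s))" for j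
      define h where "h y = (I / of_real m) * of_real (indicator (ball x s) y)" for y
      define b where "b y = a y - h y" for y
      have hb: "bdd (cmod (I / of_real m)) h"
        unfolding bdd_def h_def
        by (auto intro!: AE_I2 mult_left_le borel_measurable_times borel_measurable_of_real borel_measurable_indicator
              simp: norm_mult sets_mu indicator_def)
      have hs: "h y = 0" if "y \<notin> ball x s" for y using that by (simp add: h_def)
      have hi: "integrable \<mu> h" by (rule bdd_integrable[OF hb hs])
      have "(LINT y|\<mu>. h y) = (I / of_real m) * of_real (LINT y|\<mu>. indicator (ball x s) y)"
        unfolding h_def by (simp only: integral_mult_right_zero integral_complex_of_real)
      also have "\<dots> = I" using m by (simp add: m_def)
      finally have hI: "(LINT y|\<mu>. h y) = I" .
      have ai: "integrable \<mu> a" by (rule bdd_integrable[OF a supp])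
      have bi: "integrable \<mu> b" unfolding b_def[abs_def] using ai hi by (rule Bochner_Integration.integrable_diff)
      have b0: "(LINT y|\<mu>. b y) = 0" unfolding b_def[abs_def] using ai hi hI by (simp add: I_def)
      have bk: "b y = \<kappa> 1 * atom 1 y + \<kappa> 2 * atom 2 y" for y
        using k by (simp add: b_def h_def \<kappa>_def atom_def)
      have S0: "ball x s \<subseteq> ball c (4 * R)" using sub by auto
      have S1: "ball c r \<subseteq> ball c (4 * R)" using R r by (intro subset_ball) simp
      define sz where "sz = cmod (\<kappa> 1) + cmod (\<kappa> 2)"
      have "proper_atomic_block \<mu> lam \<rho> p b sz"
        unfolding proper_atomic_block_def
      proof (intro conjI exI[of _ "(c, 4 * R)"] exI[of _ atom] exI[of _ Bs] exI[of _ \<kappa>] ballI allI)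
        show "b \<in> L1_loc \<mu>" using bi by (rule integrable_L1_loc)
        show "is_ball (c, 4 * R)" by fact
        show "y \<notin> pts (c, 4 * R) \<longrightarrow> b y = 0" for y
        proof
          assume "y \<notin> pts (c, 4 * R)"
          then have ny: "y \<notin> ball x s" "y \<notin> ball c r"
            using S0 S1 unfolding pts_def fst_conv snd_conv by blast+
          show "b y = 0" unfolding b_def by (simp only: supp[OF ny(2)] hs[OF ny(1)] diff_self)
        qed
        fix j :: nat assume j: "j \<in> {1, 2}"
        show "is_ball (Bs j)" using balls by (simp add: Bs_def)
        show "pts (Bs j) \<subseteq> pts (c, 4 * R)" using S0 S1 by (simp add: Bs_def pts_def)
        show atm: "atom j \<in> borel_measurable \<mu>"
        proof -
          have "(\<lambda>y. a y / complex_of_real k1) \<in> borel_measurable \<mu>" by measurable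
          moreover have "(\<lambda>y. complex_of_real (indicator (ball x s) y / k2)) \<in> borel_measurable \<mu>" by measurable
          ultimately show ?thesis by (simp add: atom_def del: of_real_divide)
        qed
        show ats: "y \<notin> pts (Bs j) \<longrightarrow> atom j y = 0" for y
          using supp[of y] by (auto simp: Bs_def atom_def pts_def)
        show "Lp_norm \<mu> p (atom j) \<le> ennreal (measure \<mu> (pts (dilate \<rho> (Bs j))) powr (real_of_ereal (1 / p) - 1)
                         * inverse (1 + delta \<mu> lam (Bs j) (c, 4 * R)))"
        proof (cases "j = 1")
          case True
          have "Lp_norm \<mu> p (atom 1) \<le> ennreal (m1 powr (real_of_ereal (1 / p) - 1) * inverse (1 + d1))"
          proof (rule atom_norm[OF p _ m1 d1(1) mono1])
            show "atom 1 \<in> borel_measurable \<mu>" using atm True by simp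
            show "atom 1 y = 0" if "y \<notin> ball c r" for y using supp[OF that] by (simp add: atom_def)
            show "AE y in \<mu>. cmod (atom 1 y) \<le> inverse (m1 * (1 + d1))"
              using bdd_AE[OF a]
            proof eventually_elim
              case (elim y)
              have "cmod (atom 1 y) = cmod (a y) / k1"
                using k by (simp add: atom_def norm_divide)
              also have "\<dots> \<le> A / k1"
                using elim k by (intro divide_right_mono) auto
              also have "\<dots> = inverse (m1 * (1 + d1))" unfolding k1_def using Apos by (simp add: inverse_eq_divide)
              finally show ?case .
            qed
          qed
          then show ?thesis using True by (simp add: Bs_def pts_def dilate_def m1_def d1_def)
        next
          case False
          then have j2: "j = 2" using j by simp
          have "Lp_norm \<mu> p (atom 2) \<le> ennreal (m0 powr (real_of_ereal (1 / p) - 1) * inverse (1 + d0))"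
          proof (rule atom_norm[OF p _ m0(1) d0(1) mm0[unfolded m_def]])
            show "atom 2 \<in> borel_measurable \<mu>" using atm j2 by simp
            show "atom 2 y = 0" if "y \<notin> ball x s" for y using that by (simp add: atom_def)
            show "AE y in \<mu>. cmod (atom 2 y) \<le> inverse (m0 * (1 + d0))"
              unfolding k2_def[symmetric] using k
              by (intro AE_I2) (auto simp: atom_def indicator_def norm_inverse divide_inverse)
          qed
          then show ?thesis using j2 by (simp add: Bs_def pts_def dilate_def m0_def d0_def)
        qed
      qed (auto simp: bk b0 sz_def)
      then have blk: "atomic_block \<mu> lam \<rho> p b sz" by (simp add: atomic_block_def)
      have sz0: "0 \<le> sz" by (simp add: sz_def)
      \<comment> \<open>In the second coefficient the division by m = \<mu>(D) is undone by
        \<open>k2\<close>, as \<mu>(\<rho>D) is at most C * m.\<close>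
      have sz: "sz \<le> A * ?M * ((1 + C) + C * (1 + C))"
      proof -
        have "cmod (\<kappa> 1) \<le> A * ?M * (1 + C)"
        proof -
          have "cmod (\<kappa> 1) = A * m1 * (1 + d1)" using k by (simp add: \<kappa>_def k1_def[symmetric])
          also have "\<dots> \<le> A * ?M * (1 + C)" using Apos m1 d1 mono2 by (intro mult_mono) auto
          finally show ?thesis .
        qed
        moreover have "cmod (\<kappa> 2) \<le> A * ?M * (C * (1 + C))"
        proof -
          have "cmod (\<kappa> 2) = cmod I / m * (m0 * (1 + d0))"
            using m k by (simp add: \<kappa>_def norm_mult norm_divide k2_def[symmetric])
          also have "\<dots> \<le> (A * ?M) / m * (C * m * (1 + C))"
          proof (intro mult_mono divide_right_mono)
            have "cmod I \<le> A * measure \<mu> (ball c r)" by (rule I)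
            also have "\<dots> \<le> A * ?M" using mono1 mono2 A by (intro mult_left_mono) auto
            finally show "cmod I \<le> A * ?M" .
          qed (use m m0 d0 C A in auto)
          also have "\<dots> = A * ?M * (C * (1 + C))" using m by simp
          finally show ?thesis .
        qed
        ultimately show ?thesis by (simp add: sz_def distrib_left)
      qed
      have bb: "bdd (A + cmod (I / of_real m)) b"
      proof -
        have "bdd (cmod (I / of_real m)) (\<lambda>y. - h y)" using hb by (auto simp: bdd_def)
        from bdd_add[OF a this] show ?thesis by (simp add: b_def[abs_def])
      qed
      have ptw: "marc a y * indicator (ball c (2 * r)) y
          \<le> marc b y + ennreal (CK * Clam * growth 2 * A) * indicator (ball c (2 * r)) y" for y
      proof (cases "y \<in> ball c (2 * r)")
        case True
        have "marc a y = marc (\<lambda>y. b y + h y) y" by (simp add: b_def)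
        also have "\<dots> \<le> marc b y + marc h y" by (rule marc_triangle[OF bb hb])
        \<comment> \<open>Every point of D is at least r away from y, so the weight is at most 1 /
          \<open>lam y r\<close>. The mass of h is at most |I|, hence at most A *
          \<open>lam c r\<close>, and the two values of \<open>lam\<close> are comparable.\<close>
        also have "marc h y \<le> ennreal (CK * Clam * growth 2 * A)"
        proof -
          have ly: "0 < lam y r" using r by (rule lam_pos)
          have "marc h y \<le> ennreal (CK * cmod (I / of_real m)) * wt_int y (ball x s)"
            using hs by (intro marc_size_bdd[OF hb]) auto
          also have "wt_int y (ball x s) \<le> (\<integral>\<^sup>+ z. ennreal (1 / lam y r) * indicator (ball x s) z \<partial>\<mu>)"
          proof (intro nn_integral_mono)
            fix z
            have "r \<le> dist y z" if "z \<in> ball x s"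
              using sub[OF that] True dist_triangle[of c z y] by simp
            then show "ennreal (wt y z) * indicator (ball x s) z \<le> ennreal (1 / lam y r) * indicator (ball x s) z"
              using r by (auto simp: indicator_def intro!: ennreal_leI wt_le)
          qed
          also have "\<dots> = ennreal (1 / lam y r * m)"
            using ly by (subst nn_integral_cmult_indicator) (auto simp: sets_mu measure_ball m_def ennreal_mult[symmetric])
          also have "ennreal (CK * cmod (I / of_real m)) * ennreal (1 / lam y r * m) = ennreal (CK * (cmod I / lam y r))"
            using CK_pos ly m by (subst ennreal_mult[symmetric]) (auto simp: norm_divide)
          also have "\<dots> \<le> ennreal (CK * (A * (Clam * growth 2)))"
          proof (intro ennreal_leI mult_left_mono)
            have "cmod I \<le> A * lam c r" using I measure_ball_le_lam[OF r, of c] A by (meson mult_left_mono order_trans)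
            also have "lam c r \<le> Clam * growth 2 * lam y r"
              using r True by (intro lam_compare) auto
            finally have "cmod I \<le> A * (Clam * growth 2 * lam y r)" using A by (simp add: mult_left_mono)
            then show "cmod I / lam y r \<le> A * (Clam * growth 2)" using ly by (simp add: field_simps)
          qed (use CK_pos in simp)
          finally show ?thesis by (simp add: mult_ac mult_left_mono mult_right_mono)
        qed
        finally show ?thesis using True by (simp add: add_left_mono)
      qed simp
      have "(\<integral>\<^sup>+ y. marc a y * indicator (ball c (2 * r)) y \<partial>\<mu>)
         \<le> (\<integral>\<^sup>+ y. marc b y + ennreal (CK * Clam * growth 2 * A) * indicator (ball c (2 * r)) y \<partial>\<mu>)"
        by (intro nn_integral_mono ptw)
      also have "\<dots> = (\<integral>\<^sup>+ y. marc b y \<partial>\<mu>) + ennreal (CK * Clam * growth 2 * A) * emeasure \<mu> (ball c (2 * r))"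
        using marc_measurable[OF bdd_measurable[OF bb]]
        by (subst nn_integral_add) (auto simp: sets_mu nn_integral_cmult_indicator)
      also have "(\<integral>\<^sup>+ y. marc b y \<partial>\<mu>) \<le> ennreal (Cb * sz)"
      proof -
        have "(\<integral>\<^sup>+ y. marc b y \<partial>\<mu>) \<le> ennreal Cb * H1_atb_norm \<mu> lam \<rho> p b"
          by (rule Cb(2)[OF single_block_norm(1)[OF bi blk sz0 p]])
        also have "\<dots> \<le> ennreal Cb * ennreal sz"
          by (intro mult_left_mono single_block_norm(2)[OF bi blk sz0 p]) simp
        finally show ?thesis using Cb sz0 by (simp add: ennreal_mult)
      qed
      also have "ennreal (Cb * sz) \<le> ennreal (Cb * (A * ?M * ((1 + C) + C * (1 + C))))"
        using Cb sz by (intro ennreal_leI mult_left_mono) auto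
      also have "ennreal (CK * Clam * growth 2 * A) * emeasure \<mu> (ball c (2 * r)) \<le> ennreal (CK * Clam * growth 2 * A * ?M)"
        unfolding measure_ball using mono3 CK_pos Clam_ge_1 A
        by (subst ennreal_mult[symmetric]) (auto intro!: ennreal_leI mult_left_mono)
      also have "ennreal (Cb * (A * ?M * ((1 + C) + C * (1 + C)))) + ennreal (CK * Clam * growth 2 * A * ?M)
          = ennreal (Cb * (A * ?M * ((1 + C) + C * (1 + C))) + CK * Clam * growth 2 * A * ?M)"
        by (rule ennreal_plus[symmetric]) (use Cb C A CK_pos Clam_ge_1 in auto)
      also have "Cb * (A * ?M * ((1 + C) + C * (1 + C))) + CK * Clam * growth 2 * A * ?M = D * A * ?M"
        by (simp add: D_def algebra_simps)
      also have "ennreal (D * A * ?M) = ennreal (D * A) * emeasure \<mu> (ball c (?k * r))"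
        unfolding measure_ball using D0 A by (simp add: ennreal_mult)
      finally show ?thesis by (simp add: add_mono)
    qed
  qed
qed

text \<open>Mean oscillation alone does not bound the number attached to 2B. It is anchored at D,
  where the Marcinkiewicz integral of a is bounded outright, and carried over through the common
  ball S. The enlargement \<open>2 * \<rho>\<close> arises because oscillation over 2B is measured
  on \<rho>(2B).\<close>

lemma local_bound_of_RBMO:
  assumes \<rho>: "1 < \<rho>" and C0: "0 < C0" and \<eta>: "1 < \<eta>"
    and bnd: "\<And>f. f \<in> Linf_b \<mu> \<Longrightarrow> (AE x in \<mu>. marc f x < \<infinity>) \<and>
      RBMO_norm \<mu> lam \<rho> (\<lambda>x. of_real (enn2real (marc f x))) \<le> ennreal C0 * Lp_norm \<mu> \<infinity> f"
  shows "\<exists>C\<ge>0. local_bound \<eta> C"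
proof -
  obtain C where C: "0 < C" and comp: "\<And>c r. 0 < r \<Longrightarrow> 0 < emeasure \<mu> (- ball c (4 * r)) \<Longrightarrow>
    \<exists>x s R. companion \<rho> C c r x s R"
    using companion_ball[of \<rho>] by blast
  define E where "E = CK * Clam * growth 2"
  define D where "D = (C0 + 1) + ((C0 + 1) * C + E + 2 * ((C0 + 1) * (1 + C)))"
  have E0: "0 \<le> E" using CK_pos Clam_ge_1 by (simp add: E_def)
  have D0: "0 \<le> D" using C C0 E0 by (simp add: D_def)
  show ?thesis
  proof (rule local_bound_improve[OF D0 _ \<eta>, of "2 * \<rho>"])
    show "1 \<le> 2 * \<rho>" using \<rho> by simp
    fix c r a A
    assume r: "0 < r" and out: "0 < emeasure \<mu> (- ball c (4 * r))" and a: "bdd A a" and supp: "\<And>y. y \<notin> ball c r \<Longrightarrow> a y = 0"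
    have A: "0 \<le> A" using a by (rule bdd_nonneg)
    note am [measurable] = bdd_measurable[OF a]
    show "(\<integral>\<^sup>+ x. marc a x * indicator (ball c (2 * r)) x \<partial>\<mu>) \<le> ennreal (D * A) * emeasure \<mu> (ball c (2 * \<rho> * r))"
    proof (cases "A = 0")
      case True
      then have "AE y in \<mu>. a y = 0" using bdd_AE[OF a] by (auto elim!: eventually_mono)
      then have "marc a x = 0" for x using am by (rule marc_zero)
      then show ?thesis by simp
    next
      case False
      then have Apos: "0 < A" using A by simp
      have aL: "a \<in> Linf_b \<mu>" by (rule bdd_Linf_b[OF a]) (rule supp)
      define g where "g x = enn2real (marc a x)" for x
      have fin: "AE x in \<mu>. marc a x = ennreal (g x)"
        using bnd[OF aL] by (auto simp: g_def elim!: eventually_mono)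
      have gm [measurable]: "g \<in> borel_measurable \<mu>"
        unfolding g_def using marc_measurable[OF am] by measurable
      have "RBMO_norm \<mu> lam \<rho> (\<lambda>x. of_real (g x)) \<le> ennreal C0 * ennreal A"
        unfolding g_def using bnd[OF aL] bdd_Linf[OF a] by (meson mult_left_mono order_trans zero_le)
      also have "\<dots> = ennreal (C0 * A)" using C0 A by (simp add: ennreal_mult)
      \<comment> \<open>The RBMO norm is an infimum that need not be known to be attained; the
        slack, available as A > 0, yields an admissible constant \<open>C1\<close>.\<close>
      also have "\<dots> < ennreal ((C0 + 1) * A)" using C0 Apos by (intro ennreal_lessI) auto
      finally obtain C1 where C1: "ennreal C1 < ennreal ((C0 + 1) * A)" "RBMO_bound \<mu> lam \<rho> (\<lambda>x. of_real (g x)) C1"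
        unfolding RBMO_norm_def by (auto simp: Inf_less_iff)
      from C1(2) have C1pos: "0 < C1" by (simp add: RBMO_bound_def)
      have C1le: "C1 \<le> (C0 + 1) * A" using C1(1) C1pos by (simp add: ennreal_less_iff)
      from C1(2) obtain mB :: "'a metric_ball \<Rightarrow> complex" where
        osc: "\<And>B. is_ball B \<Longrightarrow> (\<integral>\<^sup>+ y\<in>pts B. ennreal (cmod (of_real (g y) - mB B)) \<partial>\<mu>) \<le> ennreal C1 * emeasure \<mu> (pts (dilate \<rho> B))"
        and diff: "\<And>B S. is_ball B \<Longrightarrow> is_ball S \<Longrightarrow> pts B \<subseteq> pts S \<Longrightarrow> cmod (mB B - mB S) \<le> C1 * (1 + delta \<mu> lam B S)"
        unfolding RBMO_bound_def by blast
      obtain x s R where s: "0 < s" and R: "4 * r \<le> R"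
        and sub: "\<And>z. z \<in> ball x s \<Longrightarrow> 3 * r \<le> dist c z \<and> dist c z < 4 * R"
        and mm: "0 < measure \<mu> (ball x s)" and dbl: "measure \<mu> (ball x (\<rho> * s)) \<le> C * measure \<mu> (ball x s)"
        and w1: "wt_int c (annulus c r (8 * R)) \<le> ennreal C"
        and w0: "wt_int x {y. s \<le> dist x y \<and> dist c y < 8 * R} \<le> ennreal C"
        using comp[OF r out] unfolding companion_def by blast
      let ?S = "(c, 4 * R)" and ?D = "(c, 2 * r)" and ?Q = "(x, s)"
      have balls: "is_ball ?D" "is_ball ?Q" "is_ball ?S" using r s R by (auto simp: is_ball_def)
      have d1: "delta \<mu> lam ?D ?S \<le> C"
        using C w1 r by (intro delta_le[OF balls(1), where E="(annulus c r (8 * R))"]) (auto simp: pts_def dilate_def)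
      have d0: "delta \<mu> lam ?Q ?S \<le> C"
        using C w0 by (intro delta_le[OF balls(2), where E="{y. s \<le> dist x y \<and> dist c y < 8 * R}"]) (auto simp: pts_def dilate_def)
      have S0: "pts ?Q \<subseteq> pts ?S" using sub by (auto simp: pts_def)
      have S1: "pts ?D \<subseteq> pts ?S" using R r by (auto simp: pts_def)
      have e1: "cmod (mB ?D - mB ?S) \<le> C1 * (1 + C)"
        using diff[OF balls(1,3) S1] d1 C1pos by (meson add_left_mono less_imp_le mult_left_mono order_trans)
      have e0: "cmod (mB ?Q - mB ?S) \<le> C1 * (1 + C)"
        using diff[OF balls(2,3) S0] d0 C1pos by (meson add_left_mono less_imp_le mult_left_mono order_trans)
      have g0: "g y \<le> E * A" if y: "y \<in> ball x s" for y
      proof -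
        have d: "3 * r \<le> dist c y" using sub[OF y] by simp
        have lc: "0 < lam c r" using r by (rule lam_pos)
        have "marc a y \<le> ennreal (CK * Clam * growth 2 * wt c y) * (\<integral>\<^sup>+ z. ennreal (cmod (a z)) \<partial>\<mu>)"
          using d r by (intro marc_off_ball am supp) auto
        also have "\<dots> \<le> ennreal (E * (1 / lam c r)) * ennreal (A * lam c r)"
        proof (rule mult_mono[OF ennreal_leI])
          show "CK * Clam * growth 2 * wt c y \<le> E * (1 / lam c r)"
            unfolding E_def using d r CK_pos Clam_ge_1 by (intro mult_left_mono wt_le) auto
          have "(\<integral>\<^sup>+ z. ennreal (cmod (a z)) \<partial>\<mu>) \<le> ennreal A * emeasure \<mu> (ball c r)" by (rule bdd_supp_integral[OF a supp])
          also have "\<dots> \<le> ennreal A * ennreal (lam c r)" by (intro mult_left_mono emeasure_ball_le_lam r) simp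
          finally show "(\<integral>\<^sup>+ z. ennreal (cmod (a z)) \<partial>\<mu>) \<le> ennreal (A * lam c r)" using A lc by (simp add: ennreal_mult)
        qed auto
        also have "\<dots> = ennreal (E * A)" using E0 A lc by (subst ennreal_mult[symmetric]) auto
        finally show ?thesis unfolding g_def using E0 A by (intro enn2real_leI) auto
      qed
      define m where "m = measure \<mu> (ball x s)"
      have m: "0 < m" using mm by (simp add: m_def)
      \<comment> \<open>The oscillation over D is at most \<open>C1\<close> * \<mu>(\<rho>D), hence
        at most \<open>C1\<close> * C * \<mu>(D) by doubling; dividing by \<mu>(D) bounds the number
        itself.\<close>
      have mD0: "cmod (mB ?Q) \<le> C1 * C + E * A"
      proof -
        have "ennreal (cmod (mB ?Q) * m) = (\<integral>\<^sup>+ y. ennreal (cmod (mB ?Q)) * indicator (ball x s) y \<partial>\<mu>)"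
          by (subst nn_integral_cmult_indicator) (auto simp: sets_mu m_def measure_ball ennreal_mult)
        also have "\<dots> \<le> (\<integral>\<^sup>+ y. ennreal (cmod (of_real (g y) - mB ?Q)) * indicator (ball x s) y
             + ennreal (E * A) * indicator (ball x s) y \<partial>\<mu>)"
        proof (intro nn_integral_mono)
          fix y
          show "ennreal (cmod (mB ?Q)) * indicator (ball x s) y \<le> ennreal (cmod (of_real (g y) - mB ?Q)) * indicator (ball x s) y
             + ennreal (E * A) * indicator (ball x s) y"
          proof (cases "y \<in> ball x s")
            case True
            have "cmod (mB ?Q) \<le> cmod (of_real (g y) - mB ?Q) + cmod (of_real (g y))"
              using norm_triangle_sub[of "mB ?Q" "of_real (g y)"] by (simp add: norm_minus_commute)
            also have "cmod (of_real (g y)) \<le> E * A" using g0[OF True] by (simp add: g_def)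
            finally have "ennreal (cmod (mB ?Q)) \<le> ennreal (cmod (of_real (g y) - mB ?Q) + E * A)" by (simp add: ennreal_leI)
            then show ?thesis using True E0 A by simp
          qed simp
        qed
        also have "\<dots> = (\<integral>\<^sup>+ y. ennreal (cmod (of_real (g y) - mB ?Q)) * indicator (ball x s) y \<partial>\<mu>) + ennreal (E * A) * emeasure \<mu> (ball x s)"
          by (subst nn_integral_add, measurable) (simp add: nn_integral_cmult_indicator)
        also have "\<dots> \<le> ennreal C1 * ennreal (C * m) + ennreal (E * A) * ennreal m"
        proof (intro add_mono)
          have "(\<integral>\<^sup>+ y. ennreal (cmod (of_real (g y) - mB ?Q)) * indicator (ball x s) y \<partial>\<mu>) \<le> ennreal C1 * emeasure \<mu> (ball x (\<rho> * s))"
            using osc[OF balls(2)] by (simp add: pts_def dilate_def)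
          also have "\<dots> \<le> ennreal C1 * ennreal (C * m)"
            using dbl by (intro mult_left_mono) (auto simp: measure_ball m_def intro!: ennreal_leI)
          finally show "(\<integral>\<^sup>+ y. ennreal (cmod (of_real (g y) - mB ?Q)) * indicator (ball x s) y \<partial>\<mu>) \<le> ennreal C1 * ennreal (C * m)" .
        qed (simp add: measure_ball m_def)
        also have "\<dots> = ennreal ((C1 * C + E * A) * m)"
          using C1pos C E0 A m by (simp add: ennreal_mult[symmetric] ennreal_plus[symmetric] algebra_simps del: ennreal_plus)
        finally have "cmod (mB ?Q) * m \<le> (C1 * C + E * A) * m" using C1pos C E0 A m by simp
        then show ?thesis using m by simp
      qed
      have mD: "cmod (mB ?D) \<le> C1 * C + E * A + 2 * (C1 * (1 + C))"
      proof -
        have "mB ?D = (mB ?D - mB ?S) - (mB ?Q - mB ?S) + mB ?Q" by simp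
        then have "cmod (mB ?D) \<le> cmod (mB ?D - mB ?S) + cmod (mB ?Q - mB ?S) + cmod (mB ?Q)"
          by (metis norm_triangle_ineq norm_triangle_ineq4 add_right_mono order_trans)
        then show ?thesis using e0 e1 mD0 by linarith
      qed
      have mD': "cmod (mB ?D) \<le> ((C0 + 1) * C + E + 2 * ((C0 + 1) * (1 + C))) * A"
      proof -
        have "C1 * C \<le> (C0 + 1) * A * C" "C1 * (1 + C) \<le> (C0 + 1) * A * (1 + C)"
          using C1le C by (auto intro!: mult_right_mono)
        then show ?thesis using mD by (simp add: algebra_simps)
      qed
      let ?M = "measure \<mu> (ball c (2 * \<rho> * r))"
      have MD: "measure \<mu> (ball c (2 * r)) \<le> ?M" using r \<rho> by (intro measure_ball_mono subset_ball) auto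
      have "(\<integral>\<^sup>+ y. marc a y * indicator (ball c (2 * r)) y \<partial>\<mu>)
         \<le> (\<integral>\<^sup>+ y. ennreal (cmod (of_real (g y) - mB ?D)) * indicator (ball c (2 * r)) y + ennreal (cmod (mB ?D)) * indicator (ball c (2 * r)) y \<partial>\<mu>)"
      proof (rule nn_integral_mono_AE)
        show "AE y in \<mu>. marc a y * indicator (ball c (2 * r)) y
          \<le> ennreal (cmod (of_real (g y) - mB ?D)) * indicator (ball c (2 * r)) y + ennreal (cmod (mB ?D)) * indicator (ball c (2 * r)) y"
          using fin
        proof eventually_elim
          case (elim y)
          have "g y = cmod (of_real (g y))" by (simp add: g_def)
          also have "\<dots> \<le> cmod (of_real (g y) - mB ?D) + cmod (mB ?D)"
            using norm_triangle_sub[of "of_real (g y)" "mB ?D"] by simp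
          finally have "ennreal (g y) \<le> ennreal (cmod (of_real (g y) - mB ?D) + cmod (mB ?D))" by (rule ennreal_leI)
          then show ?case unfolding elim by (cases "y \<in> ball c (2 * r)") auto
        qed
      qed
      also have "\<dots> = (\<integral>\<^sup>+ y. ennreal (cmod (of_real (g y) - mB ?D)) * indicator (ball c (2 * r)) y \<partial>\<mu>)
          + ennreal (cmod (mB ?D)) * emeasure \<mu> (ball c (2 * r))"
        by (subst nn_integral_add, measurable) (simp add: nn_integral_cmult_indicator)
      also have "\<dots> \<le> ennreal ((C0 + 1) * A) * ennreal ?M
          + ennreal (((C0 + 1) * C + E + 2 * ((C0 + 1) * (1 + C))) * A) * ennreal ?M"
      proof (intro add_mono mult_mono)
        have "(\<integral>\<^sup>+ y. ennreal (cmod (of_real (g y) - mB ?D)) * indicator (ball c (2 * r)) y \<partial>\<mu>) \<le> ennreal C1 * emeasure \<mu> (ball c (\<rho> * (2 * r)))"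
          using osc[OF balls(1)] by (simp add: pts_def dilate_def)
        also have "\<dots> \<le> ennreal ((C0 + 1) * A) * ennreal ?M"
          using C1le by (intro mult_mono ennreal_leI) (auto simp: measure_ball mult_ac)
        finally show "(\<integral>\<^sup>+ y. ennreal (cmod (of_real (g y) - mB ?D)) * indicator (ball c (2 * r)) y \<partial>\<mu>) \<le> ennreal ((C0 + 1) * A) * ennreal ?M" .
      qed (use mD' MD in \<open>auto simp: measure_ball intro!: ennreal_leI\<close>)
      also have "\<dots> = ennreal (D * A) * emeasure \<mu> (ball c (2 * \<rho> * r))"
      proof -
        have e: "D * A = (C0 + 1) * A + ((C0 + 1) * C + E + 2 * ((C0 + 1) * (1 + C))) * A"
          by (simp add: D_def distrib_right)
        have nn: "0 \<le> (C0 + 1) * A" "0 \<le> ((C0 + 1) * C + E + 2 * ((C0 + 1) * (1 + C))) * A"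
          using C0 C E0 A by auto
        show ?thesis unfolding e ennreal_plus[OF nn] measure_ball by (simp add: distrib_right)
      qed
      finally show ?thesis .
    qed
  qed
qed

end

section \<open>Essential infima\<close>

lemma AE_ess_inf_le:
  assumes "S \<in> sets M"
  shows "AE x in M. x \<in> S \<longrightarrow> ess_inf M S g \<le> ereal (g x)"
proof -
  have "AE x in restrict_space M S. - ereal (g x) \<le> esssup (restrict_space M S) (\<lambda>x. - ereal (g x))"
    by (rule esssup_AE)
  then have "AE x in restrict_space M S. ess_inf M S g \<le> ereal (g x)"
    by (auto simp: ess_inf_def ereal_uminus_le_reorder elim!: eventually_mono)
  then show ?thesis using assms by (simp add: AE_restrict_space_iff sets.Int_space_eq2)
qed

lemma ess_inf_geI:
  assumes "S \<in> sets M" "g \<in> borel_measurable M" "AE x in M. x \<in> S \<longrightarrow> v \<le> g x"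
  shows "ereal v \<le> ess_inf M S g"
proof -
  have "AE x in restrict_space M S. - ereal (g x) \<le> - ereal v"
    using assms(1,3) by (simp add: AE_restrict_space_iff sets.Int_space_eq2)
  moreover have "(\<lambda>x. - ereal (g x)) \<in> borel_measurable (restrict_space M S)"
    using assms(2) by (intro measurable_restrict_space1) measurable
  ultimately have "esssup (restrict_space M S) (\<lambda>x. - ereal (g x)) \<le> - ereal v"
    by (intro esssup_I)
  then have "- (- ereal v) \<le> ess_inf M S g"
    unfolding ess_inf_def by (subst ereal_minus_le_minus)
  then show ?thesis by simp
qed

lemma ess_inf_le_average:
  assumes S: "S \<in> sets M" "0 < emeasure M S" "emeasure M S < \<infinity>"
    and v: "0 \<le> v" "(\<integral>\<^sup>+ x. ennreal (g x) * indicator S x \<partial>M) \<le> ennreal v * emeasure M S"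
  shows "ess_inf M S g \<le> ereal v"
proof (rule ccontr)
  assume "\<not> ?thesis"
  then obtain w where w: "ereal v < ereal w" "ereal w < ess_inf M S g"
    using ereal_dense2[of "ereal v" "ess_inf M S g"] by (auto simp: not_le)
  then have vw: "v < w" by simp
  have "ennreal w * emeasure M S = (\<integral>\<^sup>+ x. ennreal w * indicator S x \<partial>M)"
    using S by (simp add: nn_integral_cmult_indicator)
  also have "\<dots> \<le> (\<integral>\<^sup>+ x. ennreal (g x) * indicator S x \<partial>M)"
  proof (rule nn_integral_mono_AE)
    show "AE x in M. ennreal w * indicator S x \<le> ennreal (g x) * indicator S x"
      using AE_ess_inf_le[OF S(1), of g]
    proof eventually_elim
      case (elim x)
      show ?case
      proof (cases "x \<in> S")
        case True
        then have "ereal w < ereal (g x)" using elim less_le_trans[OF w(2)] by blast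
        then have "w \<le> g x" by simp
        then show ?thesis using True by (auto intro: ennreal_leI)
      qed simp
    qed
  qed
  also have "\<dots> \<le> ennreal v * emeasure M S" by (rule v(2))
  finally have le: "ennreal w * emeasure M S \<le> ennreal v * emeasure M S" .
  obtain m where m: "emeasure M S = ennreal m" "0 < m"
    using S(2,3) by (cases "emeasure M S") auto
  have "w * m \<le> v * m" using le m vw v(1) by (simp add: ennreal_mult[symmetric])
  then show False using m vw by simp
qed

context marcinkiewicz_space begin

section \<open>From local estimates to RBLO\<close>

lemma local_boundD:
  "local_bound \<kappa> C \<Longrightarrow> 0 < r \<Longrightarrow> bdd A a \<Longrightarrow> (\<And>y. y \<notin> ball c r \<Longrightarrow> a y = 0) \<Longrightarrow>
     (\<integral>\<^sup>+ x. marc a x * indicator (ball c (2 * r)) x \<partial>\<mu>) \<le> ennreal (C * A) * emeasure \<mu> (ball c (\<kappa> * r))"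
  unfolding local_bound_def by blast

text \<open>For x in \<open>ball c r\<close> and v outside \<open>ball c (\<theta> * r)\<close> one
  has r \<le> \<open>dist x v\<close> / (\<theta> - 1). This is the comparison constant between the
  weights at x and at c.\<close>

definition cwt :: "real \<Rightarrow> real" where "cwt \<theta> = Clam * growth (1 + 1 / (\<theta> - 1))"

lemma cwt_nonneg: "0 \<le> cwt \<theta>"
  using Clam_ge_1 by (simp add: cwt_def)

text \<open>The gap \<theta> > 1 keeps the annular part away from x, so its weight may be recentred
  at c, where it is controlled by w. The ball around z may be a concentric dilate or any larger
  ball, as the two RBLO conditions require.\<close>

lemma marc_compare:
  assumes f: "bdd A f" and \<theta>: "1 < \<theta>" and r: "0 < r"
    and x: "x \<in> ball c r" "x \<in> ball z R" and y: "y \<in> ball z R"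
    and w: "0 \<le> w" "wt_int c {v. r \<le> dist c v \<and> dist z v < 8 * R} \<le> ennreal w"
  shows "marc f x \<le> marc (restr (ball c (\<theta> * r)) (restr (ball z (8 * R)) f)) x
    + (marc f y + ennreal ((CK * cwt \<theta> * w + cfar) * A))"
proof -
  have A: "0 \<le> A" using f by (rule bdd_nonneg)
  let ?f1 = "restr (ball c (\<theta> * r)) (restr (ball z (8 * R)) f)"
  let ?S = "ball z (8 * R) - ball c (\<theta> * r)"
  let ?f2 = "restr ?S f" and ?f3 = "restr (- ball z (8 * R)) f"
  have b3: "bdd A ?f3" by (rule bdd_restr[OF _ f]) simp
  have b2: "bdd A ?f2" by (rule bdd_restr[OF _ f]) simp
  have b1: "bdd A ?f1" by (intro bdd_restr f) simp_all
  have "f = (\<lambda>v. ?f1 v + (?f2 v + ?f3 v))" by (auto simp: restr_def)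
  then have "marc f x = marc (\<lambda>v. ?f1 v + (?f2 v + ?f3 v)) x" by simp
  also have "\<dots> \<le> marc ?f1 x + marc (\<lambda>v. ?f2 v + ?f3 v) x" by (rule marc_triangle[OF b1 bdd_add[OF b2 b3]])
  also have "marc (\<lambda>v. ?f2 v + ?f3 v) x \<le> marc ?f2 x + marc ?f3 x" by (rule marc_triangle[OF b2 b3])
  also have "marc ?f3 x \<le> marc f y + ennreal (cfar * A)" by (rule marc_far[OF f x(2) y])
  also have "marc ?f2 x \<le> ennreal (CK * cwt \<theta> * w * A)"
  proof -
    have "marc ?f2 x \<le> ennreal (CK * A) * wt_int x ?S"
      by (rule marc_size_bdd[OF b2]) (auto simp: restr_def)
    also have "wt_int x ?S
        \<le> (\<integral>\<^sup>+ v. ennreal (cwt \<theta>) * (ennreal (wt c v) * indicator {v. r \<le> dist c v \<and> dist z v < 8 * R} v) \<partial>\<mu>)"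
    proof (intro nn_integral_mono)
      fix v
      show "ennreal (wt x v) * indicator ?S v
        \<le> ennreal (cwt \<theta>) * (ennreal (wt c v) * indicator {v. r \<le> dist c v \<and> dist z v < 8 * R} v)"
      proof (cases "v \<in> ?S")
        case True
        then have v: "\<theta> * r \<le> dist c v" "dist z v < 8 * R" by auto
        have rv: "r < \<theta> * r" using r \<theta> by simp
        have cx: "dist c x < r" using x by simp
        have "\<theta> * r - r \<le> dist x v" using v(1) cx dist_triangle[of c v x] by linarith
        then have d: "(\<theta> - 1) * r \<le> dist x v" by (simp add: left_diff_distrib)
        then have rd: "r \<le> dist x v / (\<theta> - 1)" using \<theta> by (simp add: field_simps)
        have pos: "0 < dist x v" using d r \<theta> by (meson diff_gt_0_iff_gt less_le_trans mult_pos_pos)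
        have M: "(1 + 1 / (\<theta> - 1)) * dist x v = dist x v + dist x v / (\<theta> - 1)" by (simp add: distrib_right)
        have "0 < dist c v" using v(1) rv r by linarith
        then have cv: "c \<noteq> v" by auto
        have "wt x v \<le> Clam * growth (1 + 1 / (\<theta> - 1)) * wt c v"
        proof (rule wt_compare[OF pos _ _ _ cv])
          show "1 \<le> 1 + 1 / (\<theta> - 1)" using \<theta> by simp
          show "dist c v \<le> (1 + 1 / (\<theta> - 1)) * dist x v"
            unfolding M using rd cx dist_triangle[of c v x] by linarith
          show "dist c x \<le> (1 + 1 / (\<theta> - 1)) * dist x v"
            unfolding M using rd cx zero_le_dist[of x v] by linarith
        qed
        then have "ennreal (wt x v) \<le> ennreal (cwt \<theta>) * ennreal (wt c v)"
          using cwt_nonneg by (subst ennreal_mult[symmetric]) (auto simp: cwt_def intro!: ennreal_leI)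
        moreover have "v \<in> {v. r \<le> dist c v \<and> dist z v < 8 * R}" using v rv by simp
        ultimately show ?thesis using True by simp
      qed simp
    qed
    also have "\<dots> = ennreal (cwt \<theta>) * wt_int c {v. r \<le> dist c v \<and> dist z v < 8 * R}"
      by (rule nn_integral_cmult) measurable
    also have "\<dots> \<le> ennreal (cwt \<theta>) * ennreal w" by (intro mult_left_mono w) simp
    finally have "marc ?f2 x \<le> ennreal (CK * A) * (ennreal (cwt \<theta>) * ennreal w)" by (simp add: mult_left_mono)
    also have "\<dots> = ennreal (CK * cwt \<theta> * w * A)"
      using CK_pos A cwt_nonneg w(1) by (simp add: ennreal_mult[symmetric] mult_ac)
    finally show ?thesis .
  qed
  finally have "marc f x \<le> marc ?f1 x + (ennreal (CK * cwt \<theta> * w * A) + (marc f y + ennreal (cfar * A)))"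
    by (simp add: add_left_mono add_mono)
  also have "ennreal (CK * cwt \<theta> * w * A) + (marc f y + ennreal (cfar * A))
      = marc f y + (ennreal (CK * cwt \<theta> * w * A) + ennreal (cfar * A))" by (simp add: ac_simps)
  also have "ennreal (CK * cwt \<theta> * w * A) + ennreal (cfar * A) = ennreal ((CK * cwt \<theta> * w + cfar) * A)"
    unfolding distrib_right using CK_pos A cwt_nonneg w(1) cfar_nonneg by (intro ennreal_plus[symmetric]) auto
  finally show ?thesis .
qed

text \<open>Finiteness at the single point \<open>x0\<close> spreads: in a ball around
  \<open>x0\<close> that contains \<open>ball c r\<close>, the far part of f is bounded by the value
  at \<open>x0\<close> plus a constant, and the near part is integrable by the local bound.\<close>

lemma marc_locally_integrable:
  assumes f: "bdd A f" and fin: "marc f x0 < \<infinity>" and loc: "local_bound 2 C"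
  shows "(\<integral>\<^sup>+ x. marc f x * indicator (ball c r) x \<partial>\<mu>) < \<infinity>"
proof -
  define R where "R = \<bar>r\<bar> + dist x0 c + 1"
  have R: "0 < R" by (simp add: R_def add_nonneg_pos)
  have sub: "ball c r \<subseteq> ball x0 R"
  proof
    fix y assume "y \<in> ball c r"
    then show "y \<in> ball x0 R" using dist_triangle[of x0 y c] by (simp add: R_def)
  qed
  let ?f1 = "restr (ball x0 (8 * R)) f" and ?f3 = "restr (- ball x0 (8 * R)) f"
  have b1: "bdd A ?f1" and b3: "bdd A ?f3" by (auto intro!: bdd_restr f)
  have "(\<integral>\<^sup>+ x. marc f x * indicator (ball c r) x \<partial>\<mu>)
     \<le> (\<integral>\<^sup>+ x. marc ?f1 x * indicator (ball x0 (2 * (8 * R))) x + (marc f x0 + ennreal (cfar * A)) * indicator (ball x0 R) x \<partial>\<mu>)"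
  proof (intro nn_integral_mono)
    fix x
    show "marc f x * indicator (ball c r) x
      \<le> marc ?f1 x * indicator (ball x0 (2 * (8 * R))) x + (marc f x0 + ennreal (cfar * A)) * indicator (ball x0 R) x"
    proof (cases "x \<in> ball c r")
      case True
      then have x: "x \<in> ball x0 R" using sub by blast
      have "f = (\<lambda>v. ?f1 v + ?f3 v)" by (auto simp: restr_def)
      then have "marc f x \<le> marc ?f1 x + marc ?f3 x" using marc_triangle[OF b1 b3, of x] by simp
      also have "marc ?f3 x \<le> marc f x0 + ennreal (cfar * A)" using x R by (intro marc_far[OF f]) auto
      finally show ?thesis using x True R by (simp add: add_left_mono)
    qed simp
  qed
  also have "\<dots> = (\<integral>\<^sup>+ x. marc ?f1 x * indicator (ball x0 (2 * (8 * R))) x \<partial>\<mu>) + (marc f x0 + ennreal (cfar * A)) * emeasure \<mu> (ball x0 R)"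
  proof -
    note [measurable] = marc_measurable[OF bdd_measurable[OF b1]]
    show ?thesis by (subst nn_integral_add, measurable) (simp add: nn_integral_cmult_indicator)
  qed
  also have "\<dots> < \<infinity>"
  proof -
    have "(\<integral>\<^sup>+ x. marc ?f1 x * indicator (ball x0 (2 * (8 * R))) x \<partial>\<mu>) \<le> ennreal (C * A) * emeasure \<mu> (ball x0 (2 * (8 * R)))"
      using R by (intro local_boundD[OF loc _ b1]) (auto simp: restr_def)
    also have "\<dots> < \<infinity>" by (simp add: ennreal_mult_less_top emeasure_ball_finite[simplified])
    finally show ?thesis
      using fin by (simp add: ennreal_mult_less_top emeasure_ball_finite[simplified])
  qed
  finally show ?thesis .
qed

lemma marc_AE_finite:
  assumes f: "bdd A f" and fin: "marc f x0 < \<infinity>" and loc: "local_bound 2 C"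
  shows "AE x in \<mu>. marc f x < \<infinity>"
proof -
  note [measurable] = marc_measurable[OF bdd_measurable[OF f]]
  have "AE x in \<mu>. marc f x * indicator (ball x0 (real n)) x \<noteq> \<infinity>" for n :: nat
    using marc_locally_integrable[OF f fin loc, of x0 "real n"]
    by (intro nn_integral_PInf_AE) auto
  then have "AE x in \<mu>. \<forall>n::nat. marc f x * indicator (ball x0 (real n)) x \<noteq> \<infinity>"
    by (simp only: AE_all_countable) simp
  then show ?thesis
  proof eventually_elim
    case (elim x)
    obtain n where "dist x0 x < real n" using reals_Archimedean2 by blast
    then show ?case using elim[rule_format, of n] by (auto simp: less_top)
  qed
qed

text \<open>For fixed x the comparison holds at almost every y of the larger ball, so it passes to
  the essential infimum there; the near part is then integrated over B by the local bound. In the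
  second condition B is doubling, which turns \<mu>(\<rho>B) into \<mu>(B) and bounds the infimum
  over B by an average.\<close>

lemma marc_in_RBLO:
  assumes \<eta>: "1 < \<eta>" and \<rho>: "1 < \<rho>"
    and C2: "local_bound 2 C2"
    and C\<eta>: "0 \<le> C\<eta>" "local_bound (sqrt \<eta>) C\<eta>"
    and C\<rho>: "0 \<le> C\<rho>" "local_bound (sqrt \<rho>) C\<rho>"
    and D: "D = (C\<eta> + CK * cwt (sqrt \<eta>) * (ctilde \<rho> + growth 8) + cfar)
      + (beta Clam N0 \<rho> * C\<rho> + CK * cwt (sqrt \<rho>) * (1 + growth 9) + cfar)"
    and f: "bdd A f" and fin: "marc f x0 < \<infinity>"
  shows "(\<lambda>x. enn2real (marc f x)) \<in> L1_loc \<mu>"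
    and "RBLO_bound \<mu> lam Clam N0 \<eta> \<rho> (\<lambda>x. enn2real (marc f x)) (D * A)"
proof -
  have A: "0 \<le> A" using f by (rule bdd_nonneg)
  define g where "g x = enn2real (marc f x)" for x
  note mm [measurable] = marc_measurable[OF bdd_measurable[OF f]]
  have gm [measurable]: "g \<in> borel_measurable \<mu>" unfolding g_def by measurable
  have g0: "0 \<le> g x" for x by (simp add: g_def)
  have AEg: "AE x in \<mu>. marc f x = ennreal (g x)"
    using marc_AE_finite[OF f fin C2] by (auto simp: g_def elim!: eventually_mono)
  have \<beta>: "0 \<le> beta Clam N0 \<rho>" using beta_gt[OF \<rho>] powr_gt_zero[of \<rho> "log 2 Clam"] \<rho> by linarith
  define D1 where "D1 = C\<eta> + CK * cwt (sqrt \<eta>) * (ctilde \<rho> + growth 8) + cfar"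
  define D2 where "D2 = beta Clam N0 \<rho> * C\<rho> + CK * cwt (sqrt \<rho>) * (1 + growth 9) + cfar"
  have D10: "0 \<le> D1" unfolding D1_def
    using C\<eta> CK_pos cwt_nonneg ctilde_nonneg[OF \<rho>] cfar_nonneg by (intro add_nonneg_nonneg mult_nonneg_nonneg) auto
  have D20: "0 \<le> D2" unfolding D2_def
    using C\<rho> CK_pos cwt_nonneg \<beta> cfar_nonneg by (intro add_nonneg_nonneg mult_nonneg_nonneg) auto
  have D12: "D = D1 + D2" by (simp add: D D1_def D2_def)
  show "(\<lambda>x. enn2real (marc f x)) \<in> L1_loc \<mu>"
    unfolding L1_loc_def g_def[symmetric]
  proof (intro CollectI allI impI)
    fix B :: "'a metric_ball"
    have "(\<integral>\<^sup>+ x. ennreal (norm (indicat_real (pts B) x *\<^sub>R g x)) \<partial>\<mu>) \<le> (\<integral>\<^sup>+ x. marc f x * indicator (pts B) x \<partial>\<mu>)"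
      using AEg by (intro nn_integral_mono_AE) (auto elim!: eventually_mono simp: g0 indicator_def)
    also have "\<dots> < \<infinity>" unfolding pts_def by (rule marc_locally_integrable[OF f fin C2])
    finally show "set_integrable \<mu> (pts B) g"
      unfolding set_integrable_def by (intro integrableI_bounded) (auto simp: pts_def)
  qed
  show "RBLO_bound \<mu> lam Clam N0 \<eta> \<rho> (\<lambda>x. enn2real (marc f x)) (D * A)"
    unfolding RBLO_bound_def g_def[symmetric]
  proof (intro conjI allI impI)
    show "0 \<le> D * A" using A D10 D20 D12 by simp
  next
    fix B :: "'a metric_ball" assume "is_ball B"
    then obtain c r where B: "B = (c, r)" and r: "0 < r" by (cases B) (auto simp: is_ball_def)
    obtain J where J: "1 \<le> J" "tilde_ball \<mu> Clam N0 \<rho> (c, r) = (c, \<rho> ^ J * r)"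
      and w: "wt_int c (annulus c r (\<rho> ^ J * r)) \<le> ennreal (ctilde \<rho>)"
      by (rule tilde_ball[OF r \<rho>, of c]) (rule that; assumption)
    define R where "R = \<rho> ^ J * r"
    have rR: "r \<le> R" unfolding R_def using r one_le_power[of \<rho> J] \<rho> by simp
    have R: "0 < R" using r rR by simp
    define W where "W = ctilde \<rho> + growth 8"
    have W: "wt_int c (annulus c r (8 * R)) \<le> ennreal W"
    proof -
      have "wt_int c (annulus c r (8 * R))
        \<le> (\<integral>\<^sup>+ v. ennreal (wt c v) * indicator (annulus c r R) v
              + ennreal (wt c v) * indicator (annulus c R (8 * R)) v \<partial>\<mu>)"
        by (intro nn_integral_mono) (auto simp: indicator_def)
      also have "\<dots> = wt_int c (annulus c r R)
              + wt_int c (annulus c R (8 * R))"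
        by (rule nn_integral_add) measurable
      also have "\<dots> \<le> ennreal (ctilde \<rho>) + ennreal (growth (8 * R / R))"
        using w[folded R_def] R by (intro add_mono annulus_wt) auto
      also have "\<dots> = ennreal W" using R ctilde_nonneg[OF \<rho>] by (simp add: W_def)
      finally show ?thesis .
    qed
    have W0: "0 \<le> W" using ctilde_nonneg[OF \<rho>] by (simp add: W_def)
    \<comment> \<open>One factor \<open>sqrt \<eta>\<close> separates B from the annular part, the
      other is the enlargement in the local bound; their product is the \<eta> of the
      condition.\<close>
    let ?\<theta> = "sqrt \<eta>"
    have \<theta>: "1 < ?\<theta>" using \<eta> by simp
    let ?f1 = "restr (ball c (?\<theta> * r)) (restr (ball c (8 * R)) f)"
    have b1: "bdd A ?f1" by (intro bdd_restr f) simp_all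
    note [measurable] = marc_measurable[OF bdd_measurable[OF b1]]
    define E where "E = (CK * cwt ?\<theta> * W + cfar) * A"
    have E0: "0 \<le> E" unfolding E_def using CK_pos cwt_nonneg W0 cfar_nonneg A by simp
    let ?m = "ess_inf \<mu> (ball c R) g"
    have ptw: "e2ennreal (ereal (g x) - ?m) \<le> marc ?f1 x + ennreal E" if x: "x \<in> ball c r" "marc f x = ennreal (g x)" for x
    proof (cases "marc ?f1 x")
      case (real v)
      have "AE y in \<mu>. y \<in> ball c R \<longrightarrow> g x - (v + E) \<le> g y"
        using AEg
      proof eventually_elim
        case (elim y)
        show ?case
        proof
          assume y: "y \<in> ball c R"
          have xR: "x \<in> ball c R" using x(1) rR by simp
          have "marc f x \<le> marc ?f1 x + (marc f y + ennreal E)"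
            unfolding E_def by (rule marc_compare[OF f \<theta> r x(1) xR y W0 W])
          then have "ennreal (g x) \<le> ennreal (v + (g y + E))"
            using real x(2) elim g0[of y] E0 by simp
          then have "g x \<le> v + (g y + E)" using real g0[of y] E0 by (subst (asm) ennreal_le_iff) auto
          then show "g x - (v + E) \<le> g y" by simp
        qed
      qed
      then have "ereal (g x - (v + E)) \<le> ?m" by (intro ess_inf_geI) auto
      then have "ereal (g x) - ?m \<le> ereal (v + E)" by (cases ?m) auto
      then have "e2ennreal (ereal (g x) - ?m) \<le> e2ennreal (ereal (v + E))" by (rule e2ennreal_mono)
      then show ?thesis using real E0 by (simp add: e2ennreal_ereal)
    qed simp
    have "(\<integral>\<^sup>+ y\<in>pts B. e2ennreal (ereal (g y) - ess_inf \<mu> (pts (tilde_ball \<mu> Clam N0 \<rho> B)) g) \<partial>\<mu>)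
       = (\<integral>\<^sup>+ y. e2ennreal (ereal (g y) - ?m) * indicator (ball c r) y \<partial>\<mu>)"
      by (simp add: B J(2) pts_def R_def)
    also have "\<dots> \<le> (\<integral>\<^sup>+ y. marc ?f1 y * indicator (ball c (2 * (?\<theta> * r))) y + ennreal E * indicator (ball c r) y \<partial>\<mu>)"
    proof (rule nn_integral_mono_AE)
      have sub: "ball c r \<subseteq> ball c (2 * (?\<theta> * r))"
      proof (rule subset_ball)
        have "1 * r \<le> (2 * ?\<theta>) * r" using \<theta> r by (intro mult_right_mono) linarith+
        then show "r \<le> 2 * (?\<theta> * r)" by simp
      qed
      show "AE y in \<mu>. e2ennreal (ereal (g y) - ?m) * indicator (ball c r) y
        \<le> marc ?f1 y * indicator (ball c (2 * (?\<theta> * r))) y + ennreal E * indicator (ball c r) y"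
        using AEg
      proof eventually_elim
        case (elim y)
        show ?case
        proof (cases "y \<in> ball c r")
          case True
          then show ?thesis using ptw[OF True elim] subsetD[OF sub True] by simp
        qed simp
      qed
    qed
    also have "\<dots> = (\<integral>\<^sup>+ y. marc ?f1 y * indicator (ball c (2 * (?\<theta> * r))) y \<partial>\<mu>) + ennreal E * emeasure \<mu> (ball c r)"
      by (subst nn_integral_add, measurable) (simp add: nn_integral_cmult_indicator)
    also have "\<dots> \<le> ennreal (C\<eta> * A) * emeasure \<mu> (ball c (\<eta> * r)) + ennreal E * emeasure \<mu> (ball c (\<eta> * r))"
    proof (intro add_mono mult_left_mono)
      have "(\<integral>\<^sup>+ y. marc ?f1 y * indicator (ball c (2 * (?\<theta> * r))) y \<partial>\<mu>) \<le> ennreal (C\<eta> * A) * emeasure \<mu> (ball c (?\<theta> * (?\<theta> * r)))"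
        using r \<theta> by (intro local_boundD[OF C\<eta>(2) _ b1]) (auto simp: restr_def)
      also have "?\<theta> * (?\<theta> * r) = \<eta> * r" using \<eta> by (simp add: mult.assoc[symmetric])
      finally show "(\<integral>\<^sup>+ y. marc ?f1 y * indicator (ball c (2 * (?\<theta> * r))) y \<partial>\<mu>) \<le> ennreal (C\<eta> * A) * emeasure \<mu> (ball c (\<eta> * r))" .
      show "emeasure \<mu> (ball c r) \<le> emeasure \<mu> (ball c (\<eta> * r))"
        using \<eta> r by (intro emeasure_mono subset_ball) auto
    qed simp
    also have "\<dots> = ennreal (C\<eta> * A + E) * emeasure \<mu> (ball c (\<eta> * r))"
      using C\<eta>(1) A E0 by (simp add: distrib_right)
    also have "C\<eta> * A + E = D1 * A" by (simp add: E_def D1_def W_def distrib_right)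
    also have "ennreal (D1 * A) * emeasure \<mu> (ball c (\<eta> * r)) \<le> ennreal (D * A) * emeasure \<mu> (ball c (\<eta> * r))"
      using D12 D20 A by (intro mult_right_mono ennreal_leI) auto
    finally show "(\<integral>\<^sup>+ y\<in>pts B. e2ennreal (ereal (g y) - ess_inf \<mu> (pts (tilde_ball \<mu> Clam N0 \<rho> B)) g) \<partial>\<mu>)
       \<le> ennreal (D * A) * emeasure \<mu> (pts (dilate \<eta> B))"
      by (simp add: B pts_def dilate_def)
  next
    fix B S :: "'a metric_ball"
    assume *: "is_ball B \<and> is_ball S \<and> pts B \<subseteq> pts S \<and> 0 < emeasure \<mu> (pts B) \<and>
        doubling_ball \<mu> \<rho> (beta Clam N0 \<rho>) B \<and> doubling_ball \<mu> \<rho> (beta Clam N0 \<rho>) S"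
    then obtain c r z R where B: "B = (c, r)" and S: "S = (z, R)" and r: "0 < r" and R: "0 < R"
      by (cases B; cases S) (auto simp: is_ball_def)
    have sub: "ball c r \<subseteq> ball z R" using * by (simp add: B S pts_def)
    have posB: "0 < emeasure \<mu> (ball c r)" using * by (simp add: B pts_def)
    have dbl: "emeasure \<mu> (ball c (\<rho> * r)) \<le> ennreal (beta Clam N0 \<rho>) * emeasure \<mu> (ball c r)"
      using * by (simp add: B doubling_ball_def pts_def dilate_def)
    have cS: "dist z c < R" using subsetD[OF sub, of c] r by simp
    define \<delta> where "\<delta> = delta \<mu> lam B S"
    have \<delta>: "0 \<le> \<delta>" "ennreal \<delta> = wt_int c (ball z (2 * R) - ball c r)"
      using delta_eq[of B S] * by (auto simp: \<delta>_def B S pts_def dilate_def)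
    define W where "W = \<delta> + growth 9"
    have W0: "0 \<le> W" using \<delta> by (simp add: W_def)
    \<comment> \<open>Inside 2S the weight is the coefficient \<delta>(B, S). Outside 2S the
      distance to c is between R and 9 * R, since c is within R of z.\<close>
    have W: "wt_int c {v. r \<le> dist c v \<and> dist z v < 8 * R} \<le> ennreal W"
    proof -
      have "wt_int c {v. r \<le> dist c v \<and> dist z v < 8 * R}
        \<le> (\<integral>\<^sup>+ v. ennreal (wt c v) * indicator (ball z (2 * R) - ball c r) v
              + ennreal (wt c v) * indicator (annulus c R (9 * R)) v \<partial>\<mu>)"
      proof (intro nn_integral_mono)
        fix v
        show "ennreal (wt c v) * indicator {v. r \<le> dist c v \<and> dist z v < 8 * R} v
          \<le> ennreal (wt c v) * indicator (ball z (2 * R) - ball c r) v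
              + ennreal (wt c v) * indicator (annulus c R (9 * R)) v"
          using cS dist_triangle[of z v c] dist_triangle[of c v z]
          by (cases "dist z v < 2 * R") (auto simp: indicator_def dist_commute)
      qed
      also have "\<dots> = wt_int c (ball z (2 * R) - ball c r)
              + wt_int c (annulus c R (9 * R))"
        by (rule nn_integral_add) measurable
      also have "\<dots> \<le> ennreal \<delta> + ennreal (growth (9 * R / R))"
        using R \<delta> by (intro add_mono annulus_wt) auto
      also have "\<dots> = ennreal W" using R \<delta> by (simp add: W_def)
      finally show ?thesis .
    qed
    let ?\<theta> = "sqrt \<rho>"
    have \<theta>: "1 < ?\<theta>" using \<rho> by simp
    let ?f1 = "restr (ball c (?\<theta> * r)) (restr (ball z (8 * R)) f)"
    have b1: "bdd A ?f1" by (intro bdd_restr f) simp_all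
    note [measurable] = marc_measurable[OF bdd_measurable[OF b1]]
    define E where "E = (CK * cwt ?\<theta> * W + cfar) * A"
    have E0: "0 \<le> E" unfolding E_def using CK_pos cwt_nonneg W0 cfar_nonneg A by simp
    define T where "T = beta Clam N0 \<rho> * C\<rho> * A + E"
    have T0: "0 \<le> T" unfolding T_def using \<beta> C\<rho> A E0 by simp
    have int1: "(\<integral>\<^sup>+ y. marc ?f1 y * indicator (ball c r) y \<partial>\<mu>) \<le> ennreal (beta Clam N0 \<rho> * C\<rho> * A) * emeasure \<mu> (ball c r)"
    proof -
      have "1 * r \<le> (2 * ?\<theta>) * r" using \<theta> r by (intro mult_right_mono) linarith+
      then have "ball c r \<subseteq> ball c (2 * (?\<theta> * r))" by (intro subset_ball) simp
      then have "(\<integral>\<^sup>+ y. marc ?f1 y * indicator (ball c r) y \<partial>\<mu>) \<le> (\<integral>\<^sup>+ y. marc ?f1 y * indicator (ball c (2 * (?\<theta> * r))) y \<partial>\<mu>)"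
        by (intro nn_integral_mono mult_left_mono) (auto simp: indicator_def)
      also have "\<dots> \<le> ennreal (C\<rho> * A) * emeasure \<mu> (ball c (?\<theta> * (?\<theta> * r)))"
        using r \<theta> by (intro local_boundD[OF C\<rho>(2) _ b1]) (auto simp: restr_def)
      also have "?\<theta> * (?\<theta> * r) = \<rho> * r" using \<rho> by (simp add: mult.assoc[symmetric])
      also have "ennreal (C\<rho> * A) * emeasure \<mu> (ball c (\<rho> * r)) \<le> ennreal (C\<rho> * A) * (ennreal (beta Clam N0 \<rho>) * emeasure \<mu> (ball c r))"
        by (intro mult_left_mono dbl) simp
      also have "\<dots> = ennreal (beta Clam N0 \<rho> * C\<rho> * A) * emeasure \<mu> (ball c r)"
        using C\<rho> A \<beta> by (simp add: ennreal_mult mult_ac)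
      finally show ?thesis .
    qed
    have key: "ess_inf \<mu> (ball c r) g \<le> ereal (g y + T)" if y: "y \<in> ball z R" "marc f y = ennreal (g y)" for y
    proof (rule ess_inf_le_average)
      show "ball c r \<in> sets \<mu>" "0 < emeasure \<mu> (ball c r)" "emeasure \<mu> (ball c r) < \<infinity>" "0 \<le> g y + T"
        using posB g0[of y] T0 emeasure_ball_finite by auto
      have "(\<integral>\<^sup>+ x. ennreal (g x) * indicator (ball c r) x \<partial>\<mu>)
         \<le> (\<integral>\<^sup>+ x. marc ?f1 x * indicator (ball c r) x + ennreal (g y + E) * indicator (ball c r) x \<partial>\<mu>)"
      proof (rule nn_integral_mono_AE)
        show "AE x in \<mu>. ennreal (g x) * indicator (ball c r) x \<le> marc ?f1 x * indicator (ball c r) x + ennreal (g y + E) * indicator (ball c r) x"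
          using AEg
        proof eventually_elim
          case (elim x)
          show ?case
          proof (cases "x \<in> ball c r")
            case True
            have "marc f x \<le> marc ?f1 x + (marc f y + ennreal E)"
              unfolding E_def by (rule marc_compare[OF f \<theta> r True subsetD[OF sub True] y(1) W0 W])
            then show ?thesis using True elim y(2) g0[of y] E0 by simp
          qed simp
        qed
      qed
      also have "\<dots> = (\<integral>\<^sup>+ x. marc ?f1 x * indicator (ball c r) x \<partial>\<mu>) + ennreal (g y + E) * emeasure \<mu> (ball c r)"
        by (subst nn_integral_add, measurable) (simp add: nn_integral_cmult_indicator)
      also have "\<dots> \<le> ennreal (beta Clam N0 \<rho> * C\<rho> * A) * emeasure \<mu> (ball c r) + ennreal (g y + E) * emeasure \<mu> (ball c r)"
        by (intro add_right_mono int1)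
      also have "\<dots> = ennreal (g y + T) * emeasure \<mu> (ball c r)"
      proof -
        have e: "g y + T = beta Clam N0 \<rho> * C\<rho> * A + (g y + E)" by (simp add: T_def)
        have nn: "0 \<le> beta Clam N0 \<rho> * C\<rho> * A" "0 \<le> g y + E" using \<beta> C\<rho> A g0[of y] E0 by auto
        show ?thesis unfolding e ennreal_plus[OF nn] by (simp add: distrib_right)
      qed
      finally show "(\<integral>\<^sup>+ x. ennreal (g x) * indicator (ball c r) x \<partial>\<mu>) \<le> ennreal (g y + T) * emeasure \<mu> (ball c r)" .
    qed
    \<comment> \<open>One such point makes the essential infimum over B finite, so that the
      subtraction of infima below is meaningful.\<close>
    have "\<exists>y\<in>ball z R. marc f y = ennreal (g y)"
    proof (rule ccontr)
      assume neg: "\<not> ?thesis"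
      have "AE y in \<mu>. y \<notin> ball z R" using AEg by eventually_elim (use neg in blast)
      then have "ball z R \<in> null_sets \<mu>" by (simp only: AE_iff_null_sets[OF ball_sets])
      then have "emeasure \<mu> (ball z R) = 0" by (rule null_setsD1)
      moreover have "emeasure \<mu> (ball c r) \<le> emeasure \<mu> (ball z R)" by (intro emeasure_mono sub) simp
      ultimately show False using posB by simp
    qed
    then obtain y0 where "ess_inf \<mu> (ball c r) g \<le> ereal (g y0 + T)" using key by blast
    moreover have "ereal 0 \<le> ess_inf \<mu> (ball c r) g" by (rule ess_inf_geI) (auto simp: g0)
    ultimately obtain mB where mB: "ess_inf \<mu> (ball c r) g = ereal mB" by (cases "ess_inf \<mu> (ball c r) g") auto
    have "AE y in \<mu>. y \<in> ball z R \<longrightarrow> mB - T \<le> g y"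
      using AEg
    proof eventually_elim
      case (elim y)
      then show ?case using key[of y] by (auto simp: mB)
    qed
    then have "ereal (mB - T) \<le> ess_inf \<mu> (ball z R) g" by (intro ess_inf_geI) auto
    then have "ess_inf \<mu> (ball c r) g - ess_inf \<mu> (ball z R) g \<le> ereal T"
      unfolding mB by (cases "ess_inf \<mu> (ball z R) g") auto
    also have "T \<le> D * A * (1 + \<delta>)"
    proof -
      have "beta Clam N0 \<rho> * C\<rho> + (CK * cwt ?\<theta> * W + cfar) \<le> D2 * (1 + \<delta>)"
      proof -
        have "W \<le> (1 + growth 9) * (1 + \<delta>)" using \<delta>(1) by (simp add: W_def algebra_simps)
        then have "CK * cwt ?\<theta> * W \<le> CK * cwt ?\<theta> * ((1 + growth 9) * (1 + \<delta>))"
          using CK_pos cwt_nonneg by (intro mult_left_mono) auto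
        moreover have "beta Clam N0 \<rho> * C\<rho> * 1 \<le> beta Clam N0 \<rho> * C\<rho> * (1 + \<delta>)" "cfar * 1 \<le> cfar * (1 + \<delta>)"
          using \<delta>(1) \<beta> C\<rho> cfar_nonneg by (intro mult_left_mono; simp)+
        ultimately show ?thesis by (simp add: D2_def distrib_right mult.assoc)
      qed
      also have "\<dots> \<le> D * (1 + \<delta>)" using D12 D10 \<delta>(1) by (intro mult_right_mono) auto
      finally have "(beta Clam N0 \<rho> * C\<rho> + (CK * cwt ?\<theta> * W + cfar)) * A \<le> D * (1 + \<delta>) * A"
        using A by (intro mult_right_mono) auto
      then show ?thesis by (simp add: T_def E_def algebra_simps)
    qed
    finally show "ess_inf \<mu> (pts B) g - ess_inf \<mu> (pts S) g \<le> ereal (D * A * (1 + delta \<mu> lam B S))"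
      by (simp add: B S pts_def \<delta>_def)
  qed
qed



section \<open>From local estimates to boundedness on atomic blocks\<close>

text \<open>The constant 1 is bounded but need not have bounded support, so it is cut off in space
  and time. For x in \<open>ball x0 k\<close> and t \<le> k the inner integral sees a bounded ball
  only; the local bound there is at most C times the total mass, and monotone convergence removes
  the cut-off.\<close>

lemma marc_one:
  assumes fin: "emeasure \<mu> UNIV < \<infinity>" and C: "0 \<le> C" and loc: "local_bound \<kappa> C"
  shows "(\<integral>\<^sup>+ x. marc (\<lambda>_. 1) x \<partial>\<mu>) \<le> ennreal C * emeasure \<mu> UNIV"
proof -
  define x0 :: 'a where "x0 = undefined"
  let ?one = "\<lambda>_::'a. 1 :: complex"
  have b1: "bdd 1 ?one" by (simp add: bdd_def)
  define q where "q x t = ennreal (cmod (inner_int x ?one t))" for x t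
  define w :: "real \<Rightarrow> ennreal" where "w t = ennreal (1 / t ^ 3) * indicator {0<..} t" for t
  define G where "G k x = tnorm (\<lambda>t. q x t * indicator {..real k} t)" for k x
  define H where "H k x = G k x * indicator (ball x0 (real k)) x" for k x
  have [measurable]: "w \<in> borel_measurable borel" unfolding w_def by measurable
  have qt [measurable]: "q x \<in> borel_measurable borel" for x
    unfolding q_def using inner_int_measurable_t[OF bdd_measurable[OF b1], of x] by measurable
  have qm: "(\<lambda>p. q (fst p) (snd p)) \<in> borel_measurable (\<mu> \<Otimes>\<^sub>M lborel)"
  proof -
    have "(\<lambda>p. inner_int (fst p) ?one (snd p)) \<in> borel_measurable (\<mu> \<Otimes>\<^sub>M lborel)"
      using inner_int_measurable[OF bdd_measurable[OF b1]] by (simp cong: measurable_cong_sets)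
    then show ?thesis unfolding q_def by measurable
  qed
  have Gm [measurable]: "G k \<in> borel_measurable \<mu>" for k
  proof -
    note [measurable] = qm
    have ep: "(\<lambda>a. epowr a (1 / 2)) \<in> borel_measurable borel" unfolding epowr_def by measurable
    have "(\<lambda>x. \<integral>\<^sup>+ t. (q x t * indicator {..real k} t) ^ 2 * tw t \<partial>lborel)
      \<in> borel_measurable \<mu>"
      by (rule lborel.borel_measurable_nn_integral) measurable
    then show ?thesis unfolding G_def[abs_def] tnorm_def by (rule measurable_compose[OF _ ep])
  qed
  have G_mono: "G k x \<le> G k' x" if "k \<le> k'" for k k' x
    unfolding G_def using that by (intro tnorm_mono) (auto simp: indicator_def)
  have marc_le: "marc ?one x \<le> (SUP k. H k x)" for x
  proof -
    have inc: "incseq (\<lambda>k t. (q x t * indicator {..real k} t)\<^sup>2 * w t)"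
      by (auto simp: incseq_def le_fun_def indicator_def)
    have "(marc ?one x)\<^sup>2 = (\<integral>\<^sup>+ t. (q x t)\<^sup>2 * w t \<partial>lborel)"
      by (simp add: marc_eq_tnorm tnorm_square q_def w_def)
    also have "\<dots> = (\<integral>\<^sup>+ t. (SUP k. (q x t * indicator {..real k} t)\<^sup>2 * w t) \<partial>lborel)"
    proof (intro nn_integral_cong antisym)
      fix t
      obtain k where "t < real k" using reals_Archimedean2 by blast
      then show "(q x t)\<^sup>2 * w t \<le> (SUP k. (q x t * indicator {..real k} t)\<^sup>2 * w t)"
        by (intro SUP_upper2[of k]) (auto simp: indicator_def)
      show "(SUP k. (q x t * indicator {..real k} t)\<^sup>2 * w t) \<le> (q x t)\<^sup>2 * w t"
        by (intro SUP_least) (auto simp: indicator_def)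
    qed
    also have "\<dots> = (SUP k. (\<integral>\<^sup>+ t. (q x t * indicator {..real k} t)\<^sup>2 * w t \<partial>lborel))"
      by (rule nn_integral_monotone_convergence_SUP[OF inc]) measurable
    also have "\<dots> = (SUP k. (G k x)\<^sup>2)"
      by (simp add: G_def tnorm_square w_def)
    also have "\<dots> \<le> (SUP k. G k x)\<^sup>2"
      by (intro SUP_least power_mono SUP_upper) auto
    finally have "marc ?one x \<le> (SUP k. G k x)" by (rule ennreal_square_le)
    also have "\<dots> \<le> (SUP k. H k x)"
    proof (rule SUP_least)
      fix k
      obtain n where n: "dist x0 x < real n" using reals_Archimedean2 by blast
      have "G k x \<le> G (k + n) x" by (rule G_mono) simp
      also have "\<dots> = H (k + n) x" using n by (simp add: H_def)
      also have "\<dots> \<le> (SUP k. H k x)" by (rule SUP_upper) simp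
      finally show "G k x \<le> (SUP k. H k x)" .
    qed
    finally show ?thesis .
  qed
  have H_inc: "incseq H"
    unfolding incseq_def le_fun_def
  proof (intro allI impI)
    fix k k' x assume "k \<le> (k'::nat)"
    then show "H k x \<le> H k' x"
      unfolding H_def using G_mono[of k k' x] by (intro mult_mono) (auto simp: indicator_def)
  qed
  have H_int: "(\<integral>\<^sup>+ x. H k x \<partial>\<mu>) \<le> ennreal C * emeasure \<mu> UNIV" for k
  proof -
    \<comment> \<open>The radius 2k contains all points seen at times up to k; adding 1 keeps it
      positive for k = 0.\<close>
    let ?r = "2 * real k + 1"
    let ?f = "restr (ball x0 ?r) ?one"
    have bf: "bdd 1 ?f" by (rule bdd_restr[OF _ b1]) simp
    have "H k x \<le> marc ?f x * indicator (ball x0 (2 * ?r)) x" for x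
    proof (cases "x \<in> ball x0 (real k)")
      case True
      have "G k x \<le> marc ?f x"
        unfolding G_def marc_eq_tnorm
      proof (rule tnorm_mono)
        fix t
        show "q x t * indicator {..real k} t \<le> ennreal (cmod (inner_int x ?f t))"
        proof (cases "t \<le> real k")
          case t: True
          have "ball x t \<subseteq> ball x0 ?r"
          proof
            fix y assume "y \<in> ball x t"
            then show "y \<in> ball x0 ?r" using True t dist_triangle[of x0 y x] by simp
          qed
          then have "inner_int x ?f t = inner_int x ?one t"
            unfolding inner_int_def by (intro Bochner_Integration.integral_cong) (auto simp: restr_def indicator_def)
          then show ?thesis by (simp add: q_def indicator_def)
        qed simp
      qed
      then show ?thesis using True by (simp add: H_def)
    qed (simp add: H_def)
    then have "(\<integral>\<^sup>+ x. H k x \<partial>\<mu>) \<le> (\<integral>\<^sup>+ x. marc ?f x * indicator (ball x0 (2 * ?r)) x \<partial>\<mu>)"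
      by (intro nn_integral_mono)
    also have "\<dots> \<le> ennreal (C * 1) * emeasure \<mu> (ball x0 (\<kappa> * ?r))"
      by (rule local_boundD[OF loc _ bf]) (auto simp: restr_def)
    also have "\<dots> \<le> ennreal C * emeasure \<mu> UNIV"
      using sets.top[of \<mu>] by (intro mult_mono emeasure_mono) auto
    finally show ?thesis .
  qed
  have "(\<integral>\<^sup>+ x. marc ?one x \<partial>\<mu>) \<le> (\<integral>\<^sup>+ x. (SUP k. H k x) \<partial>\<mu>)"
    by (intro nn_integral_mono marc_le)
  also have "\<dots> = (SUP k. (\<integral>\<^sup>+ x. H k x \<partial>\<mu>))"
    by (rule nn_integral_monotone_convergence_SUP[OF H_inc]) (simp add: H_def[abs_def])
  also have "\<dots> \<le> ennreal C * emeasure \<mu> UNIV" by (intro SUP_least H_int)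
  finally show ?thesis .
qed

text \<open>The normalisation says that A * m * (1 + \<delta>) is at most 1. The part A * m pays for
  twice the ball of the atom, and A * m * \<delta> for the rest of 2B, where integrating the size
  bound produces exactly the coefficient \<delta>.\<close>

lemma atom_marc_bound:
  assumes C: "0 \<le> C" "local_bound \<rho> C" and \<rho>: "1 < \<rho>"
    and balls: "is_ball Q" "is_ball B"
    and am: "a \<in> borel_measurable \<mu>" and supp: "\<And>x. x \<notin> pts Q \<Longrightarrow> a x = 0"
    and norm: "Lp_norm \<mu> \<infinity> a \<le> ennreal (measure \<mu> (pts (dilate \<rho> Q)) powr (real_of_ereal (1 / \<infinity>) - 1)
                         * inverse (1 + delta \<mu> lam Q B))"
  obtains A where "bdd A a" "(\<integral>\<^sup>+ x. ennreal (cmod (a x)) \<partial>\<mu>) \<le> 1"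
    "(\<integral>\<^sup>+ x. marc a x * indicator (pts (dilate 2 B)) x \<partial>\<mu>) \<le> ennreal (C + CK * Clam * growth 2)"
proof -
  obtain c r where Q: "Q = (c, r)" and r: "0 < r" using balls by (cases Q) (auto simp: is_ball_def)
  define m where "m = measure \<mu> (ball c (\<rho> * r))"
  define \<delta> where "\<delta> = delta \<mu> lam Q B"
  have \<delta>: "0 \<le> \<delta>" "ennreal \<delta> = wt_int c (pts (dilate 2 B) - ball c r)"
    using delta_eq[OF balls(1), of B] by (auto simp: \<delta>_def Q pts_def)
  \<comment> \<open>For m = 0 the convention \<open>0 powr (-1) = 0\<close> gives A = 0, so the norm
    hypothesis makes the atom vanish almost everywhere.\<close>
  define A where "A = m powr (-1) * inverse (1 + \<delta>)"
  have A: "0 \<le> A" using \<delta> by (simp add: A_def)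
  have Lp: "esssup \<mu> (\<lambda>x. ennreal (cmod (a x))) \<le> ennreal A"
    using norm by (simp add: A_def Lp_norm_def Q pts_def dilate_def m_def \<delta>_def)
  have "AE x in \<mu>. ennreal (cmod (a x)) \<le> ennreal A"
    using esssup_AE[of "\<lambda>x. ennreal (cmod (a x))" \<mu>] by (auto elim!: eventually_mono intro: order_trans[OF _ Lp])
  then have bA: "bdd A a" using am A by (simp add: bdd_def)
  have supp': "a y = 0" if "y \<notin> ball c r" for y using supp[of y] that by (simp add: Q pts_def)
  have Am: "A * m * (1 + \<delta>) \<le> 1"
  proof (cases "m = 0")
    case False
    then have "0 < m" using measure_nonneg[of \<mu> "ball c (\<rho> * r)"] unfolding m_def by linarith
    then have z: "m * (1 + \<delta>) \<noteq> 0" and "A = inverse (m * (1 + \<delta>))"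
      using \<delta>(1) by (simp_all add: A_def powr_minus)
    then have "A * (m * (1 + \<delta>)) = 1" by (simp only: left_inverse[OF z])
    then show ?thesis by (simp only: mult.assoc order_refl)
  qed simp
  have m0: "0 \<le> m" by (simp add: m_def)
  have Am1: "A * m \<le> 1"
  proof -
    have "A * m * 1 \<le> A * m * (1 + \<delta>)" using \<delta> A m0 by (intro mult_left_mono) auto
    then show ?thesis using Am by simp
  qed
  have Am\<delta>: "A * m * \<delta> \<le> 1"
  proof -
    have "A * m * \<delta> \<le> A * m * (1 + \<delta>)" using \<delta> A m0 by (intro mult_left_mono) auto
    then show ?thesis using Am by simp
  qed
  have L1: "(\<integral>\<^sup>+ x. ennreal (cmod (a x)) \<partial>\<mu>) \<le> ennreal (A * m)"
  proof -
    have "(\<integral>\<^sup>+ x. ennreal (cmod (a x)) \<partial>\<mu>) \<le> ennreal A * emeasure \<mu> (ball c r)"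
      by (rule bdd_supp_integral[OF bA supp'])
    also have "\<dots> \<le> ennreal A * ennreal m"
      unfolding measure_ball m_def using \<rho> r by (intro mult_left_mono ennreal_leI measure_ball_mono subset_ball) auto
    finally show ?thesis using A m0 by (simp add: ennreal_mult)
  qed
  let ?E = "CK * Clam * growth 2"
  have E: "0 \<le> ?E" using CK_pos Clam_ge_1 by simp
  note [measurable] = marc_measurable[OF am]
  have Bm [measurable]: "pts (dilate 2 B) \<in> sets \<mu>" by (simp add: pts_def)
  have "(\<integral>\<^sup>+ x. marc a x * indicator (pts (dilate 2 B)) x \<partial>\<mu>)
     \<le> (\<integral>\<^sup>+ x. marc a x * indicator (ball c (2 * r)) x
        + ennreal (?E * (A * m)) * (ennreal (wt c x) * indicator (pts (dilate 2 B) - ball c r) x) \<partial>\<mu>)"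
  proof (intro nn_integral_mono)
    fix x
    show "marc a x * indicator (pts (dilate 2 B)) x \<le> marc a x * indicator (ball c (2 * r)) x
        + ennreal (?E * (A * m)) * (ennreal (wt c x) * indicator (pts (dilate 2 B) - ball c r) x)"
    proof (cases "x \<in> pts (dilate 2 B) \<and> x \<notin> ball c (2 * r)")
      case True
      then have d: "2 * r \<le> dist c x" by simp
      then have nb: "x \<notin> ball c r" using r by simp
      have "marc a x \<le> ennreal (?E * wt c x) * (\<integral>\<^sup>+ z. ennreal (cmod (a z)) \<partial>\<mu>)"
        by (rule marc_off_ball[OF am supp' r d])
      also have "\<dots> \<le> ennreal (?E * wt c x) * ennreal (A * m)" by (intro mult_left_mono L1) simp
      also have "\<dots> = ennreal (?E * (A * m)) * ennreal (wt c x)"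
      proof -
        have "ennreal (?E * wt c x) * ennreal (A * m) = ennreal (?E * wt c x * (A * m))"
          using E A m0 by (intro ennreal_mult[symmetric] mult_nonneg_nonneg[OF E wt_nonneg]) simp
        also have "?E * wt c x * (A * m) = ?E * (A * m) * wt c x" by (simp only: mult_ac)
        also have "ennreal \<dots> = ennreal (?E * (A * m)) * ennreal (wt c x)"
          using A m0 by (intro ennreal_mult mult_nonneg_nonneg[OF E] wt_nonneg) simp
        finally show ?thesis .
      qed
      finally show ?thesis using True nb by simp
    qed (auto simp: indicator_def)
  qed
  also have "\<dots> = (\<integral>\<^sup>+ x. marc a x * indicator (ball c (2 * r)) x \<partial>\<mu>)
      + ennreal (?E * (A * m)) * wt_int c (pts (dilate 2 B) - ball c r)"
    by (subst nn_integral_add, measurable) (subst nn_integral_cmult, measurable)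
  also have "\<dots> \<le> ennreal (C * A) * ennreal m + ennreal (?E * (A * m)) * ennreal \<delta>"
    using local_boundD[OF C(2) r bA supp'] unfolding \<delta>(2) m_def measure_ball[symmetric]
    by (intro add_right_mono)
  also have "\<dots> = ennreal (C * (A * m) + ?E * (A * m * \<delta>))"
  proof -
    have nn: "0 \<le> C * (A * m)" "0 \<le> ?E * (A * m * \<delta>)" using C E A m0 \<delta>(1) by (auto intro!: mult_nonneg_nonneg)
    have "ennreal (C * A) * ennreal m = ennreal (C * A * m)"
      using C(1) A m0 by (intro ennreal_mult[symmetric]) simp_all
    moreover have "ennreal (?E * (A * m)) * ennreal \<delta> = ennreal (?E * (A * m) * \<delta>)"
      using A m0 \<delta>(1) by (intro ennreal_mult[symmetric] mult_nonneg_nonneg[OF E]) simp_all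
    ultimately show ?thesis unfolding ennreal_plus[OF nn] by (simp only: mult.assoc)
  qed
  also have "\<dots> \<le> ennreal (C * 1 + ?E * 1)"
    using C E Am1 Am\<delta> by (intro ennreal_leI add_mono mult_left_mono) auto
  finally have "(\<integral>\<^sup>+ x. marc a x * indicator (pts (dilate 2 B)) x \<partial>\<mu>) \<le> ennreal (C + ?E)" by simp
  moreover have "(\<integral>\<^sup>+ x. ennreal (cmod (a x)) \<partial>\<mu>) \<le> 1"
    using L1 Am1 by (metis ennreal_1 ennreal_leI order_trans)
  ultimately show ?thesis using bA that by blast
qed

section \<open>Blocks, finite sums of blocks, and the two implications\<close>

lemma bdd_cmult: "bdd A g \<Longrightarrow> bdd (cmod k * A) (\<lambda>y. k * g y)"
  unfolding bdd_def by (auto simp: norm_mult elim!: eventually_mono intro!: mult_left_mono)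

text \<open>For a proper block the atoms are estimated separately on 2B, while off 2B only their
  combination has mean zero and decays. The constant block is the case of \<open>marc_one\<close>.
  Boundedness of b is recorded because subadditivity is available for bounded functions.\<close>

lemma atomic_block_marc_bound:
  assumes C: "0 \<le> C" "local_bound \<rho> C" and \<rho>: "1 < \<rho>"
    and b: "atomic_block \<mu> lam \<rho> \<infinity> b s"
  shows "(\<exists>A. bdd A b) \<and> (\<integral>\<^sup>+ x. marc b x \<partial>\<mu>) \<le> ennreal (C + CK * Clam * growth 2 + cmean) * ennreal s"
proof -
  let ?E = "CK * Clam * growth 2"
  have E: "0 \<le> ?E" using CK_pos Clam_ge_1 by simp
  have cm: "0 \<le> cmean" using CK_pos Clam_ge_1 by (simp add: cmean_def)
  from b consider "proper_atomic_block \<mu> lam \<rho> \<infinity> b s"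
    | k where "emeasure \<mu> UNIV < \<infinity>" "b = (\<lambda>_. k * of_real (inverse (measure \<mu> UNIV)))" "s = cmod k"
    unfolding atomic_block_def by blast
  then show ?thesis
  proof cases
    case 2
    define m where "m = measure \<mu> (UNIV :: 'a set)"
    have m: "emeasure \<mu> UNIV = ennreal m" using 2(1) by (simp add: m_def emeasure_eq_ennreal_measure)
    define l where "l = k * of_real (inverse m)"
    have b1: "bdd 1 (\<lambda>_::'a. 1 :: complex)" by (simp add: bdd_def)
    have bl: "b = (\<lambda>y. l * 1)" by (simp add: 2(2) l_def m_def)
    have mm: "(\<lambda>x. marc (\<lambda>_. 1) x) \<in> borel_measurable \<mu>" by (rule marc_measurable[OF bdd_measurable[OF b1]])
    have "(\<integral>\<^sup>+ x. marc b x \<partial>\<mu>) \<le> (\<integral>\<^sup>+ x. ennreal (cmod l) * marc (\<lambda>_. 1) x \<partial>\<mu>)"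
      unfolding bl by (intro nn_integral_mono marc_cmult) simp
    also have "\<dots> = ennreal (cmod l) * (\<integral>\<^sup>+ x. marc (\<lambda>_. 1) x \<partial>\<mu>)" by (rule nn_integral_cmult[OF mm])
    also have "\<dots> \<le> ennreal (cmod l) * (ennreal C * emeasure \<mu> UNIV)"
      by (intro mult_left_mono marc_one[OF 2(1) C]) simp
    also have "\<dots> = ennreal (C * (cmod l * m))"
      unfolding m using C by (simp add: ennreal_mult[symmetric] m_def mult_ac)
    also have "\<dots> \<le> ennreal ((C + ?E + cmean) * s)"
    proof (intro ennreal_leI mult_mono)
      have "cmod l * m \<le> cmod k"
      proof (cases "m = 0")
        case False
        then have "0 < m" using measure_nonneg[of \<mu> "UNIV :: 'a set"] unfolding m_def by linarith
        then show ?thesis by (simp add: l_def norm_mult norm_inverse mult.assoc)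
      qed simp
      then show "cmod l * m \<le> s" by (simp add: 2(3))
    qed (use C E cm in \<open>auto simp: m_def\<close>)
    finally have "(\<integral>\<^sup>+ x. marc b x \<partial>\<mu>) \<le> ennreal ((C + ?E + cmean) * s)" .
    moreover have "bdd (cmod l * 1) b" unfolding bl by (rule bdd_cmult[OF b1])
    ultimately show ?thesis using C E cm 2(3) by (auto simp: ennreal_mult)
  next
    case 1
    then obtain B and a :: "nat \<Rightarrow> 'a \<Rightarrow> complex" and Q and \<kappa> :: "nat \<Rightarrow> complex" where B: "is_ball B"
      and supp: "\<forall>x. x \<notin> pts B \<longrightarrow> b x = 0" and mean: "(LINT x|\<mu>. b x) = 0"
      and atoms: "\<forall>j\<in>{1,2}. is_ball (Q j) \<and> pts (Q j) \<subseteq> pts B \<and>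
              a j \<in> borel_measurable \<mu> \<and> (\<forall>x. x \<notin> pts (Q j) \<longrightarrow> a j x = 0) \<and>
              Lp_norm \<mu> \<infinity> (a j) \<le>
                ennreal (measure \<mu> (pts (dilate \<rho> (Q j))) powr (real_of_ereal (1 / \<infinity>) - 1)
                         * inverse (1 + delta \<mu> lam (Q j) B))"
      and bk: "\<forall>x. b x = \<kappa> 1 * a 1 x + \<kappa> 2 * a 2 x" and s: "s = cmod (\<kappa> 1) + cmod (\<kappa> 2)"
      unfolding proper_atomic_block_def by (elim conjE exE) (rule that; assumption)
    note supp = supp[rule_format] and bk = bk[rule_format]
    obtain c r where Bc: "B = (c, r)" and r: "0 < r" using B by (cases B) (auto simp: is_ball_def)
    have *: "\<exists>A. bdd A (a j) \<and> (\<integral>\<^sup>+ x. ennreal (cmod (a j x)) \<partial>\<mu>) \<le> 1 \<and>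
        (\<integral>\<^sup>+ x. marc (a j) x * indicator (pts (dilate 2 B)) x \<partial>\<mu>) \<le> ennreal (C + ?E)" if "j \<in> {1,2}" for j
    proof -
      from bspec[OF atoms that] have h: "is_ball (Q j)" "a j \<in> borel_measurable \<mu>" "\<And>x. x \<notin> pts (Q j) \<Longrightarrow> a j x = 0"
        "Lp_norm \<mu> \<infinity> (a j) \<le> ennreal (measure \<mu> (pts (dilate \<rho> (Q j))) powr (real_of_ereal (1 / \<infinity>) - 1)
                         * inverse (1 + delta \<mu> lam (Q j) B))" by auto
      show ?thesis by (rule atom_marc_bound[OF C \<rho> h(1) B h(2) h(3) h(4)]) auto
    qed
    obtain A1 where a1: "bdd A1 (a 1)" "(\<integral>\<^sup>+ x. ennreal (cmod (a 1 x)) \<partial>\<mu>) \<le> 1"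
        "(\<integral>\<^sup>+ x. marc (a 1) x * indicator (pts (dilate 2 B)) x \<partial>\<mu>) \<le> ennreal (C + ?E)" using *[of 1] by auto
    obtain A2 where a2: "bdd A2 (a 2)" "(\<integral>\<^sup>+ x. ennreal (cmod (a 2 x)) \<partial>\<mu>) \<le> 1"
        "(\<integral>\<^sup>+ x. marc (a 2) x * indicator (pts (dilate 2 B)) x \<partial>\<mu>) \<le> ennreal (C + ?E)" using *[of 2] by auto
    have be: "b = (\<lambda>y. \<kappa> 1 * a 1 y + \<kappa> 2 * a 2 y)" using bk by auto
    note b1 = bdd_cmult[OF a1(1), of "\<kappa> 1"] and b2 = bdd_cmult[OF a2(1), of "\<kappa> 2"]
    have bb: "bdd (cmod (\<kappa> 1) * A1 + cmod (\<kappa> 2) * A2) b" unfolding be by (rule bdd_add[OF b1 b2])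
    let ?D = "pts (dilate 2 B)"
    have D: "?D = ball c (2 * r)" by (simp add: Bc pts_def dilate_def)
    have Dm [measurable]: "?D \<in> sets \<mu>" "- ?D \<in> sets \<mu>" using sets.compl_sets[of ?D \<mu>] by (auto simp: D Compl_eq_Diff_UNIV)
    note [measurable] = bdd_measurable[OF a1(1)] bdd_measurable[OF a2(1)]
    note [measurable] = marc_measurable[OF bdd_measurable[OF a1(1)]] marc_measurable[OF bdd_measurable[OF a2(1)]]
      marc_measurable[OF bdd_measurable[OF bb]]
    have near: "(\<integral>\<^sup>+ x. marc b x * indicator ?D x \<partial>\<mu>) \<le> ennreal (C + ?E) * ennreal s"
    proof -
      have "(\<integral>\<^sup>+ x. marc b x * indicator ?D x \<partial>\<mu>)
         \<le> (\<integral>\<^sup>+ x. ennreal (cmod (\<kappa> 1)) * (marc (a 1) x * indicator ?D x) + ennreal (cmod (\<kappa> 2)) * (marc (a 2) x * indicator ?D x) \<partial>\<mu>)"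
      proof (intro nn_integral_mono)
        fix x
        have "marc b x \<le> marc (\<lambda>y. \<kappa> 1 * a 1 y) x + marc (\<lambda>y. \<kappa> 2 * a 2 y) x"
          unfolding be by (rule marc_triangle[OF b1 b2])
        also have "\<dots> \<le> ennreal (cmod (\<kappa> 1)) * marc (a 1) x + ennreal (cmod (\<kappa> 2)) * marc (a 2) x"
          by (intro add_mono marc_cmult bdd_measurable[OF a1(1)] bdd_measurable[OF a2(1)])
        finally show "marc b x * indicator ?D x
          \<le> ennreal (cmod (\<kappa> 1)) * (marc (a 1) x * indicator ?D x) + ennreal (cmod (\<kappa> 2)) * (marc (a 2) x * indicator ?D x)"
          by (cases "x \<in> ?D") auto
      qed
      also have "\<dots> = ennreal (cmod (\<kappa> 1)) * (\<integral>\<^sup>+ x. marc (a 1) x * indicator ?D x \<partial>\<mu>)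
          + ennreal (cmod (\<kappa> 2)) * (\<integral>\<^sup>+ x. marc (a 2) x * indicator ?D x \<partial>\<mu>)"
        by (subst nn_integral_add, measurable) (simp add: nn_integral_cmult del: One_nat_def)
      also have "\<dots> \<le> ennreal (cmod (\<kappa> 1)) * ennreal (C + ?E) + ennreal (cmod (\<kappa> 2)) * ennreal (C + ?E)"
        by (intro add_mono mult_left_mono a1(3) a2(3)) auto
      also have "\<dots> = ennreal (C + ?E) * ennreal s"
        unfolding s by (simp add: distrib_left mult.commute)
      finally show ?thesis .
    qed
    have L1: "(\<integral>\<^sup>+ x. ennreal (cmod (b x)) \<partial>\<mu>) \<le> ennreal s"
    proof -
      have "(\<integral>\<^sup>+ x. ennreal (cmod (b x)) \<partial>\<mu>)
         \<le> (\<integral>\<^sup>+ x. ennreal (cmod (\<kappa> 1)) * ennreal (cmod (a 1 x)) + ennreal (cmod (\<kappa> 2)) * ennreal (cmod (a 2 x)) \<partial>\<mu>)"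
      proof (intro nn_integral_mono)
        fix x
        have "cmod (b x) \<le> cmod (\<kappa> 1) * cmod (a 1 x) + cmod (\<kappa> 2) * cmod (a 2 x)"
          unfolding bk using norm_triangle_ineq[of "\<kappa> 1 * a 1 x" "\<kappa> 2 * a 2 x"] by (simp only: norm_mult)
        then have "ennreal (cmod (b x)) \<le> ennreal (cmod (\<kappa> 1) * cmod (a 1 x) + cmod (\<kappa> 2) * cmod (a 2 x))" by (rule ennreal_leI)
        then show "ennreal (cmod (b x)) \<le> ennreal (cmod (\<kappa> 1)) * ennreal (cmod (a 1 x)) + ennreal (cmod (\<kappa> 2)) * ennreal (cmod (a 2 x))"
          by (simp add: ennreal_mult)
      qed
      also have "\<dots> = ennreal (cmod (\<kappa> 1)) * (\<integral>\<^sup>+ x. ennreal (cmod (a 1 x)) \<partial>\<mu>) + ennreal (cmod (\<kappa> 2)) * (\<integral>\<^sup>+ x. ennreal (cmod (a 2 x)) \<partial>\<mu>)"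
        by (subst nn_integral_add, measurable) (simp add: nn_integral_cmult del: One_nat_def)
      also have "\<dots> \<le> ennreal (cmod (\<kappa> 1)) * 1 + ennreal (cmod (\<kappa> 2)) * 1"
        by (intro add_mono mult_left_mono a1(2) a2(2)) auto
      also have "\<dots> = ennreal s" by (simp add: s)
      finally show ?thesis .
    qed
    have far: "(\<integral>\<^sup>+ x. marc b x * indicator (- ?D) x \<partial>\<mu>) \<le> ennreal cmean * ennreal s"
    proof -
      have "(\<integral>\<^sup>+ x. marc b x * indicator (- ?D) x \<partial>\<mu>) \<le> ennreal cmean * (\<integral>\<^sup>+ x. ennreal (cmod (b x)) \<partial>\<mu>)"
        unfolding D
      proof (rule marc_mean_zero_far[OF bb r _ mean])
        show "b y = 0" if "y \<notin> ball c r" for y using supp[of y] that by (simp add: Bc pts_def)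
      qed
      also have "\<dots> \<le> ennreal cmean * ennreal s" by (intro mult_left_mono L1) simp
      finally show ?thesis .
    qed
    have "(\<integral>\<^sup>+ x. marc b x \<partial>\<mu>) = (\<integral>\<^sup>+ x. marc b x * indicator ?D x + marc b x * indicator (- ?D) x \<partial>\<mu>)"
      by (intro nn_integral_cong) (auto simp: indicator_def)
    also have "\<dots> = (\<integral>\<^sup>+ x. marc b x * indicator ?D x \<partial>\<mu>) + (\<integral>\<^sup>+ x. marc b x * indicator (- ?D) x \<partial>\<mu>)"
      by (rule nn_integral_add) measurable
    also have "\<dots> \<le> ennreal (C + ?E) * ennreal s + ennreal cmean * ennreal s" by (intro add_mono near far)
    also have "\<dots> = ennreal (C + ?E + cmean) * ennreal s"
      using C E cm by (subst ennreal_plus[of "C + ?E"]) (auto simp: distrib_right)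
    finally show ?thesis using bb by blast
  qed
qed

lemma marc_bounded_on_H1_fin:
  assumes C: "0 \<le> C" "local_bound \<rho> C" and \<rho>: "1 < \<rho>"
  shows "bounded_into_L1 \<mu> (H1_fin \<mu> lam \<rho> \<infinity>) (H1_fin_norm \<mu> lam \<rho> \<infinity>) marc"
proof -
  define D where "D = C + CK * Clam * growth 2 + cmean"
  have D: "0 < D" using C CK_pos Clam_ge_1 by (simp add: D_def cmean_def add_nonneg_pos)
  have dec: "(\<integral>\<^sup>+ x. marc f x \<partial>\<mu>) \<le> ennreal D * ennreal (\<Sum>j<N. s j)"
    if fm: "f \<in> borel_measurable \<mu>" and d: "fin_decomposition \<mu> lam \<rho> \<infinity> f N b s" for f N b s
  proof -
    have blk: "atomic_block \<mu> lam \<rho> \<infinity> (b j) (s j)" if "j < N" for j using d that by (simp add: fin_decomposition_def)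
    have ae: "AE x in \<mu>. f x = (\<Sum>j<N. b j x)" using d by (simp add: fin_decomposition_def)
    have s0: "0 \<le> s j" if "j < N" for j
      using blk[OF that] unfolding atomic_block_def proper_atomic_block_def by auto
    have "\<forall>j. \<exists>A. j < N \<longrightarrow> bdd A (b j)" using atomic_block_marc_bound[OF C \<rho> blk] by blast
    then obtain A where A: "\<And>j. j < N \<Longrightarrow> bdd (A j) (b j)" by metis
    have bi: "(\<integral>\<^sup>+ x. marc (b j) x \<partial>\<mu>) \<le> ennreal D * ennreal (s j)" if "j < N" for j
      using atomic_block_marc_bound[OF C \<rho> blk[OF that]] by (simp add: D_def)
    have "(\<integral>\<^sup>+ x. marc f x \<partial>\<mu>) \<le> (\<integral>\<^sup>+ x. (\<Sum>j<N. marc (b j) x) \<partial>\<mu>)"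
    proof (intro nn_integral_mono)
      fix x
      have "marc f x = marc (\<lambda>x. \<Sum>j<N. b j x) x"
        using A by (intro marc_cong_AE fm ae borel_measurable_sum bdd_measurable) auto
      also have "\<dots> \<le> (\<Sum>j<N. marc (b j) x)" using marc_sum[of "{..<N}" A b x] A by simp
      finally show "marc f x \<le> (\<Sum>j<N. marc (b j) x)" .
    qed
    also have "\<dots> = (\<Sum>j<N. \<integral>\<^sup>+ x. marc (b j) x \<partial>\<mu>)"
      using A by (intro nn_integral_sum marc_measurable bdd_measurable) auto
    also have "\<dots> \<le> (\<Sum>j<N. ennreal D * ennreal (s j))" by (intro sum_mono bi) simp
    also have "\<dots> = ennreal D * (\<Sum>j<N. ennreal (s j))" by (simp only: sum_distrib_left)
    also have "(\<Sum>j<N. ennreal (s j)) = ennreal (\<Sum>j<N. s j)"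
      using s0 by (intro sum_ennreal) auto
    finally show ?thesis .
  qed
  show ?thesis
    unfolding bounded_into_L1_def
  proof (intro exI[of _ D] conjI ballI)
    fix f assume "f \<in> H1_fin \<mu> lam \<rho> \<infinity>"
    then have fm: "f \<in> borel_measurable \<mu>" by (simp add: H1_fin_def)
    show "marc f \<in> borel_measurable \<mu>" by (rule marc_measurable[OF fm])
    let ?I = "\<integral>\<^sup>+ x. marc f x \<partial>\<mu>"
    have inv: "ennreal (1 / D) * ennreal D = 1" using D by (simp add: ennreal_mult[symmetric])
    \<comment> \<open>Divided by D, the estimate is a lower bound for the size of every
      decomposition and hence for their infimum; no product has to be moved through the
      infimum.\<close>
    have "ennreal (1 / D) * ?I \<le> H1_fin_norm \<mu> lam \<rho> \<infinity> f"
      unfolding H1_fin_norm_def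
    proof (rule Inf_greatest, clarify)
      fix N b s assume d: "fin_decomposition \<mu> lam \<rho> \<infinity> f N b s"
      have "ennreal (1 / D) * ?I \<le> ennreal (1 / D) * (ennreal D * ennreal (\<Sum>j<N. s j))"
        by (intro mult_left_mono dec[OF fm d]) simp
      then show "ennreal (1 / D) * ?I \<le> ennreal (\<Sum>j<N. s j)" by (simp add: mult.assoc[symmetric] inv)
    qed
    then have "ennreal D * (ennreal (1 / D) * ?I) \<le> ennreal D * H1_fin_norm \<mu> lam \<rho> \<infinity> f" by (rule mult_left_mono) simp
    moreover have "ennreal D * (ennreal (1 / D) * ?I) = ?I"
      using inv by (simp add: mult.assoc[symmetric] mult.commute)
    ultimately show "?I \<le> ennreal D * H1_fin_norm \<mu> lam \<rho> \<infinity> f" by simp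
  qed (rule D)
qed

text \<open>The local bound is used with three enlargements: 2 for local integrability,
  \<open>sqrt \<eta>\<close> for the oscillation condition and \<open>sqrt \<rho>\<close> for the
  condition on pairs of doubling balls.\<close>

lemma RBLO_of_H1:
  assumes \<rho>H: "1 < \<rho>H" and p: "1 < p" and \<eta>: "1 < \<eta>" and \<rho>: "1 < \<rho>"
    and bnd: "bounded_into_L1 \<mu> (H1_atb \<mu> lam \<rho>H p) (H1_atb_norm \<mu> lam \<rho>H p) marc"
  shows "\<exists>C::real. 0 < C \<and> (\<forall>f\<in>Linf \<mu>. \<forall>x0. marc f x0 < \<infinity> \<longrightarrow>
    (AE x in \<mu>. marc f x < \<infinity>) \<and> (\<lambda>x. enn2real (marc f x)) \<in> RBLO \<mu> lam Clam N0 \<eta> \<rho> \<and>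
    RBLO_norm \<mu> lam Clam N0 \<eta> \<rho> (\<lambda>x. enn2real (marc f x)) \<le> ennreal C * Lp_norm \<mu> \<infinity> f)"
proof -
  obtain C2 where C2: "0 \<le> C2" "local_bound 2 C2" using local_bound_of_H1[OF \<rho>H p bnd, of 2] by auto
  obtain C\<eta> where C\<eta>: "0 \<le> C\<eta>" "local_bound (sqrt \<eta>) C\<eta>" using local_bound_of_H1[OF \<rho>H p bnd, of "sqrt \<eta>"] \<eta> by auto
  obtain C\<rho> where C\<rho>: "0 \<le> C\<rho>" "local_bound (sqrt \<rho>) C\<rho>" using local_bound_of_H1[OF \<rho>H p bnd, of "sqrt \<rho>"] \<rho> by auto
  define D where "D = (C\<eta> + CK * cwt (sqrt \<eta>) * (ctilde \<rho> + growth 8) + cfar)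
      + (beta Clam N0 \<rho> * C\<rho> + CK * cwt (sqrt \<rho>) * (1 + growth 9) + cfar)"
  show ?thesis
  proof (intro exI[of _ "\<bar>D\<bar> + 1"] conjI ballI allI impI)
    fix f x0 assume f: "f \<in> Linf \<mu>" and fin: "marc f x0 < \<infinity>"
    define A where "A = enn2real (Lp_norm \<mu> \<infinity> f)"
    have LA: "Lp_norm \<mu> \<infinity> f = ennreal A" using f by (simp add: A_def Linf_def)
    have "AE y in \<mu>. ennreal (cmod (f y)) \<le> ennreal A"
      using esssup_AE[of "\<lambda>x. ennreal (cmod (f x))" \<mu>] LA by (simp add: Lp_norm_def)
    moreover have A: "0 \<le> A" by (simp add: A_def)
    ultimately have b: "bdd A f" using f by (simp add: bdd_def Linf_def)
    show "AE x in \<mu>. marc f x < \<infinity>" by (rule marc_AE_finite[OF b fin C2(2)])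
    note R = marc_in_RBLO[OF \<eta> \<rho> C2(2) C\<eta> C\<rho> D_def b fin]
    show "(\<lambda>x. enn2real (marc f x)) \<in> RBLO \<mu> lam Clam N0 \<eta> \<rho>"
      unfolding RBLO_def using R by blast
    have "RBLO_norm \<mu> lam Clam N0 \<eta> \<rho> (\<lambda>x. enn2real (marc f x)) \<le> ennreal (D * A)"
      unfolding RBLO_norm_def using R by (intro Inf_lower) blast
    also have "\<dots> \<le> ennreal ((\<bar>D\<bar> + 1) * A)" using A by (intro ennreal_leI mult_right_mono) auto
    also have "\<dots> = ennreal (\<bar>D\<bar> + 1) * Lp_norm \<mu> \<infinity> f" unfolding LA using A by (intro ennreal_mult) auto
    finally show "RBLO_norm \<mu> lam Clam N0 \<eta> \<rho> (\<lambda>x. enn2real (marc f x)) \<le> ennreal (\<bar>D\<bar> + 1) * Lp_norm \<mu> \<infinity> f" .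
  qed simp
qed

end

theorem theorem1p2:
  fixes \<mu> :: "'a::metric_space measure"
    and lam :: "'a \<Rightarrow> real \<Rightarrow> real"
    and Clam :: real
    and N0 :: nat
    and K :: "'a \<Rightarrow> 'a \<Rightarrow> complex"
  assumes "non_homogeneous_space \<mu> lam Clam N0"
    and "marcinkiewicz_kernel \<mu> lam K"
  shows
    "(\<forall>(\<rho>\<^sub>H::real) (p::ereal) (\<eta>::real) (\<rho>::real).
        1 < \<rho>\<^sub>H \<longrightarrow> 1 < p \<longrightarrow> 1 < \<eta> \<longrightarrow> 1 < \<rho> \<longrightarrow>
        bounded_into_L1 \<mu> (H1_atb \<mu> lam \<rho>\<^sub>H p) (H1_atb_norm \<mu> lam \<rho>\<^sub>H p) (marcinkiewicz \<mu> K) \<longrightarrow>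
        (\<exists>C::real. 0 < C \<and>
           (\<forall>f\<in>Linf \<mu>.
              ((\<forall>x. marcinkiewicz \<mu> K f x = \<infinity>) \<or> (AE x in \<mu>. marcinkiewicz \<mu> K f x < \<infinity>)) \<and>
              ((\<exists>x0. marcinkiewicz \<mu> K f x0 < \<infinity>) \<longrightarrow>
                 (AE x in \<mu>. marcinkiewicz \<mu> K f x < \<infinity>) \<and>
                 (\<lambda>x. enn2real (marcinkiewicz \<mu> K f x)) \<in> RBLO \<mu> lam Clam N0 \<eta> \<rho> \<and>
                 RBLO_norm \<mu> lam Clam N0 \<eta> \<rho> (\<lambda>x. enn2real (marcinkiewicz \<mu> K f x))
                   \<le> ennreal C * Lp_norm \<mu> \<infinity> f))))
     \<and>
     (\<forall>(\<rho>\<^sub>R::real) (\<rho>\<^sub>H::real).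
        1 < \<rho>\<^sub>R \<longrightarrow> 1 < \<rho>\<^sub>H \<longrightarrow>
        (\<exists>C::real. 0 < C \<and>
           (\<forall>f\<in>Linf_b \<mu>.
              (AE x in \<mu>. marcinkiewicz \<mu> K f x < \<infinity>) \<and>
              (\<lambda>x. of_real (enn2real (marcinkiewicz \<mu> K f x))) \<in> RBMO \<mu> lam \<rho>\<^sub>R \<and>
              RBMO_norm \<mu> lam \<rho>\<^sub>R (\<lambda>x. of_real (enn2real (marcinkiewicz \<mu> K f x)))
                \<le> ennreal C * Lp_norm \<mu> \<infinity> f)) \<longrightarrow>
        bounded_into_L1 \<mu> (H1_fin \<mu> lam \<rho>\<^sub>H \<infinity>) (H1_fin_norm \<mu> lam \<rho>\<^sub>H \<infinity>) (marcinkiewicz \<mu> K))"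
proof -
  interpret nonhomogeneous \<mu> lam Clam N0 by unfold_locales (rule assms(1))
  \<comment> \<open>The values on the diagonal are irrelevant, and a kernel vanishing there is measurable.\<close>
  define K' where "K' x y = (if x = y then 0 else K x y)" for x y
  note kernel = assms(2)[unfolded marcinkiewicz_kernel_def]
  have loc: "\<exists>r>0. set_integrable (\<mu> \<Otimes>\<^sub>M \<mu>) (ball x r \<times> ball y r) (\<lambda>(u, v). K u v)" if "x \<noteq> y" for x y
    by (rule kernel[THEN conjunct1, rule_format, OF that])
  from kernel[THEN conjunct2] obtain CK where K: "0 < CK \<and>
        (\<forall>x y. x \<noteq> y \<longrightarrow> cmod (K x y) \<le> CK * (dist x y / lam x (dist x y))) \<and>
        (\<forall>y y'.
           (\<integral>\<^sup>+ x\<in>{x. 2 * dist y y' \<le> dist x y}.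
              ennreal ((cmod (K x y - K x y') + cmod (K y x - K y' x)) * (1 / dist x y)) \<partial>\<mu>)
           \<le> ennreal CK)" ..
  note CK = K[THEN conjunct1]
    and size = K[THEN conjunct2, THEN conjunct1, rule_format]
    and reg = K[THEN conjunct2, THEN conjunct2, rule_format]
  interpret marcinkiewicz_space \<mu> lam Clam N0 K' CK
  proof unfold_locales
    show "(\<lambda>p. K' (fst p) (snd p)) \<in> borel_measurable (\<mu> \<Otimes>\<^sub>M \<mu>)"
      unfolding K'_def by (rule kernel_measurable[OF loc])
    show "K' x x = 0" for x by (simp add: K'_def)
    show "0 < CK" by (rule CK)
    show "cmod (K' x y) \<le> CK * (dist x y * wt x y)" for x y
      using size[of x y] CK by (auto simp: K'_def wt_def)
    fix y y'
    show "(\<integral>\<^sup>+ x. ennreal ((cmod (K' x y - K' x y') + cmod (K' y x - K' y' x)) * (1 / dist x y))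
        * indicator {x. 2 * dist y y' \<le> dist x y} x \<partial>\<mu>) \<le> ennreal CK"
    proof (rule order_trans[OF nn_integral_mono reg[of y y']])
      fix x
      show "ennreal ((cmod (K' x y - K' x y') + cmod (K' y x - K' y' x)) * (1 / dist x y)) * indicator {x. 2 * dist y y' \<le> dist x y} x
        \<le> ennreal ((cmod (K x y - K x y') + cmod (K y x - K y' x)) * (1 / dist x y)) * indicator {x. 2 * dist y y' \<le> dist x y} x"
      \<comment> \<open>For y = y' the left side is zero. Otherwise the region of integration keeps
        x away from both y and y', where the two kernels agree.\<close>
      proof (cases "y = y' \<or> \<not> 2 * dist y y' \<le> dist x y")
        case False
        then have "x \<noteq> y" "x \<noteq> y'" using zero_less_dist_iff[of y y'] by (auto simp: dist_commute)
        then show ?thesis by (auto simp: K'_def)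
      qed auto
    qed
  qed
  have eq: "marcinkiewicz \<mu> K' f x = marcinkiewicz \<mu> K f x" for f x
  proof -
    have "(LINT y : {y. y \<noteq> x \<and> dist x y < t} | \<mu>. K' x y * f y) = (LINT y : {y. y \<noteq> x \<and> dist x y < t} | \<mu>. K x y * f y)" for t
      unfolding set_lebesgue_integral_def
      by (intro Bochner_Integration.integral_cong) (auto simp: indicator_def K'_def)
    then show ?thesis by (simp add: marcinkiewicz_def)
  qed
  have eqf: "marcinkiewicz \<mu> K' = marcinkiewicz \<mu> K" by (intro ext eq)
  show ?thesis
  proof (intro conjI allI impI)
    fix \<rho>H p \<eta> \<rho>
    assume "1 < (\<rho>H::real)" "1 < (p::ereal)" "1 < (\<eta>::real)" "1 < (\<rho>::real)"
      "bounded_into_L1 \<mu> (H1_atb \<mu> lam \<rho>H p) (H1_atb_norm \<mu> lam \<rho>H p) (marcinkiewicz \<mu> K)"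
    from RBLO_of_H1[unfolded eqf, OF this] obtain C where C: "0 < C" "\<And>f x0. f \<in> Linf \<mu> \<Longrightarrow> marcinkiewicz \<mu> K f x0 < \<infinity> \<Longrightarrow>
      (AE x in \<mu>. marcinkiewicz \<mu> K f x < \<infinity>) \<and> (\<lambda>x. enn2real (marcinkiewicz \<mu> K f x)) \<in> RBLO \<mu> lam Clam N0 \<eta> \<rho> \<and>
      RBLO_norm \<mu> lam Clam N0 \<eta> \<rho> (\<lambda>x. enn2real (marcinkiewicz \<mu> K f x)) \<le> ennreal C * Lp_norm \<mu> \<infinity> f" by blast
    show "\<exists>C::real. 0 < C \<and>
           (\<forall>f\<in>Linf \<mu>.
              ((\<forall>x. marcinkiewicz \<mu> K f x = \<infinity>) \<or> (AE x in \<mu>. marcinkiewicz \<mu> K f x < \<infinity>)) \<and>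
              ((\<exists>x0. marcinkiewicz \<mu> K f x0 < \<infinity>) \<longrightarrow>
                 (AE x in \<mu>. marcinkiewicz \<mu> K f x < \<infinity>) \<and>
                 (\<lambda>x. enn2real (marcinkiewicz \<mu> K f x)) \<in> RBLO \<mu> lam Clam N0 \<eta> \<rho> \<and>
                 RBLO_norm \<mu> lam Clam N0 \<eta> \<rho> (\<lambda>x. enn2real (marcinkiewicz \<mu> K f x))
                   \<le> ennreal C * Lp_norm \<mu> \<infinity> f))"
    proof (intro exI[of _ C] conjI ballI impI)
      fix f assume f: "f \<in> Linf \<mu>"
      show "(\<forall>x. marcinkiewicz \<mu> K f x = \<infinity>) \<or> (AE x in \<mu>. marcinkiewicz \<mu> K f x < \<infinity>)"
        using C(2)[OF f] by (metis infinity_ennreal_def top.not_eq_extremum)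
      assume "\<exists>x0. marcinkiewicz \<mu> K f x0 < \<infinity>"
      then obtain x0 where "marcinkiewicz \<mu> K f x0 < \<infinity>" ..
      note * = C(2)[OF f this]
      show "AE x in \<mu>. marcinkiewicz \<mu> K f x < \<infinity>" using * by blast
      show "(\<lambda>x. enn2real (marcinkiewicz \<mu> K f x)) \<in> RBLO \<mu> lam Clam N0 \<eta> \<rho>" using * by blast
      show "RBLO_norm \<mu> lam Clam N0 \<eta> \<rho> (\<lambda>x. enn2real (marcinkiewicz \<mu> K f x)) \<le> ennreal C * Lp_norm \<mu> \<infinity> f" using * by blast
    qed (rule C(1))
  next
    fix \<rho>R \<rho>H :: real
    assume \<rho>: "1 < \<rho>R" "1 < \<rho>H"
    assume "\<exists>C::real. 0 < C \<and>
           (\<forall>f\<in>Linf_b \<mu>.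
              (AE x in \<mu>. marcinkiewicz \<mu> K f x < \<infinity>) \<and>
              (\<lambda>x. of_real (enn2real (marcinkiewicz \<mu> K f x))) \<in> RBMO \<mu> lam \<rho>R \<and>
              RBMO_norm \<mu> lam \<rho>R (\<lambda>x. of_real (enn2real (marcinkiewicz \<mu> K f x)))
                \<le> ennreal C * Lp_norm \<mu> \<infinity> f)"
    then obtain C0 where C0: "0 < C0" "\<And>f. f \<in> Linf_b \<mu> \<Longrightarrow> (AE x in \<mu>. marcinkiewicz \<mu> K f x < \<infinity>) \<and>
        RBMO_norm \<mu> lam \<rho>R (\<lambda>x. of_real (enn2real (marcinkiewicz \<mu> K f x))) \<le> ennreal C0 * Lp_norm \<mu> \<infinity> f" by blast
    obtain C where C: "0 \<le> C" "local_bound \<rho>H C"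
      using local_bound_of_RBMO[unfolded eqf, OF \<rho>(1) C0(1) \<rho>(2) C0(2)] by blast
    show "bounded_into_L1 \<mu> (H1_fin \<mu> lam \<rho>H \<infinity>) (H1_fin_norm \<mu> lam \<rho>H \<infinity>) (marcinkiewicz \<mu> K)"
      using marc_bounded_on_H1_fin[OF C \<rho>(2)] unfolding eqf .
  qed
qed

end
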